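(* For every $n\ge1$ there exists a bijection $\mathcal{C}:\mathfrak{W}_n\to\mathfrak{W}_n$ such that, for every $w\in\mathfrak{W}_n$, setting $u=\mathcal{C}(w)$, we have $w\sim_{rid}u$, $$w_2\cdots w_n\sim_{cid}u_1\cdots u_{n-1},$$ and the set of integers occurring in $u$ equals the set of integers occurring in $w$.
   Context: $\mathfrak{W}_n$ is the set of words of length $n$ whose letters are positive integers. For a word $x$, $\mathrm{lis}(x)$ and $\mathrm{lds}(x)$ are the lengths of a longest strictly increasing and strictly decreasing subsequence of $x$. For words $u,w$ of the same length $N$, $u\sim_{cid}w$ means $\mathrm{lis}(u_i\cdots u_j)=\mathrm{lis}(w_i\cdots w_j)$ and $\mathrm{lds}(u_i\cdots u_j)=\mathrm{lds}(w_i\cdots w_j)$ for all $1\le i\le j\le N$. $u\sim_{rid}w$ means that for every integer interval $[a,b]$, the words $u',w'$ obtained from $u,w$ by deleting all letters not in $[a,b]$ satisfy $\mathrm{lis}(u')=\mathrm{lis}(w')$ and $\mathrm{lds}(u')=\mathrm{lds}(w')$. *)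

theory Defs
  imports Main "HOL-Library.Sublist"
begin

definition words :: "nat \<Rightarrow> int list set" where
  "words n = {w. length w = n \<and> (\<forall>x\<in>set w. 0 < x)}"

definition lis :: "'a::linorder list \<Rightarrow> nat" where
  "lis x = Max (length ` {v. subseq v x \<and> sorted_wrt (<) v})"

definition lds :: "'a::linorder list \<Rightarrow> nat" where
  "lds x = Max (length ` {v. subseq v x \<and> sorted_wrt (>) v})"

text \<open>The factor \<open>x\<^sub>i \<dots> x\<^sub>j\<close>, with positions counted from 1.\<close>
definition factor :: "nat \<Rightarrow> nat \<Rightarrow> 'a list \<Rightarrow> 'a list" where
  "factor i j x = drop (i - 1) (take j x)"

definition cid :: "'a::linorder list \<Rightarrow> 'a list \<Rightarrow> bool"  (infix "\<sim>cid" 50) where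
  "u \<sim>cid w \<longleftrightarrow> length u = length w \<and>
     (\<forall>i j. 1 \<le> i \<and> i \<le> j \<and> j \<le> length u \<longrightarrow>
        lis (factor i j u) = lis (factor i j w) \<and> lds (factor i j u) = lds (factor i j w))"

definition rid :: "'a::linorder list \<Rightarrow> 'a list \<Rightarrow> bool"  (infix "\<sim>rid" 50) where
  "u \<sim>rid w \<longleftrightarrow> length u = length w \<and>
     (\<forall>a b. lis (filter (\<lambda>x. x \<in> {a..b}) u) = lis (filter (\<lambda>x. x \<in> {a..b}) w) \<and>
            lds (filter (\<lambda>x. x \<in> {a..b}) u) = lds (filter (\<lambda>x. x \<in> {a..b}) w))"

end

theory Submission imports Defs begin

text \<open>The bijection comes from K-theoretic jeu de taquin. An increasing tableau is a chain of Young diagrams in which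
  consecutive ones differ by boxes in distinct rows and columns, and sliding it through another tableau is a two-dimensional
  array of diagrams with a local rule at each unit square (the rule is an involution). Write a word on the antidiagonal next
  to a staircase and slide it through the tableau of the staircase whose \<open>t\<close>th antidiagonal has label \<open>t\<close>. Slides preserve
  \<open>lis\<close> and \<open>lds\<close> of all restrictions to intervals of labels, so the rectified tableau (the bottom row of the array)
  determines the class of the word under \<open>\<sim>rid\<close>, while the tableau left behind (the right column) determines its class
  under \<open>\<sim>cid\<close>. These two tableaux determine the word, and every tableau of the shape of the right column is the bottom row of
  some array with that right column, because the staircase tableau is characterised by rectangular patterns that slides
  preserve.

  For \<open>w = a # x\<close>, rectify \<open>x\<close>, put \<open>a\<close> at the foot of an additional first column and slide the labels through the rest
  of that column. The word \<open>u = y @ [b]\<close> is the one for which \<open>rev u = b # rev y\<close> gives the transposes of all these data.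
  Transposition exchanges \<open>lis\<close> and \<open>lds\<close>, as does reversal; hence \<open>w \<sim>rid u\<close> and \<open>x \<sim>cid y\<close>. The map is injective
  and preserves the finite sets of words with a given length and set of letters.\<close>

section \<open>Diagrams and growth arrays\<close>

text \<open>Transposing the array of \<open>x\<close> gives an array of \<open>rev x\<close>, but
  the array that absorbs the first letter slides a column, and its transpose would slide a row.
  Hence only the bottom row of this array can be transposed directly. The way out is that its right
  column is determined by two shapes, \<open>D\<close> before and \<open>D'\<close> after the
  absorption, and one box \<open>(e, f)\<close>: the box gained, or a corner of \<open>D\<close> if
  \<open>D' = D\<close>. These three data do have transposes. If \<open>D' = D\<close>, the shapes
  leave the corner open, so it must be carried along and recovered in the proof of injectivity. An
  array that is run backwards from its bottom row and right column need not obviously have the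
  desired left column. Exchanging the axes makes the left column the result of sliding the right
  one, so invariants of slides decide the matter here as well; for a column, chain lengths are
  enough.\<close>

definition diagram :: "(nat \<times> nat) set \<Rightarrow> bool" where
  "diagram D \<longleftrightarrow> finite D \<and> (\<forall>r c. (Suc r, c) \<in> D \<longrightarrow> (r, c) \<in> D) \<and> (\<forall>r c. (r, Suc c) \<in> D \<longrightarrow> (r, c) \<in> D)"

definition strip :: "(nat \<times> nat) set \<Rightarrow> (nat \<times> nat) set \<Rightarrow> bool" where
  "strip A B \<longleftrightarrow> diagram A \<and> diagram B \<and> A \<subseteq> B \<and>
     (\<forall>r c d. (r, c) \<in> B - A \<longrightarrow> (r, d) \<in> B - A \<longrightarrow> c = d) \<and>
     (\<forall>r q c. (r, c) \<in> B - A \<longrightarrow> (q, c) \<in> B - A \<longrightarrow> r = q)"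

text \<open>The local rule: the boxes of \<open>B - A\<close> and those of \<open>C - B\<close> trade places, a box staying put when it has no neighbour
  of the other kind.\<close>

definition switch :: "(nat \<times> nat) set \<Rightarrow> (nat \<times> nat) set \<Rightarrow> (nat \<times> nat) set \<Rightarrow> (nat \<times> nat) set" where
  "switch A B C = A \<union> {(r, c). (r, c) \<in> B - A \<and> ((Suc r, c) \<in> C - B \<or> (r, Suc c) \<in> C - B)} \<union>
     {(r, c). (r, c) \<in> C - B \<and> \<not> (\<exists>q. r = Suc q \<and> (q, c) \<in> B - A) \<and> \<not> (\<exists>d. c = Suc d \<and> (r, d) \<in> B - A)}"

lemma diagramD:
  assumes "diagram A"
  shows "finite A" "(Suc r, c) \<in> A \<Longrightarrow> (r, c) \<in> A" "(r, Suc c) \<in> A \<Longrightarrow> (r, c) \<in> A"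
  using assms unfolding diagram_def by blast+

lemma diagram_row: "diagram D \<Longrightarrow> (r, c) \<in> D \<Longrightarrow> d \<le> c \<Longrightarrow> (r, d) \<in> D"
proof -
  assume D: "diagram D"
  have *: "(r, d + k) \<in> D \<Longrightarrow> (r, d) \<in> D" for k
    by (induction k) (use diagramD(3)[OF D] in \<open>simp_all only: add_0_right add_Suc_right\<close>)
  assume "(r, c) \<in> D" "d \<le> c"
  then show ?thesis using *[of "c - d"] by simp
qed

lemma diagram_col: "diagram D \<Longrightarrow> (r, c) \<in> D \<Longrightarrow> q \<le> r \<Longrightarrow> (q, c) \<in> D"
proof -
  assume D: "diagram D"
  have *: "(q + k, c) \<in> D \<Longrightarrow> (q, c) \<in> D" for k
    by (induction k) (use diagramD(2)[OF D] in \<open>simp_all only: add_0_right add_Suc_right\<close>)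
  assume "(r, c) \<in> D" "q \<le> r"
  then show ?thesis using *[of "r - q"] by simp
qed

lemma stripD:
  assumes "strip A B"
  shows "diagram A" "diagram B" "A \<subseteq> B"
    "\<And>r c d. (r, c) \<in> B \<Longrightarrow> (r, c) \<notin> A \<Longrightarrow> (r, d) \<in> B \<Longrightarrow> (r, d) \<notin> A \<Longrightarrow> c = d"
    "\<And>r q c. (r, c) \<in> B \<Longrightarrow> (r, c) \<notin> A \<Longrightarrow> (q, c) \<in> B \<Longrightarrow> (q, c) \<notin> A \<Longrightarrow> r = q"
  using assms unfolding strip_def by blast+

lemma switch_subset: "A \<subseteq> B \<Longrightarrow> B \<subseteq> C \<Longrightarrow> A \<subseteq> switch A B C \<and> switch A B C \<subseteq> C"
  by (auto simp: switch_def)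

lemma mem_switch:
  "(r, c) \<in> switch A B C \<longleftrightarrow> (r, c) \<in> A \<or> (r, c) \<in> B - A \<and> ((Suc r, c) \<in> C - B \<or> (r, Suc c) \<in> C - B) \<or>
     (r, c) \<in> C - B \<and> \<not> (\<exists>q. r = Suc q \<and> (q, c) \<in> B - A) \<and> \<not> (\<exists>d. c = Suc d \<and> (r, d) \<in> B - A)"
  by (simp add: switch_def)

text \<open>Boxes of one strip never share a row or column, so the neighbour above or to the left of
  any box of the switched diagram already lies in \<open>A\<close>.\<close>

lemma diagram_switch:
  assumes "strip A B" "strip B C"
  shows "diagram (switch A B C)"
proof -
  note A = stripD[OF assms(1)] and B = stripD[OF assms(2)]
  note dA = diagramD[OF A(1)] and dB = diagramD[OF A(2)] and dC = diagramD[OF B(2)]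
  have fin: "finite (switch A B C)"
    using switch_subset[OF A(3) B(3)] dC(1) by (auto intro: finite_subset)
  have up: "(r, c) \<in> switch A B C" if x: "(Suc r, c) \<in> switch A B C" for r c
  proof -
    consider "(Suc r, c) \<in> A" | "(Suc r, c) \<in> B - A" | "(Suc r, c) \<in> C - B" "(r, c) \<notin> B - A"
      using x unfolding mem_switch by blast
    then have "(r, c) \<in> A"
    proof cases
      case 1 then show ?thesis by (rule dA)
    next
      case 2 then show ?thesis using A(5)[of "Suc r" c r] dB(2)[of r c] by auto
    next
      case 3 then show ?thesis using B(5)[of "Suc r" c r] dC(2)[of r c] by auto
    qed
    then show ?thesis unfolding mem_switch by blast
  qed
  have left: "(r, c) \<in> switch A B C" if x: "(r, Suc c) \<in> switch A B C" for r c
  proof -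
    consider "(r, Suc c) \<in> A" | "(r, Suc c) \<in> B - A" | "(r, Suc c) \<in> C - B" "(r, c) \<notin> B - A"
      using x unfolding mem_switch by blast
    then have "(r, c) \<in> A"
    proof cases
      case 1 then show ?thesis by (rule dA)
    next
      case 2 then show ?thesis using A(4)[of r "Suc c" c] dB(3)[of r c] by auto
    next
      case 3 then show ?thesis using B(4)[of r "Suc c" c] dC(3)[of r c] by auto
    qed
    then show ?thesis unfolding mem_switch by blast
  qed
  show ?thesis using fin up left unfolding diagram_def by blast
qed

text \<open>A gap between the two boxes would have to be filled by a second box of one of the strips
  in the same row. With the column version this cuts \<open>C - A\<close> into lone boxes and thin
  ribbons in which the two kinds of boxes alternate.\<close>

lemma strip_row_adj:
  assumes "strip A B" "strip B C" "(r, c) \<in> B - A" "(r, d) \<in> C - B"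
  shows "d = Suc c"
proof -
  note A = stripD[OF assms(1)] and B = stripD[OF assms(2)]
  have "c < d" using assms(3,4) diagram_row[OF A(2), of r c d] by (meson DiffD1 DiffD2 not_le)
  have "(r, Suc c) \<in> C" using diagram_row[OF B(2), of r d "Suc c"] \<open>c < d\<close> assms(4) by auto
  moreover have "(r, Suc c) \<notin> B"
  proof
    assume "(r, Suc c) \<in> B"
    moreover have "(r, Suc c) \<notin> A" using assms(3) diagramD(3)[OF A(1)] by blast
    ultimately show False using A(4)[of r "Suc c" c] assms(3) by auto
  qed
  ultimately show ?thesis using B(4)[of r d "Suc c"] assms(4) by auto
qed

lemma strip_col_adj:
  assumes "strip A B" "strip B C" "(r, c) \<in> B - A" "(q, c) \<in> C - B"
  shows "q = Suc r"
proof -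
  note A = stripD[OF assms(1)] and B = stripD[OF assms(2)]
  have "r < q" using assms(3,4) diagram_col[OF A(2), of r c q] by (meson DiffD1 DiffD2 not_le)
  have "(Suc r, c) \<in> C" using diagram_col[OF B(2), of q c "Suc r"] \<open>r < q\<close> assms(4) by auto
  moreover have "(Suc r, c) \<notin> B"
  proof
    assume "(Suc r, c) \<in> B"
    moreover have "(Suc r, c) \<notin> A" using assms(3) diagramD(2)[OF A(1)] by blast
    ultimately show False using A(5)[of "Suc r" c r] assms(3) by auto
  qed
  ultimately show ?thesis using B(5)[of q c "Suc r"] assms(4) by auto
qed

lemma strip_switch:
  assumes s: "strip A B" "strip B C"
  shows "strip A (switch A B C)" "strip (switch A B C) C"
proof -
  have d: "diagram (switch A B C)" by (rule diagram_switch[OF s])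
  have sub: "A \<subseteq> switch A B C" "switch A B C \<subseteq> C" using switch_subset[of A B C] s by (auto simp: strip_def)
  note ra = strip_row_adj[OF s] and ca = strip_col_adj[OF s]
  have rB: "c = d" if "(r, c) \<in> B - A" "(r, d) \<in> B - A" for r c d using that s by (auto simp: strip_def)
  have rC: "c = d" if "(r, c) \<in> C - B" "(r, d) \<in> C - B" for r c d using that s by (auto simp: strip_def)
  have cB: "r = q" if "(r, c) \<in> B - A" "(q, c) \<in> B - A" for r q c using that s by (auto simp: strip_def)
  have cC: "r = q" if "(r, c) \<in> C - B" "(q, c) \<in> C - B" for r q c using that s by (auto simp: strip_def)
  have in1: "x \<in> switch A B C - A \<longleftrightarrow> (\<exists>r c. x = (r, c) \<and> ((r, c) \<in> B - A \<and> ((Suc r, c) \<in> C - B \<or> (r, Suc c) \<in> C - B) \<or>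
      (r, c) \<in> C - B \<and> \<not> (\<exists>q. r = Suc q \<and> (q, c) \<in> B - A) \<and> \<not> (\<exists>d. c = Suc d \<and> (r, d) \<in> B - A)))" for x
    using stripD(3)[OF s(1)] stripD(3)[OF s(2)] by (cases x) (auto simp: mem_switch)
  have in2: "x \<in> C - switch A B C \<longleftrightarrow> (\<exists>r c. x = (r, c) \<and> ((r, c) \<in> B - A \<and> \<not> ((Suc r, c) \<in> C - B \<or> (r, Suc c) \<in> C - B) \<or>
      (r, c) \<in> C - B \<and> ((\<exists>q. r = Suc q \<and> (q, c) \<in> B - A) \<or> (\<exists>d. c = Suc d \<and> (r, d) \<in> B - A))))" for x
    using stripD(3)[OF s(1)] stripD(3)[OF s(2)] by (cases x) (auto simp: mem_switch)
  have "c = d" if "(r, c) \<in> switch A B C - A" "(r, d) \<in> switch A B C - A" for r c d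
    using that unfolding in1 using rB rC ra by blast
  moreover have "r = q" if "(r, c) \<in> switch A B C - A" "(q, c) \<in> switch A B C - A" for r q c
    using that unfolding in1 using cB cC ca by blast
  ultimately show "strip A (switch A B C)" using d sub s by (auto simp: strip_def)
  have "c = d" if "(r, c) \<in> C - switch A B C" "(r, d) \<in> C - switch A B C" for r c d
    using that unfolding in2 using rB rC ra by blast
  moreover have "r = q" if "(r, c) \<in> C - switch A B C" "(q, c) \<in> C - switch A B C" for r q c
    using that unfolding in2 using cB cC ca by blast
  ultimately show "strip (switch A B C) C" using d sub s by (auto simp: strip_def)
qed

text \<open>In an alternating ribbon the inner positions remain the inner positions after the trade,
  and lone boxes keep their place: \<open>e1\<close> recovers the boxes of \<open>B - A\<close> with
  a neighbour in \<open>C - B\<close>, and \<open>e2\<close> those without.\<close>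

lemma switch_switch:
  assumes s: "strip A B" "strip B C"
  shows "switch A (switch A B C) C = B"
proof -
  have sub: "A \<subseteq> B" "B \<subseteq> C" using s by (auto simp: strip_def)
  note ra = strip_row_adj[OF s] and ca = strip_col_adj[OF s]
  have BB: "(Suc r, c) \<in> B - A \<Longrightarrow> (r, c) \<notin> B - A" "(r, Suc c) \<in> B - A \<Longrightarrow> (r, c) \<notin> B - A" for r c
    using stripD(5)[OF s(1), of "Suc r" c r] stripD(4)[OF s(1), of r "Suc c" c] by auto
  have CC: "(Suc r, c) \<in> C - B \<Longrightarrow> (r, c) \<notin> C - B" "(r, Suc c) \<in> C - B \<Longrightarrow> (r, c) \<notin> C - B" for r c
    using stripD(5)[OF s(2), of "Suc r" c r] stripD(4)[OF s(2), of r "Suc c" c] by auto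
  have dB: "(Suc r, c) \<in> B \<Longrightarrow> (r, c) \<in> B" "(r, Suc c) \<in> B \<Longrightarrow> (r, c) \<in> B" for r c
    using diagramD[OF stripD(2)[OF s(1)]] by blast+
  define D where "D = switch A B C"
  have D1: "(r, c) \<in> D - A \<longleftrightarrow> (r, c) \<in> B - A \<and> ((Suc r, c) \<in> C - B \<or> (r, Suc c) \<in> C - B) \<or>
      (r, c) \<in> C - B \<and> \<not> (\<exists>q. r = Suc q \<and> (q, c) \<in> B - A) \<and> \<not> (\<exists>d. c = Suc d \<and> (r, d) \<in> B - A)" for r c
    using sub by (auto simp: switch_def D_def)
  have D2: "(r, c) \<in> C - D \<longleftrightarrow> (r, c) \<in> B - A \<and> \<not> ((Suc r, c) \<in> C - B \<or> (r, Suc c) \<in> C - B) \<or>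
      (r, c) \<in> C - B \<and> ((\<exists>q. r = Suc q \<and> (q, c) \<in> B - A) \<or> (\<exists>d. c = Suc d \<and> (r, d) \<in> B - A))" for r c
    using sub by (auto simp: switch_def D_def)
  have e1: "(r, c) \<in> D - A \<and> ((Suc r, c) \<in> C - D \<or> (r, Suc c) \<in> C - D) \<longleftrightarrow>
     (r, c) \<in> B - A \<and> ((Suc r, c) \<in> C - B \<or> (r, Suc c) \<in> C - B)" (is "?L \<longleftrightarrow> ?R") for r c
  proof
    assume ?R
    then have "(r, c) \<in> D - A" using D1 by blast
    moreover have "(Suc r, c) \<in> C - D \<or> (r, Suc c) \<in> C - D" using \<open>?R\<close> D2 by blast
    ultimately show ?L by blast
  next
    assume L: ?L
    show ?R
    proof (cases "(r, c) \<in> B - A")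
      case True then show ?thesis using L D1 by blast
    next
      case False
      then have a: "(r, c) \<in> C - B" using L D1 by blast
      have "(Suc r, c) \<notin> B" "(r, Suc c) \<notin> B" "(Suc r, c) \<notin> C - B" "(r, Suc c) \<notin> C - B"
        using a dB CC by blast+
      then have False using L D2 by blast
      then show ?thesis ..
    qed
  qed
  have e2: "(r, c) \<in> C - D \<and> \<not> (\<exists>q. r = Suc q \<and> (q, c) \<in> D - A) \<and> \<not> (\<exists>d. c = Suc d \<and> (r, d) \<in> D - A) \<longleftrightarrow>
     (r, c) \<in> B - A \<and> \<not> ((Suc r, c) \<in> C - B \<or> (r, Suc c) \<in> C - B)" (is "?L \<longleftrightarrow> ?R") for r c
  proof
    assume R: ?R
    then have "(r, c) \<in> C - D" using D2 by blast
    moreover have "(q, c) \<notin> D - A" if "r = Suc q" for q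
      using R that BB dB D1 by blast
    moreover have "(r, d) \<notin> D - A" if "c = Suc d" for d
      using R that BB dB D1 by blast
    ultimately show ?L by blast
  next
    assume L: ?L
    show ?R
    proof (cases "(r, c) \<in> B - A")
      case True then show ?thesis using L D2 by blast
    next
      case False
      then have "(r, c) \<in> C - B" "(\<exists>q. r = Suc q \<and> (q, c) \<in> B - A) \<or> (\<exists>d. c = Suc d \<and> (r, d) \<in> B - A)" using L D2 by blast+
      then have "(\<exists>q. r = Suc q \<and> (q, c) \<in> D - A) \<or> (\<exists>d. c = Suc d \<and> (r, d) \<in> D - A)" using D1 by blast
      then show ?thesis using L by blast
    qed
  qed
  have "switch A D C = A \<union> (B - A)"
    unfolding switch_def e1 e2 by auto
  then show ?thesis using sub D_def by auto
qed

section \<open>Transposition of diagrams, and the local rule in terms of row lengths\<close>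

definition conjugate :: "(nat \<times> nat) set \<Rightarrow> (nat \<times> nat) set" where
  "conjugate D = {(c, r). (r, c) \<in> D}"

lemma conj_conj [simp]: "conjugate (conjugate D) = D"
  by (auto simp: conjugate_def)

lemma mem_conj [simp]: "(r, c) \<in> conjugate D \<longleftrightarrow> (c, r) \<in> D"
  by (auto simp: conjugate_def)

lemma diagram_conj [simp]: "diagram (conjugate D) \<longleftrightarrow> diagram D"
proof -
  have "conjugate D = prod.swap ` D" for D by (force simp: conjugate_def)
  moreover have "inj_on prod.swap D" for D :: "(nat \<times> nat) set" by (auto simp: inj_on_def)
  ultimately have "finite (conjugate D) \<longleftrightarrow> finite D" by (metis finite_image_iff)
  then show ?thesis unfolding diagram_def mem_conj by blast
qed

lemma strip_conj [simp]: "strip (conjugate A) (conjugate B) \<longleftrightarrow> strip A B"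
proof -
  have "conjugate A \<subseteq> conjugate B \<longleftrightarrow> A \<subseteq> B" by (auto simp: conjugate_def)
  then show ?thesis by (auto simp: strip_def)
qed

lemma switch_conj: "switch (conjugate A) (conjugate B) (conjugate C) = conjugate (switch A B C)"
  by (auto simp: switch_def conjugate_def)

definition len :: "(nat \<times> nat) set \<Rightarrow> nat \<Rightarrow> nat" where
  "len D r = card {c. (r, c) \<in> D}"

lemma mem_iff_len:
  assumes "diagram D"
  shows "(r, c) \<in> D \<longleftrightarrow> c < len D r"
proof -
  let ?X = "{c. (r, c) \<in> D}"
  have "?X \<subseteq> snd ` D" by force
  then have fin: "finite ?X" using assms by (meson diagram_def finite_imageI finite_subset)
  have down: "d \<in> ?X" if "c \<in> ?X" "d \<le> c" for c d using that diagram_row[OF assms] by auto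
  show ?thesis
  proof
    assume "(r, c) \<in> D"
    then have "{..c} \<subseteq> ?X" using down by auto
    then have "card {..c} \<le> card ?X" using fin card_mono by blast
    then show "c < len D r" by (simp add: len_def)
  next
    assume l: "c < len D r"
    show "(r, c) \<in> D"
    proof (rule ccontr)
      assume "(r, c) \<notin> D"
      then have "?X \<subseteq> {..<c}" using down by (metis (mono_tags) lessThan_iff mem_Collect_eq not_le subsetI)
      then have "card ?X \<le> c" using card_mono[of "{..<c}" ?X] by simp
      then show False using l by (simp add: len_def)
    qed
  qed
qed

lemma diagram_eqI:
  assumes "diagram A" "diagram B" "\<And>r. len A r = len B r"
  shows "A = B"
  using mem_iff_len[OF assms(1)] mem_iff_len[OF assms(2)] assms(3) by auto

lemma len_Suc_le: "diagram D \<Longrightarrow> len D (Suc r) \<le> len D r"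
  using mem_iff_len[of D] diagramD(2)[of D] by (metis linorder_not_le less_irrefl)

lemma strip_len:
  assumes "strip A B"
  shows "len A r \<le> len B r" "len B r \<le> Suc (len A r)" "len B (Suc r) \<le> len A r"
proof -
  have A: "diagram A" and B: "diagram B" and sub: "A \<subseteq> B" using assms by (auto simp: strip_def)
  show 1: "len A r \<le> len B r" using mem_iff_len[OF A] mem_iff_len[OF B] sub by (meson in_mono linorder_not_le order.strict_iff_not)
  show "len B r \<le> Suc (len A r)"
  proof (rule ccontr)
    assume "\<not> len B r \<le> Suc (len A r)"
    then have "(r, len A r) \<in> B - A" "(r, Suc (len A r)) \<in> B - A" using mem_iff_len[OF A] mem_iff_len[OF B] by auto
    then show False using stripD(4)[OF assms, of r "len A r" "Suc (len A r)"] by auto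
  qed
  show "len B (Suc r) \<le> len A r"
  proof (rule ccontr)
    assume *: "\<not> len B (Suc r) \<le> len A r"
    then have "(Suc r, len A r) \<in> B - A" "(r, len A r) \<in> B - A"
      using mem_iff_len[OF A] mem_iff_len[OF B] len_Suc_le[OF A, of r] len_Suc_le[OF B, of r] by auto
    then show False using stripD(5)[OF assms, of "Suc r" "len A r" r] by auto
  qed
qed

lemma strip_mem:
  assumes "strip A B"
  shows "(r, c) \<in> B - A \<longleftrightarrow> c = len A r \<and> len A r < len B r"
  using mem_iff_len[OF stripD(1)[OF assms], of r c] mem_iff_len[OF stripD(2)[OF assms], of r c] strip_len(2)[OF assms, of r] by auto

text \<open>A strip adds at most one box to a row, at its end, so adjacency becomes an equation
  between row lengths: \<open>Suc (len B (Suc r)) = len B r\<close> puts the box of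
  \<open>C - B\<close> in row \<open>Suc r\<close> right below the box of \<open>B - A\<close> in
  row \<open>r\<close>.\<close>

lemma switch_len:
  assumes s: "strip A B" "strip B C"
  shows "len A r < len (switch A B C) r \<longleftrightarrow>
     (if len A r < len B r then len B r < len C r \<or> (len B (Suc r) < len C (Suc r) \<and> Suc (len B (Suc r)) = len B r)
      else len B r < len C r \<and> \<not> (\<exists>q. r = Suc q \<and> len A q < len B q \<and> Suc (len B r) = len B q))"
proof -
  note m = strip_mem[OF s(1)] strip_mem[OF s(2)] strip_mem[OF strip_switch(1)[OF s]]
  have sub: "A \<subseteq> B" "B \<subseteq> C" using s by (auto simp: strip_def)
  have 1: "(r, c) \<in> switch A B C - A \<longleftrightarrow> (r, c) \<in> B - A \<and> ((Suc r, c) \<in> C - B \<or> (r, Suc c) \<in> C - B) \<or>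
      (r, c) \<in> C - B \<and> \<not> (\<exists>q. r = Suc q \<and> (q, c) \<in> B - A) \<and> \<not> (\<exists>d. c = Suc d \<and> (r, d) \<in> B - A)" for c
    using sub by (auto simp: switch_def)
  have B: "len B r = (if len A r < len B r then Suc (len A r) else len A r)" for r
    using strip_len[OF s(1), of r] by auto
  have "len A r < len (switch A B C) r \<longleftrightarrow> (r, len A r) \<in> switch A B C - A" using m(3) by auto
  also have "\<dots> \<longleftrightarrow> len A r < len B r \<and> (len A r = len B (Suc r) \<and> len B (Suc r) < len C (Suc r) \<or> Suc (len A r) = len B r \<and> len B r < len C r) \<or>
      (len A r = len B r \<and> len B r < len C r) \<and> \<not> (\<exists>q. r = Suc q \<and> len A r = len A q \<and> len A q < len B q) \<and> \<not> (\<exists>d. len A r = Suc d \<and> d = len A r \<and> len A r < len B r)"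
    unfolding 1 m(1) m(2) by auto
  also have "\<dots> \<longleftrightarrow> (if len A r < len B r then len B r < len C r \<or> (len B (Suc r) < len C (Suc r) \<and> Suc (len B (Suc r)) = len B r)
      else len B r < len C r \<and> \<not> (\<exists>q. r = Suc q \<and> len A q < len B q \<and> Suc (len B r) = len B q))"
    using B[of r] B[of "r - 1"] by (auto split: if_splits)
  finally show ?thesis .
qed

text \<open>The index \<open>t\<close> counts the rows of the array from bottom to top,
  \<open>v\<close> its columns from left to right. The left column and the top row are the input of
  the slide; the bottom row and the right column are its output.\<close>

definition growth :: "nat \<Rightarrow> nat \<Rightarrow> (nat \<Rightarrow> nat \<Rightarrow> (nat \<times> nat) set) \<Rightarrow> bool" where
  "growth a m G \<longleftrightarrow> (\<forall>t\<le>a. \<forall>v<m. strip (G t v) (G t (Suc v))) \<and> (\<forall>t<a. \<forall>v\<le>m. strip (G t v) (G (Suc t) v)) \<and>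
     (\<forall>t<a. \<forall>v<m. G t (Suc v) = switch (G t v) (G (Suc t) v) (G (Suc t) (Suc v)))"

lemma growthD:
  assumes "growth a m G"
  shows "t \<le> a \<Longrightarrow> v < m \<Longrightarrow> strip (G t v) (G t (Suc v))"
    "t < a \<Longrightarrow> v \<le> m \<Longrightarrow> strip (G t v) (G (Suc t) v)"
    "t < a \<Longrightarrow> v < m \<Longrightarrow> G t (Suc v) = switch (G t v) (G (Suc t) v) (G (Suc t) (Suc v))"
  using assms by (auto simp: growth_def)

text \<open>By \<open>switch_switch\<close> each of the two middle corners of a unit square is
  computed from the other by the same rule, so the array may be read with its axes
  exchanged.\<close>

lemma growth_swap:
  assumes "growth a m G"
  shows "growth m a (\<lambda>v t. G t v)"
  unfolding growth_def using growthD[OF assms] switch_switch by (metis less_imp_le_nat Suc_leI)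

lemma growth_conjugate:
  assumes "growth a m G"
  shows "growth a m (\<lambda>t v. conjugate (G t v))"
  using growthD[OF assms] by (auto simp: growth_def switch_conj)

lemma growth_exists:
  assumes "\<And>t. t < a \<Longrightarrow> strip (P t) (P (Suc t))" "\<And>v. v < m \<Longrightarrow> strip (W v) (W (Suc v))" "P a = W 0" "diagram (W 0)"
  shows "\<exists>G. growth a m G \<and> (\<forall>t\<le>a. G t 0 = P t) \<and> (\<forall>v\<le>m. G a v = W v)"
  using assms
proof (induction a arbitrary: W)
  case 0
  then show ?case by (intro exI[of _ "\<lambda>t. W"]) (auto simp: growth_def)
next
  case (Suc a)
  \<comment> \<open>\<open>X\<close> is the array row just below \<open>W\<close>, computed from
    left to right.\<close>
  define X where "X = rec_nat (P a) (\<lambda>v x. switch x (W v) (W (Suc v)))"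
  have X0: "X 0 = P a" and XS: "X (Suc v) = switch (X v) (W v) (W (Suc v))" for v by (auto simp: X_def)
  have col: "strip (X v) (W v)" if "v \<le> m" for v using that
  proof (induction v)
    case 0 show ?case using Suc.prems(1)[of a] Suc.prems(3) X0 by simp
  next
    case (Suc v)
    then show ?case using strip_switch(2)[of "X v" "W v" "W (Suc v)"] XS \<open>\<And>v. v < m \<Longrightarrow> strip (W v) (W (Suc v))\<close> by simp
  qed
  have row: "strip (X v) (X (Suc v))" if "v < m" for v
    unfolding XS by (rule strip_switch(1)) (use that col Suc.prems(2) in auto)
  have "diagram (X 0)" using stripD(1)[OF col[of 0]] by simp
  then obtain G where G: "growth a m G" "\<And>t. t \<le> a \<Longrightarrow> G t 0 = P t" "\<And>v. v \<le> m \<Longrightarrow> G a v = X v"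
    using Suc.IH[of X] Suc.prems(1) row X0 by fastforce
  define H where "H = (\<lambda>t. if t = Suc a then W else G t)"
  have H: "H (Suc a) = W" "t \<le> a \<Longrightarrow> H t = G t" for t by (auto simp: H_def)
  have "growth (Suc a) m H" unfolding growth_def
  proof (intro conjI allI impI)
    fix t v assume "t \<le> Suc a" "v < m"
    then show "strip (H t v) (H t (Suc v))" using growthD(1)[OF G(1)] Suc.prems(2) H by (cases "t = Suc a") auto
  next
    fix t v assume "t < Suc a" "v \<le> m"
    then show "strip (H t v) (H (Suc t) v)" using growthD(2)[OF G(1)] col G(3) H by (cases "t = a") auto
  next
    fix t v assume "t < Suc a" "v < m"
    then show "H t (Suc v) = switch (H t v) (H (Suc t) v) (H (Suc t) (Suc v))"
      using growthD(3)[OF G(1)] G(3) H XS by (cases "t = a") auto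
  qed
  then show ?case using G(2) Suc.prems(3) H by (intro exI[of _ H]) (auto simp: le_Suc_eq)
qed

lemma growth_unique:
  assumes "growth a m G" "growth a m H" "\<And>t. t \<le> a \<Longrightarrow> G t 0 = H t 0" "\<And>v. v \<le> m \<Longrightarrow> G a v = H a v"
  shows "t \<le> a \<Longrightarrow> v \<le> m \<Longrightarrow> G t v = H t v"
proof (induction "a - t" arbitrary: t v)
  case 0 then show ?case using assms(4) by auto
next
  case (Suc k)
  then have t: "t < a" by simp
  have IH: "v \<le> m \<Longrightarrow> G (Suc t) v = H (Suc t) v" for v using Suc.hyps(1)[of "Suc t" v] Suc.hyps(2) t by simp
  show ?case using Suc.prems(2)
  proof (induction v)
    case 0 then show ?case using assms(3) t by simp
  next
    case (Suc v)
    then show ?case using growthD(3)[OF assms(1) t, of v] growthD(3)[OF assms(2) t, of v] IH by simp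
  qed
qed

text \<open>Since \<open>switch\<close> is an involution, \<open>growth_exists\<close> and \<open>growth_unique\<close> also apply to the swapped array.\<close>

lemma growth_exists_rev:
  assumes "\<And>v. v < m \<Longrightarrow> strip (T v) (T (Suc v))" "\<And>t. t < a \<Longrightarrow> strip (S t) (S (Suc t))" "T m = S 0" "diagram (S 0)"
  shows "\<exists>G. growth a m G \<and> (\<forall>v\<le>m. G 0 v = T v) \<and> (\<forall>t\<le>a. G t m = S t)"
proof -
  from growth_exists[of m T a S] assms obtain G where "growth m a G" "\<forall>t\<le>m. G t 0 = T t" "\<forall>v\<le>a. G m v = S v" by blast
  then show ?thesis using growth_swap by (intro exI[of _ "\<lambda>t v. G v t"]) blast
qed

lemma growth_unique_rev:
  assumes "growth a m G" "growth a m H" "\<And>v. v \<le> m \<Longrightarrow> G 0 v = H 0 v" "\<And>t. t \<le> a \<Longrightarrow> G t m = H t m"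
  shows "t \<le> a \<Longrightarrow> v \<le> m \<Longrightarrow> G t v = H t v"
  using growth_unique[OF growth_swap[OF assms(1)] growth_swap[OF assms(2)], of v t] assms(3,4) by blast

section \<open>Slides preserve chain lengths and patterns\<close>

text \<open>One slide, seen on row lengths: \<open>A\<close> is the chain before and \<open>B\<close> the chain after the slide.\<close>

locale slide =
  fixes m :: nat and A B :: "nat \<Rightarrow> nat \<Rightarrow> nat"
  assumes A_row: "v \<le> m \<Longrightarrow> A v (Suc r) \<le> A v r"
    and B_row: "v \<le> m \<Longrightarrow> B v (Suc r) \<le> B v r"
    and A_step: "v < m \<Longrightarrow> A v r \<le> A (Suc v) r" "v < m \<Longrightarrow> A (Suc v) r \<le> Suc (A v r)" "v < m \<Longrightarrow> A (Suc v) (Suc r) \<le> A v r"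
    and B_step: "v < m \<Longrightarrow> B v r \<le> B (Suc v) r" "v < m \<Longrightarrow> B (Suc v) r \<le> Suc (B v r)" "v < m \<Longrightarrow> B (Suc v) (Suc r) \<le> B v r"
    and BA: "v \<le> m \<Longrightarrow> B v r \<le> A v r" "v \<le> m \<Longrightarrow> A v r \<le> Suc (B v r)" "v \<le> m \<Longrightarrow> A v (Suc r) \<le> B v r"
    and rule: "v < m \<Longrightarrow> B v r < B (Suc v) r \<longleftrightarrow>
       (if B v r < A v r then A v r < A (Suc v) r \<or> (A v (Suc r) < A (Suc v) (Suc r) \<and> Suc (A v (Suc r)) = A v r)
        else A v r < A (Suc v) r \<and> \<not> (\<exists>q. r = Suc q \<and> B v q < A v q \<and> Suc (A v r) = A v q))"

text \<open>The offset \<open>u\<close> lets the chains start at a later label; this is how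
  restrictions to intervals of labels enter.\<close>

lemma growth_slide:
  assumes "growth a m G" "t < a" "u + m' \<le> m"
  shows "slide m' (\<lambda>v. len (G (Suc t) (u + v))) (\<lambda>v. len (G t (u + v)))"
proof -
  have r: "strip (G t (u + v)) (G t (u + Suc v))" "strip (G (Suc t) (u + v)) (G (Suc t) (u + Suc v))" if "v < m'" for v
    using growthD(1)[OF assms(1), of _ "u + v"] that assms(2,3) by auto
  have c: "strip (G t (u + v)) (G (Suc t) (u + v))" if "v \<le> m'" for v
    using growthD(2)[OF assms(1), of _ "u + v"] that assms(2,3) by auto
  have sw: "G t (u + Suc v) = switch (G t (u + v)) (G (Suc t) (u + v)) (G (Suc t) (u + Suc v))" if "v < m'" for v
    using growthD(3)[OF assms(1), of _ "u + v"] that assms(2,3) by auto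
  show ?thesis
  proof
    fix v r assume "v < m'"
    then show "(len (G t (u + v)) r < len (G t (u + Suc v)) r) =
       (if len (G t (u + v)) r < len (G (Suc t) (u + v)) r
        then len (G (Suc t) (u + v)) r < len (G (Suc t) (u + Suc v)) r \<or>
             len (G (Suc t) (u + v)) (Suc r) < len (G (Suc t) (u + Suc v)) (Suc r) \<and>
             Suc (len (G (Suc t) (u + v)) (Suc r)) = len (G (Suc t) (u + v)) r
        else len (G (Suc t) (u + v)) r < len (G (Suc t) (u + Suc v)) r \<and>
             \<not> (\<exists>q. r = Suc q \<and> len (G t (u + v)) q < len (G (Suc t) (u + v)) q \<and>
                  Suc (len (G (Suc t) (u + v)) r) = len (G (Suc t) (u + v)) q))"
      using switch_len[OF c r(2), of v r] sw[of v] by simp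
  qed (use strip_len[OF c] strip_len[OF r(1)] strip_len[OF r(2)] len_Suc_le[OF stripD(1)[OF c]] len_Suc_le[OF stripD(2)[OF c]] in auto)
qed

text \<open>If \<open>J v r\<close> says that label \<open>v\<close> occurs in row \<open>r\<close>, then \<open>inclen J v r\<close> is the greatest length of a chain of
  strictly increasing labels below \<open>v\<close> whose rows are at least \<open>r\<close> and weakly decrease.\<close>

primrec inclen :: "(nat \<Rightarrow> nat \<Rightarrow> bool) \<Rightarrow> nat \<Rightarrow> nat \<Rightarrow> nat" where
  "inclen J 0 r = 0"
| "inclen J (Suc v) r = (if \<exists>q\<ge>r. J v q then max (inclen J v r) (Suc (inclen J v (LEAST q. r \<le> q \<and> J v q))) else inclen J v r)"

lemma inclen_cases: "inclen J (Suc v) r = inclen J v r \<or> (\<exists>q\<ge>r. J v q \<and> inclen J (Suc v) r = Suc (inclen J v q))"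
proof (cases "\<exists>q\<ge>r. J v q")
  case True
  then have "r \<le> (LEAST q. r \<le> q \<and> J v q) \<and> J v (LEAST q. r \<le> q \<and> J v q)" by (rule LeastI_ex)
  with True show ?thesis by (auto simp: max_def)
next
  case False
  then show ?thesis by (metis inclen.simps(2))
qed

lemma inclen_Suc_ge: "inclen J v r \<le> inclen J (Suc v) r"
  by simp

text \<open>A lower bound on the rows that is smaller admits more chains. This is what makes the
  least row the best choice in the recursion.\<close>

lemma inclen_antimono: "r \<le> q \<Longrightarrow> inclen J v q \<le> inclen J v r"
proof (induction v arbitrary: r q)
  case (Suc v)
  show ?case
  proof (cases "inclen J (Suc v) q = inclen J v q")
    case True
    moreover have "inclen J v q \<le> inclen J v r" by (rule Suc.IH[OF Suc.prems])
    ultimately show ?thesis using inclen_Suc_ge[of J v r] by linarith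
  next
    case False
    then obtain p where p: "q \<le> p" "J v p" using inclen_cases[of J v q] by metis
    let ?L = "\<lambda>r. LEAST p. r \<le> p \<and> J v p"
    have ex: "\<exists>p\<ge>r. J v p" "\<exists>p\<ge>q. J v p" using p Suc.prems using order_trans by blast+
    then have "q \<le> ?L q \<and> J v (?L q)" using LeastI_ex[of "\<lambda>p. q \<le> p \<and> J v p"] by blast
    then have "?L r \<le> ?L q" using Suc.prems by (intro Least_le) auto
    then have "inclen J v (?L q) \<le> inclen J v (?L r)" "inclen J v q \<le> inclen J v r" using Suc by auto
    then show ?thesis using ex by auto
  qed
qed simp

lemma inclen_step: "r \<le> q \<Longrightarrow> J v q \<Longrightarrow> Suc (inclen J v q) \<le> inclen J (Suc v) r"
proof -
  assume a: "r \<le> q" "J v q"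
  then have "(LEAST p. r \<le> p \<and> J v p) \<le> q" by (intro Least_le) auto
  then have "inclen J v q \<le> inclen J v (LEAST p. r \<le> p \<and> J v p)" by (rule inclen_antimono)
  then show ?thesis using a by auto
qed

lemma inclen_mem: "J v r \<Longrightarrow> inclen J (Suc v) r = Suc (inclen J v r)"
proof -
  assume "J v r"
  then have "(LEAST q. r \<le> q \<and> J v q) = r" by (intro Least_equality) auto
  with \<open>J v r\<close> show ?thesis by auto
qed

lemma inclen_not_mem: "\<not> J v r \<Longrightarrow> inclen J (Suc v) r = max (inclen J v r) (inclen J (Suc v) (Suc r))"
proof (rule antisym)
  assume n: "\<not> J v r"
  show "inclen J (Suc v) r \<le> max (inclen J v r) (inclen J (Suc v) (Suc r))"
  proof (cases "inclen J (Suc v) r = inclen J v r")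
    case False
    then obtain q where "q \<ge> r" "J v q" "inclen J (Suc v) r = Suc (inclen J v q)" using inclen_cases[of J v r] by metis
    moreover have "q \<noteq> r" using n \<open>J v q\<close> by blast
    ultimately show ?thesis using inclen_step[of "Suc r" q J v] by (auto simp: max_def)
  qed (simp only: max.cobounded1)
  show "max (inclen J v r) (inclen J (Suc v) (Suc r)) \<le> inclen J (Suc v) r"
    using inclen_Suc_ge[of J v r] inclen_antimono[of r "Suc r" J "Suc v"] by linarith
qed

lemma inclen_ge: "inclen J v r + (if J v r then 1 else 0) \<le> inclen J (Suc v) r"
  using inclen_mem[of J v r] inclen_Suc_ge[of J v r] by (cases "J v r") (simp_all del: inclen.simps)

lemma inclen_cong: "(\<And>w q. w < v \<Longrightarrow> J w q = K w q) \<Longrightarrow> inclen J v r = inclen K v r"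
proof (induction v arbitrary: r)
  case (Suc v)
  then have "J v = K v" "inclen J v = inclen K v" by auto
  then show ?case by (simp only: inclen.simps)
qed simp

declare inclen.simps(2) [simp del]

section \<open>Chain lengths under a single slide\<close>

definition step :: "(nat \<Rightarrow> nat \<Rightarrow> nat) \<Rightarrow> nat \<Rightarrow> nat \<Rightarrow> bool" where
  "step A v r \<longleftrightarrow> A v r < A (Suc v) r"

context slide
begin

lemma A_Suc: "v < m \<Longrightarrow> A (Suc v) r = A v r + (if step A v r then 1 else 0)"
  using A_step[of v r] by (auto simp: step_def)

lemma B_Suc: "v < m \<Longrightarrow> B (Suc v) r = B v r + (if step B v r then 1 else 0)"
  using B_step[of v r] by (auto simp: step_def)

text \<open>\<open>link v r\<close>: the hole in row \<open>r\<close> sits right above an entry \<open>v\<close> in row \<open>r + 1\<close>, which is pulled up.\<close>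

definition link :: "nat \<Rightarrow> nat \<Rightarrow> bool" where
  "link v r \<longleftrightarrow> B v r < A v r \<and> step A v (Suc r) \<and> Suc (A v (Suc r)) = A v r"

lemma step_B:
  assumes "v < m"
  shows "step B v r \<longleftrightarrow> (if B v r < A v r then step A v r \<or> link v r else step A v r \<and> \<not> (\<exists>q. r = Suc q \<and> link v q))"
  using rule[OF assms, of r] by (auto simp: step_def link_def)

lemma step_B_hole: "v < m \<Longrightarrow> B v r < A v r \<Longrightarrow> step B v r \<longleftrightarrow> step A v r \<or> link v r"
  by (simp add: step_B)

lemma step_B_no_hole: "v < m \<Longrightarrow> \<not> B v r < A v r \<Longrightarrow> step B v r \<longleftrightarrow> step A v r \<and> \<not> (\<exists>q. r = Suc q \<and> link v q)"
  by (simp add: step_B)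

lemma step_A_upper: "v < m \<Longrightarrow> step A v (Suc r) \<Longrightarrow> Suc (A v (Suc r)) \<le> A v r"
  using A_step(3)[of v r] A_Suc[of v "Suc r"] by auto

lemma hole_cases: "v \<le> m \<Longrightarrow> A v r = B v r + (if B v r < A v r then 1 else 0)"
  using BA[of v r] by auto

text \<open>Needed in the next induction at the moment when a hole enters row \<open>r\<close>,
  since no inequality for a hole in that row is available before.\<close>

lemma inclen_rows: "v \<le> m \<Longrightarrow> inclen (step A) v r + A v (Suc r) \<le> inclen (step A) v (Suc r) + A v r"
proof (induction v)
  case 0 then show ?case using A_row[of 0 r] by simp
next
  case (Suc v)
  then have v: "v < m" and IH: "inclen (step A) v r + A v (Suc r) \<le> inclen (step A) v (Suc r) + A v r" by auto
  have g: "inclen (step A) v (Suc r) + (if step A v (Suc r) then 1 else 0) \<le> inclen (step A) (Suc v) (Suc r)"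
    by (rule inclen_ge)
  show ?case
  proof (cases "step A v r")
    case True
    then show ?thesis using inclen_mem[of "step A", OF True] IH g A_Suc[OF v, of r] A_Suc[OF v, of "Suc r"] by (auto split: if_splits)
  next
    case False
    have "A (Suc v) (Suc r) \<le> A (Suc v) r" using A_row Suc.prems by blast
    then show ?thesis using inclen_not_mem[of "step A", OF False] IH g A_Suc[OF v, of r] A_Suc[OF v, of "Suc r"] False
      by (auto simp: max_def split: if_splits)
  qed
qed

text \<open>The first part alone is not inductive: for an entry pulled up by a link, the preceding
  labels are counted from row \<open>r\<close> after the slide but from row \<open>Suc r\<close>
  before it. The second part compares these counts at a hole, and at a link its correction terms
  cancel because \<open>A v (Suc r) = B v r\<close>.\<close>

lemma inclen_B_le:
  "v \<le> m \<Longrightarrow> (\<forall>r. inclen (step B) v r \<le> inclen (step A) v r) \<and>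
     (\<forall>r. B v r < A v r \<longrightarrow> inclen (step B) v r + A v (Suc r) \<le> inclen (step A) v (Suc r) + B v r)"
proof (induction v)
  case 0 then show ?case using BA(3) by simp
next
  case (Suc v)
  then have v: "v < m" and IH1: "\<And>r. inclen (step B) v r \<le> inclen (step A) v r"
    and IH2: "\<And>r. B v r < A v r \<Longrightarrow> inclen (step B) v r + A v (Suc r) \<le> inclen (step A) v (Suc r) + B v r" by auto
  have key: "Suc (inclen (step B) v q) \<le> inclen (step A) (Suc v) q" if "step B v q" for q
  proof (cases "step A v q")
    case True
    then show ?thesis using inclen_mem[of "step A", OF True] IH1 by simp
  next
    case False
    then have l: "B v q < A v q" "link v q" using that step_B[OF v, of q] by (auto split: if_splits)
    then have "A v (Suc q) = B v q" using hole_cases[of v q] v by (auto simp: link_def)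
    then have "inclen (step B) v q \<le> inclen (step A) v (Suc q)" using IH2[OF l(1)] by simp
    moreover have "Suc (inclen (step A) v (Suc q)) \<le> inclen (step A) (Suc v) q"
      using l(2) by (intro inclen_step) (auto simp: link_def)
    ultimately show ?thesis by simp
  qed
  have P1: "inclen (step B) (Suc v) r \<le> inclen (step A) (Suc v) r" for r
  proof (cases "inclen (step B) (Suc v) r = inclen (step B) v r")
    case True then show ?thesis using IH1[of r] inclen_Suc_ge[of "step A" v r] by linarith
  next
    case False
    then obtain q where q: "q \<ge> r" "step B v q" "inclen (step B) (Suc v) r = Suc (inclen (step B) v q)" using inclen_cases[of "step B" v r] by metis
    have "Suc (inclen (step B) v q) \<le> inclen (step A) (Suc v) q" by (rule key[OF q(2)])
    also have "\<dots> \<le> inclen (step A) (Suc v) r" by (rule inclen_antimono[OF q(1)])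
    finally show ?thesis using q(3) by simp
  qed
  have P2: "inclen (step B) (Suc v) r + A (Suc v) (Suc r) \<le> inclen (step A) (Suc v) (Suc r) + B (Suc v) r"
    if h: "B (Suc v) r < A (Suc v) r" for r
  proof -
    have g: "inclen (step A) v (Suc r) + (if step A v (Suc r) then 1 else 0) \<le> inclen (step A) (Suc v) (Suc r)"
      by (rule inclen_ge)
    note lens = A_Suc[OF v, of r] A_Suc[OF v, of "Suc r"] B_Suc[OF v, of r]
    have AB: "A (Suc v) (Suc r) \<le> B (Suc v) r" using BA(3)[of "Suc v" r] Suc.prems by simp
    show ?thesis
    proof (cases "step B v r")
      case True
      have "B v r < A v r" using h True lens step_B[OF v, of r] by (auto split: if_splits)
      then show ?thesis using IH2[of r] inclen_mem[of "step B", OF True] g lens True by (auto split: if_splits)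
    next
      case False
      have 1: "inclen (step B) v r + A (Suc v) (Suc r) \<le> inclen (step A) (Suc v) (Suc r) + B (Suc v) r"
      proof (cases "B v r < A v r")
        case True
        then show ?thesis using IH2[OF True] g lens False by (auto split: if_splits)
      next
        case no: False
        then have "A v r = B v r" using hole_cases[of v r] v by simp
        then show ?thesis using IH1[of r] inclen_rows[of v r] v g lens False by (auto split: if_splits)
      qed
      have "inclen (step B) (Suc v) (Suc r) \<le> inclen (step A) (Suc v) (Suc r)" by (rule P1)
      then show ?thesis using 1 AB inclen_not_mem[of "step B", OF False] by (auto simp: max_def)
    qed
  qed
  show ?case using P1 P2 by blast
qed

text \<open>For the converse bound, the alternative covers chains whose entries have been pulled
  into the row above. Row 0 has no row above, so the alternative vanishes where the result is
  used.\<close>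

lemma inclen_A_le:
  "v \<le> m \<Longrightarrow> inclen (step A) v r \<le> inclen (step B) v r \<or>
     (\<exists>q. r = Suc q \<and> inclen (step A) v r + B v q \<le> inclen (step B) v q + A v r)"
proof (induction v arbitrary: r)
  case 0 then show ?case by simp
next
  case (Suc v)
  then have v: "v < m" by simp
  let ?a = "inclen (step A)" and ?b = "inclen (step B)"
  have IH: "?a v r \<le> ?b v r \<or> (\<exists>q. r = Suc q \<and> ?a v r + B v q \<le> ?b v q + A v r)" for r using Suc v by simp
  have gb: "?b v r + (if step B v r then 1 else 0) \<le> ?b (Suc v) r" for r by (rule inclen_ge)
  note lens = A_Suc[OF v] B_Suc[OF v]
  have key: "?a (Suc v) p \<le> ?b (Suc v) p \<or> (\<exists>q. p = Suc q \<and> ?a (Suc v) p + B (Suc v) q \<le> ?b (Suc v) q + A (Suc v) p)"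
    if sp: "step A v p" for p
    using IH[of p]
  proof
    assume le: "?a v p \<le> ?b v p"
    show ?thesis
    proof (cases "step B v p")
      case True
      then show ?thesis using le inclen_mem[of "step A", OF sp] inclen_mem[of "step B", OF True] by simp
    next
      case False
      then obtain q where q: "p = Suc q" "link v q" using sp step_B[OF v, of p] by (auto split: if_splits)
      have sB: "step B v q" using q(2) step_B[OF v, of q] by (auto simp: link_def)
      have "B (Suc v) q = A (Suc v) p" using lens sB sp q hole_cases[of v q] v by (auto simp: link_def)
      moreover have "?a (Suc v) p \<le> ?b (Suc v) q"
        using le inclen_mem[of "step A", OF sp] inclen_mem[of "step B", OF sB] inclen_antimono[of q p "step B" v] q(1) by simp
      ultimately show ?thesis using q(1) by auto
    qed
  next
    assume "\<exists>q. p = Suc q \<and> ?a v p + B v q \<le> ?b v q + A v p"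
    then obtain q where q: "p = Suc q" "?a v p + B v q \<le> ?b v q + A v p" by blast
    have "?a (Suc v) p + B (Suc v) q \<le> ?b (Suc v) q + A (Suc v) p"
      using q(2) inclen_mem[of "step A", OF sp] lens(1)[of p] lens(2)[of q] sp gb[of q] by (auto split: if_splits)
    then show ?thesis using q(1) by blast
  qed
  show ?case
  proof (cases "?a (Suc v) r = ?a v r")
    case True
    from IH[of r] show ?thesis
    proof
      assume "?a v r \<le> ?b v r"
      then show ?thesis using True gb[of r] by linarith
    next
      assume "\<exists>q. r = Suc q \<and> ?a v r + B v q \<le> ?b v q + A v r"
      then obtain q where q: "r = Suc q" "?a v r + B v q \<le> ?b v q + A v r" by blast
      have "?a (Suc v) r + B (Suc v) q \<le> ?b (Suc v) q + A (Suc v) r"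
        using q(2) True lens(1)[of r] lens(2)[of q] gb[of q] by (auto split: if_splits)
      then show ?thesis using q(1) by blast
    qed
  next
    case False
    then obtain p where p: "p \<ge> r" "step A v p" "?a (Suc v) r = Suc (?a v p)" using inclen_cases[of "step A" v r] by metis
    have eq: "?a (Suc v) r = ?a (Suc v) p" using p inclen_mem[of "step A", OF p(2)] by simp
    show ?thesis
    proof (cases "p = r")
      case True then show ?thesis using key[OF p(2)] by simp
    next
      case ne: False
      have "?a (Suc v) p \<le> ?b (Suc v) r"
        using key[OF p(2)]
      proof
        assume "?a (Suc v) p \<le> ?b (Suc v) p"
        then show ?thesis using inclen_antimono[OF p(1), of "step B" "Suc v"] by linarith
      next
        assume "\<exists>q. p = Suc q \<and> ?a (Suc v) p + B (Suc v) q \<le> ?b (Suc v) q + A (Suc v) p"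
        then obtain q where q: "p = Suc q" "?a (Suc v) p + B (Suc v) q \<le> ?b (Suc v) q + A (Suc v) p" by blast
        have "A (Suc v) p \<le> B (Suc v) q" using BA(3)[of "Suc v" q] Suc.prems q(1) by simp
        then have "?a (Suc v) p \<le> ?b (Suc v) q" using q(2) by linarith
        also have "\<dots> \<le> ?b (Suc v) r" using ne p(1) q(1) by (intro inclen_antimono) auto
        finally show ?thesis .
      qed
      then show ?thesis using eq by simp
    qed
  qed
qed

theorem inclen_slide: "v \<le> m \<Longrightarrow> inclen (step B) v 0 = inclen (step A) v 0"
  using inclen_B_le[of v] inclen_A_le[of v 0] by (auto intro: antisym)

end

text \<open>Models the rectangle of \<open>R\<close> rows and \<open>C\<close> columns in the
  staircase tableau, whose box \<open>(i, j)\<close> has label \<open>i + j\<close> and lies in row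
  \<open>i\<close>. Slides may move its entries, but the inequalities between their rows
  survive.\<close>

definition pattern :: "nat \<Rightarrow> nat \<Rightarrow> (nat \<Rightarrow> nat \<Rightarrow> bool) \<Rightarrow> (nat \<Rightarrow> nat \<Rightarrow> nat) \<Rightarrow> bool" where
  "pattern R C J x \<longleftrightarrow> (\<forall>i<R. \<forall>j<C. J (i + j) (x i j)) \<and> (\<forall>i<R. \<forall>j. Suc j < C \<longrightarrow> x i (Suc j) \<le> x i j) \<and>
     (\<forall>i. \<forall>j<C. Suc i < R \<longrightarrow> x i j < x (Suc i) j)"

lemma patternD:
  assumes "pattern R C J x"
  shows "i < R \<Longrightarrow> j < C \<Longrightarrow> J (i + j) (x i j)" "i < R \<Longrightarrow> Suc j < C \<Longrightarrow> x i (Suc j) \<le> x i j"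
    "Suc i < R \<Longrightarrow> j < C \<Longrightarrow> x i j < x (Suc i) j"
  using assms by (auto simp: pattern_def)

lemma pattern_row_mono:
  assumes "pattern R C J x" "i < R" "j \<le> k" "k < C"
  shows "x i k \<le> x i j"
  using assms(3,4)
proof (induction k rule: dec_induct)
  case (step k)
  then show ?case using patternD(2)[OF assms(1,2), of k] by simp
qed simp

section \<open>Rectangular patterns under a single slide\<close>

context slide
begin

text \<open>An entry \<open>Suc p\<close> in row \<open>Suc r\<close> forces row \<open>r\<close> to
  grow at \<open>p\<close> too. The hole in row \<open>r\<close> then moves one box to the right and
  is again just above the next entry of row \<open>Suc r\<close>.\<close>

lemma link_Suc:
  assumes "Suc p < m" "link p r" "step A (Suc p) (Suc r)"
  shows "link (Suc p) r"
proof -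
  have l: "B p r < A p r" "step A p (Suc r)" "Suc (A p (Suc r)) = A p r" using assms(2) by (auto simp: link_def)
  have p: "p < m" using assms(1) by simp
  have "Suc (A (Suc p) (Suc r)) \<le> A (Suc p) r" by (rule step_A_upper[OF assms(1,3)])
  then have s: "step A p r" using A_Suc[OF p, of r] A_Suc[OF p, of "Suc r"] l by (auto split: if_splits)
  moreover have "step B p r" using s l step_B_hole[OF p] by simp
  ultimately show ?thesis using l assms(3) A_Suc[OF p, of r] A_Suc[OF p, of "Suc r"] B_Suc[OF p, of r] by (auto simp: link_def)
qed

lemma link_pred:
  assumes "Suc p < m" "link (Suc p) r" "step B p r"
  shows "link p r" "step A p r"
proof -
  have l: "B (Suc p) r < A (Suc p) r" "Suc (A (Suc p) (Suc r)) = A (Suc p) r" using assms(2) by (auto simp: link_def)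
  have p: "p < m" using assms(1) by simp
  note lens = A_Suc[OF p, of r] A_Suc[OF p, of "Suc r"] B_Suc[OF p, of r]
  have h: "B p r < A p r" using l assms(3) lens step_B_no_hole[OF p, of r] by (auto split: if_splits)
  show s: "step A p r" using h l(1) lens assms(3) hole_cases[of p r] p by (auto split: if_splits)
  have "A p (Suc r) \<le> B p r" using BA(3) p by simp
  then have "step A p (Suc r)" using l lens s h hole_cases[of p r] p by (auto split: if_splits)
  then show "link p r" using l lens s h by (auto simp: link_def split: if_splits)
qed

text \<open>Keeps pattern columns strict in \<open>pattern_slide\<close>: an entry \<open>p\<close>
  that stays in row \<open>y\<close> prevents the entry \<open>Suc p\<close> of row
  \<open>Suc y\<close> from being pulled up.\<close>

lemma step_A_B_conflict:
  assumes "Suc p < m" "step A p y" "step B p y" "step A (Suc p) (Suc y)" "\<not> step B (Suc p) (Suc y)"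
  shows False
proof -
  have p: "p < m" using assms(1) by simp
  note lens = A_Suc[OF p] B_Suc[OF p]
  from assms(4,5) have n: "\<not> B (Suc p) (Suc y) < A (Suc p) (Suc y)" "link (Suc p) y"
    using step_B[OF assms(1), of "Suc y"] by (auto split: if_splits)
  have l: "link p y" by (rule link_pred(1)[OF assms(1) n(2) assms(3)])
  then have s: "step A p (Suc y)" by (simp add: link_def)
  show False
  proof (cases "B p (Suc y) < A p (Suc y)")
    case True
    then have "step B p (Suc y)" using step_B_hole[OF p] s by simp
    then show False using n(1) lens[of "Suc y"] s True by simp
  next
    case False
    then have "\<not> step B p (Suc y)" using step_B_no_hole[OF p] l by blast
    then show False using n(1) lens[of "Suc y"] s BA(1)[of p "Suc y"] p by simp
  qed
qed

text \<open>The counterpart for \<open>pattern_unslide\<close>: if \<open>p\<close> has been pulled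
  into row \<open>y\<close>, then before the slide row \<open>y\<close> was too short to allow
  \<open>Suc p\<close> in row \<open>Suc y\<close>.\<close>

lemma step_B_A_conflict:
  assumes "Suc p < m" "step B p y" "\<not> step A p y" "step A (Suc p) (Suc y)"
  shows False
proof -
  have p: "p < m" using assms(1) by simp
  have l: "link p y" using assms(2,3) step_B[OF p, of y] by (auto split: if_splits)
  then show False using step_A_upper[OF assms(1,4)] A_Suc[OF p, of y] A_Suc[OF p, of "Suc y"] assms(3) by (auto simp: link_def)
qed

text \<open>An entry of the pattern is moved up exactly if it, or an earlier entry of its pattern row in the same row of the
  tableau, does not stay in place.\<close>

lemma pattern_slide:
  assumes P: "pattern R C (step A) x" and RC: "R + C \<le> Suc m"
  shows "\<exists>y. pattern R C (step B) y"
proof -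
  define U where "U i j \<longleftrightarrow> (\<exists>l\<le>j. x i l = x i j \<and> \<not> step B (i + l) (x i l))" for i j
  define y where "y i j = (if U i j then x i j - 1 else x i j)" for i j
  have lm: "i < R \<Longrightarrow> j < C \<Longrightarrow> i + j < m" for i j using RC by simp
  \<comment> \<open>A link at one entry passes to the later entries of the same pattern row and
    tableau row by \<open>link_Suc\<close>, so all of these entries can move up together.\<close>
  have linked: "\<exists>q. x i j = Suc q \<and> link (i + j) q" if "U i j" "i < R" "j < C" for i j
  proof -
    obtain l where l: "l \<le> j" "x i l = x i j" "\<not> step B (i + l) (x i l)" using \<open>U i j\<close> by (auto simp: U_def)
    have sA: "step A (i + k) (x i j)" if "l \<le> k" "k \<le> j" for k
    proof -
      have "x i k = x i j" using pattern_row_mono[OF P \<open>i < R\<close>, of l k] pattern_row_mono[OF P \<open>i < R\<close>, of k j] that l \<open>j < C\<close> by simp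
      then show ?thesis using patternD(1)[OF P \<open>i < R\<close>, of k] that \<open>j < C\<close> by simp
    qed
    obtain q where q: "x i j = Suc q" "link (i + l) q"
      using l sA[of l] step_B[OF lm[OF \<open>i < R\<close>, of l], of "x i j"] \<open>j < C\<close> by (auto split: if_splits)
    have "link (i + k) q" if "l \<le> k" "k \<le> j" for k
      using that
    proof (induction k rule: dec_induct)
      case (step k)
      then show ?case using link_Suc[of "i + k" q] sA[of "Suc k"] q(1) lm[OF \<open>i < R\<close>, of "Suc k"] \<open>j < C\<close> by simp
    qed (use q in simp)
    then show ?thesis using q(1) l(1) by blast
  qed
  have "pattern R C (step B) y" unfolding pattern_def
  proof (intro conjI allI impI)
    fix i j assume ij: "i < R" "j < C"
    show "step B (i + j) (y i j)"
    proof (cases "U i j")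
      case True
      then obtain q where "x i j = Suc q" "link (i + j) q" using linked ij by blast
      then show ?thesis using True step_B[OF lm[OF ij], of q] by (simp add: y_def link_def)
    next
      case False then show ?thesis by (auto simp: U_def y_def)
    qed
  next
    fix i j assume ij: "i < R" "Suc j < C"
    show "y i (Suc j) \<le> y i j"
    proof (cases "x i (Suc j) = x i j")
      case True
      then have "U i j \<Longrightarrow> U i (Suc j)" by (auto simp: U_def intro: le_SucI)
      then show ?thesis using True by (auto simp: y_def)
    next
      case False
      then show ?thesis using patternD(2)[OF P ij] by (auto simp: y_def)
    qed
  next
    fix i j assume ij: "j < C" "Suc i < R"
    have lt: "x i j < x (Suc i) j" using patternD(3)[OF P] ij by blast
    show "y i j < y (Suc i) j"
    proof (rule ccontr)
      assume "\<not> y i j < y (Suc i) j"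
      then have U: "U (Suc i) j" "\<not> U i j" and X: "x (Suc i) j = Suc (x i j)"
        using lt linked[of i j] ij by (auto simp: y_def split: if_splits)
      obtain l where l: "l \<le> j" "x (Suc i) l = Suc (x i j)" "\<not> step B (Suc i + l) (x (Suc i) l)" using U(1) X by (auto simp: U_def)
      have lC: "l < C" using l ij by simp
      have "x i j \<le> x i l" using pattern_row_mono[OF P, of i l j] ij l by simp
      moreover have "x i l < x (Suc i) l" using patternD(3)[OF P] ij lC by simp
      ultimately have xl: "x i l = x i j" using l(2) by simp
      then have "step B (i + l) (x i l)" using U(2) l(1) by (auto simp: U_def)
      moreover have "step A (i + l) (x i l)" "step A (Suc i + l) (x (Suc i) l)" using patternD(1)[OF P, of i l] patternD(1)[OF P, of "Suc i" l] ij lC by simp_all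
      ultimately show False using step_A_B_conflict[of "i + l" "x i l"] l xl lm[of "Suc i" l] ij lC by simp
    qed
  qed
  then show ?thesis by blast
qed

lemma pattern_unslide:
  assumes P: "pattern R C (step B) x" and RC: "R + C \<le> Suc m"
  shows "\<exists>y. pattern R C (step A) y"
proof -
  \<comment> \<open>Mirror image of the forward direction: \<open>link_pred\<close> carries a link
    from a later entry back to the earlier ones, hence \<open>l \<ge> j\<close>.\<close>
  define U where "U i j \<longleftrightarrow> (\<exists>l\<ge>j. l < C \<and> x i l = x i j \<and> \<not> step A (i + l) (x i l))" for i j
  define y where "y i j = (if U i j then Suc (x i j) else x i j)" for i j
  have lm: "i < R \<Longrightarrow> j < C \<Longrightarrow> i + j < m" for i j using RC by simp
  have linked: "link (i + j) (x i j)" if "U i j" "i < R" "j < C" for i j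
  proof -
    obtain l where l: "l \<ge> j" "l < C" "x i l = x i j" "\<not> step A (i + l) (x i l)" using \<open>U i j\<close> by (auto simp: U_def)
    have sB: "step B (i + k) (x i j)" if "j \<le> k" "k \<le> l" for k
    proof -
      have "x i k = x i j" using pattern_row_mono[OF P \<open>i < R\<close>, of j k] pattern_row_mono[OF P \<open>i < R\<close>, of k l] that l by simp
      then show ?thesis using patternD(1)[OF P \<open>i < R\<close>, of k] that l by simp
    qed
    have last: "link (i + l) (x i j)" using l sB[of l] step_B[OF lm[OF \<open>i < R\<close> l(2)], of "x i j"] by (auto split: if_splits)
    have "link (i + k) (x i j)" if "j \<le> k" "k \<le> l" for k
      using that(2,1)
    proof (induction k rule: inc_induct)
      case (step k)
      then show ?case using link_pred(1)[of "i + k" "x i j"] sB[of k] lm[OF \<open>i < R\<close>, of "Suc k"] l(2) by simp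
    qed (use last in simp)
    then show ?thesis using l by blast
  qed
  have "pattern R C (step A) y" unfolding pattern_def
  proof (intro conjI allI impI)
    fix i j assume ij: "i < R" "j < C"
    show "step A (i + j) (y i j)"
    proof (cases "U i j")
      case True
      then show ?thesis using linked[OF True ij] by (simp add: y_def link_def)
    next
      case False then show ?thesis using ij by (auto simp: U_def y_def)
    qed
  next
    fix i j assume ij: "i < R" "Suc j < C"
    show "y i (Suc j) \<le> y i j"
    proof (cases "x i (Suc j) = x i j")
      case True
      then have "U i (Suc j) \<Longrightarrow> U i j" by (auto simp: U_def dest: Suc_leD)
      then show ?thesis using True by (auto simp: y_def)
    next
      case False
      then show ?thesis using patternD(2)[OF P ij] by (auto simp: y_def)
    qed
  next
    fix i j assume ij: "j < C" "Suc i < R"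
    have lt: "x i j < x (Suc i) j" using patternD(3)[OF P] ij by blast
    show "y i j < y (Suc i) j"
    proof (rule ccontr)
      assume "\<not> y i j < y (Suc i) j"
      then have U: "U i j" "\<not> U (Suc i) j" and X: "x (Suc i) j = Suc (x i j)"
        using lt by (auto simp: y_def split: if_splits)
      obtain l where l: "l \<ge> j" "l < C" "x i l = x i j" "\<not> step A (i + l) (x i l)" using U(1) by (auto simp: U_def)
      have "x (Suc i) l \<le> x (Suc i) j" using pattern_row_mono[OF P, of "Suc i" j l] ij l by simp
      moreover have "x i l < x (Suc i) l" using patternD(3)[OF P, of i l] ij l by simp
      ultimately have xl: "x (Suc i) l = Suc (x i l)" using l(3) X by simp
      then have "step A (Suc i + l) (x (Suc i) l)" using U(2) l X by (auto simp: U_def)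
      moreover have "step B (i + l) (x i l)" using patternD(1)[OF P, of i l] ij l by simp
      ultimately show False using step_B_A_conflict[of "i + l" "x i l"] l xl lm[of "Suc i" l] ij by simp
    qed
  qed
  then show ?thesis by blast
qed

end

section \<open>The right column determines the increasing subsequences of factors\<close>

lemma discrete_drop: "(a::nat) \<le> b \<Longrightarrow> P b \<Longrightarrow> \<not> P a \<Longrightarrow> \<exists>p. a \<le> p \<and> p < b \<and> P (Suc p) \<and> \<not> P p"
proof (induction b rule: dec_induct)
  case (step b)
  then show ?case by (cases "P b") (auto intro: less_SucI)
qed simp

text \<open>The array of a word of length \<open>Suc N\<close>, reduced to its row lengths;
  \<open>J\<close> records the top row, that is, the word.\<close>

locale stairs =
  fixes N m :: nat and L :: "nat \<Rightarrow> nat \<Rightarrow> nat \<Rightarrow> nat" and J :: "nat \<Rightarrow> nat \<Rightarrow> bool"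
  assumes sl: "t < N \<Longrightarrow> slide m (L (Suc t)) (L t)"
    and init: "t \<le> N \<Longrightarrow> L t 0 r = t - r"
    and mono: "t \<le> N \<Longrightarrow> v < m \<Longrightarrow> L t v r \<le> L t (Suc v) r" "t \<le> N \<Longrightarrow> v < m \<Longrightarrow> L t (Suc v) r \<le> Suc (L t v r)"
    and top: "v < m \<Longrightarrow> r \<le> N \<Longrightarrow> step (L N) v r \<longleftrightarrow> J v r"
begin

text \<open>The longest increasing subsequence of a factor (\<open>window\<close> below) equals \<open>E v 0 i\<close> minus the least cost of a chain
  \<open>i \<le> q 0 \<le> \<dots> \<le> q (r - 1) \<le> N - r\<close>, and both terms depend only on the right column.\<close>

definition E :: "nat \<Rightarrow> nat \<Rightarrow> nat \<Rightarrow> int" where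
  "E v s p = int (L (p + s) v s) - int p"

definition eps :: "nat \<Rightarrow> nat \<Rightarrow> nat \<Rightarrow> bool" where
  "eps v s p = step (L (p + s)) v s"

text \<open>Written out, this is \<open>L (p + s) v s - L (Suc (p + s)) v (Suc s)\<close>, which is
  non-negative by the strip condition between neighbouring array rows.\<close>

definition gap :: "nat \<Rightarrow> nat \<Rightarrow> nat \<Rightarrow> int" where
  "gap v s p = E v s p - E v (Suc s) p"

definition cost :: "nat \<Rightarrow> nat \<Rightarrow> (nat \<Rightarrow> nat) \<Rightarrow> int" where
  "cost v r q = (\<Sum>s<r. gap v s (q s))"

definition chain :: "nat \<Rightarrow> nat \<Rightarrow> nat \<Rightarrow> (nat \<Rightarrow> nat) \<Rightarrow> bool" where
  "chain i M r q \<longleftrightarrow> (\<forall>s<r. i \<le> q s \<and> q s \<le> M) \<and> (\<forall>s. Suc s < r \<longrightarrow> q s \<le> q (Suc s))"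

lemma cost_0 [simp]: "cost v 0 q = 0" and cost_Suc [simp]: "cost v (Suc r) q = cost v r q + gap v r (q r)"
  by (simp_all add: cost_def)

lemma cost_upd [simp]: "cost v r (q(r := p)) = cost v r q"
  by (simp add: cost_def)

lemma chain_0 [simp]: "chain i M 0 q"
  by (simp add: chain_def)

lemma chain_Suc: "chain i M (Suc r) q \<longleftrightarrow> chain i (q r) r q \<and> i \<le> q r \<and> q r \<le> M"
proof
  assume c: "chain i M (Suc r) q"
  have "q s \<le> q r" if "s \<le> r" for s
    using that
  proof (induction s rule: inc_induct)
    case (step s)
    then show ?case using c by (auto simp: chain_def intro: order_trans)
  qed simp
  then show "chain i (q r) r q \<and> i \<le> q r \<and> q r \<le> M" using c by (auto simp: chain_def)
next
  assume "chain i (q r) r q \<and> i \<le> q r \<and> q r \<le> M"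
  then show "chain i M (Suc r) q" by (auto simp: chain_def less_Suc_eq)
qed

lemma chain_mono: "chain i M r q \<Longrightarrow> M \<le> M' \<Longrightarrow> chain i M' r q"
  by (auto simp: chain_def)

lemma chain_upd [simp]: "chain i M r (q(r := p)) = chain i M r q"
  by (auto simp: chain_def)

lemma E_Suc: "v < m \<Longrightarrow> p + s \<le> N \<Longrightarrow> E (Suc v) s p = E v s p + of_bool (eps v s p)"
  using mono[of "p + s" v s] by (auto simp: E_def eps_def step_def)

lemma gap_Suc: "v < m \<Longrightarrow> p + Suc s \<le> N \<Longrightarrow> gap (Suc v) s p = gap v s p + of_bool (eps v s p) - of_bool (eps v (Suc s) p)"
  by (simp add: gap_def E_Suc)

lemma gap_nonneg: "v \<le> m \<Longrightarrow> p + Suc s \<le> N \<Longrightarrow> 0 \<le> gap v s p"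
  using slide.BA(3)[OF sl, of "p + s" v s] by (simp add: gap_def E_def)

text \<open>Row \<open>s\<close> of \<open>stair (p + s)\<close> has exactly \<open>p\<close> boxes,
  which is why \<open>E\<close> subtracts \<open>p\<close>: it counts the labels below
  \<open>v\<close> in row \<open>s\<close> of array row \<open>p + s\<close>.\<close>

lemma E_init: "p + s \<le> N \<Longrightarrow> E 0 s p = 0"
  by (simp add: E_def init)

lemma gap_init: "p + Suc s \<le> N \<Longrightarrow> gap 0 s p = 0"
  by (simp add: gap_def E_init)

text \<open>The label is in row \<open>s\<close> after the slide but not before it, so it was pulled
  up through a link; the equation in the definition of \<open>link\<close> says that the gap
  vanishes.\<close>

lemma eps_rise:
  assumes "v < m" "Suc p + s \<le> N" "eps v s p" "\<not> eps v s (Suc p)"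
  shows "eps v (Suc s) p" "gap v s p = 0"
proof -
  interpret slide m "L (Suc (p + s))" "L (p + s)" using sl assms(2) by simp
  have l: "link v s" using assms(3,4) step_B[OF assms(1), of s] by (auto simp: eps_def split: if_splits)
  then show "eps v (Suc s) p" by (simp add: link_def eps_def)
  show "gap v s p = 0" using l hole_cases[of v s] assms(1) by (simp add: link_def gap_def E_def split: if_splits)
qed

text \<open>Here the label leaves row \<open>Suc s\<close> during the slide, which again requires a
  link and hence a vanishing gap.\<close>

lemma eps_fall:
  assumes "v < m" "Suc p + Suc s \<le> N" "eps v (Suc s) (Suc p)" "\<not> eps v (Suc s) p"
  shows "eps v s (Suc p)" "gap v s (Suc p) = 0"
proof -
  interpret slide m "L (Suc (p + Suc s))" "L (p + Suc s)" using sl assms(2) by simp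
  have l: "link v s" using assms(3,4) step_B[OF assms(1), of "Suc s"] by (auto simp: eps_def split: if_splits)
  have "L (p + Suc s) v s < L (Suc (p + Suc s)) v s" using l unfolding link_def by blast
  then have "step (L (p + Suc s)) v s" using step_B_hole[OF assms(1)] l by blast
  then show "eps v s (Suc p)" by (simp add: eps_def)
  have "L (p + Suc s) v s = L (Suc (p + Suc s)) v (Suc s)"
    using l hole_cases[of v s] assms(1) unfolding link_def by (simp split: if_splits)
  then show "gap v s (Suc p) = 0" by (simp add: gap_def E_def)
qed

lemma eps_row0_Suc: "v < m \<Longrightarrow> Suc p \<le> N \<Longrightarrow> eps v 0 (Suc p) \<Longrightarrow> eps v 0 p"
proof -
  assume a: "v < m" "Suc p \<le> N" "eps v 0 (Suc p)"
  interpret slide m "L (Suc p)" "L p" using sl a(2) by simp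
  show ?thesis using a(3) step_B[OF a(1), of 0] by (auto simp: eps_def)
qed

lemma eps_row0: "v < m \<Longrightarrow> i \<le> p \<Longrightarrow> p \<le> N \<Longrightarrow> eps v 0 p \<Longrightarrow> eps v 0 i"
proof (rule ccontr)
  assume a: "v < m" "i \<le> p" "p \<le> N" "eps v 0 p" "\<not> eps v 0 i"
  then obtain d where "d < p" "eps v 0 (Suc d)" "\<not> eps v 0 d" using discrete_drop[of i p "eps v 0"] by blast
  then show False using eps_row0_Suc[OF a(1), of d] a(3) by simp
qed

text \<open>Moving a point of the chain to a place where \<open>eps\<close> falls (respectively rises) costs nothing.\<close>

lemma chain_shift_up:
  assumes v: "v < m"
  shows "i \<le> M \<Longrightarrow> M + r \<le> N \<Longrightarrow> chain i M r q \<Longrightarrow>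
    \<exists>q'. chain i M r q' \<and> cost (Suc v) r q' + of_bool (eps v r M) \<le> cost v r q + of_bool (eps v 0 i)"
proof (induction r arbitrary: M)
  case 0
  then show ?case using eps_row0[OF v, of i M] by (intro exI[of _ q]) auto
next
  case (Suc r)
  have c: "chain i (q r) r q" "i \<le> q r" "q r \<le> M" using Suc.prems(3) by (auto simp: chain_Suc)
  \<comment> \<open>The increments of \<open>cost\<close> telescope as long as
    \<open>eps v (Suc r)\<close> does not become true between the last point and \<open>M\<close>.
    If it does, the last point moves to the place where this happens, and the gap there is
    zero.\<close>
  obtain x where x: "q r \<le> x" "x \<le> M" "gap v r x \<le> gap v r (q r)" "eps v (Suc r) M \<Longrightarrow> eps v (Suc r) x"
  proof (cases "eps v (Suc r) M \<and> \<not> eps v (Suc r) (q r)")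
    case True
    then obtain p where p: "q r \<le> p" "p < M" "eps v (Suc r) (Suc p)" "\<not> eps v (Suc r) p"
      using discrete_drop[of "q r" M "eps v (Suc r)"] c(3) by blast
    have "gap v r (Suc p) = 0" using eps_fall(2)[OF v _ p(3,4)] p(2) Suc.prems(2) by simp
    moreover have "0 \<le> gap v r (q r)" using gap_nonneg[of v "q r" r] v c(3) Suc.prems(2) by simp
    ultimately show ?thesis using that[of "Suc p"] p by simp
  next
    case False
    then show ?thesis using that[of "q r"] c(3) by simp
  qed
  have "chain i x r q" using chain_mono[OF c(1) x(1)] .
  then obtain q' where q': "chain i x r q'" "cost (Suc v) r q' + of_bool (eps v r x) \<le> cost v r q + of_bool (eps v 0 i)"
    using Suc.IH[of x] x c Suc.prems(2) by auto
  have "gap (Suc v) r x = gap v r x + of_bool (eps v r x) - of_bool (eps v (Suc r) x)"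
    using gap_Suc[OF v, of x r] x(2) Suc.prems(2) by simp
  moreover obtain Q where "Q r = x" "chain i x r Q" "\<And>w. cost w r Q = cost w r q'"
    using q'(1) by (metis chain_upd cost_upd fun_upd_same)
  ultimately show ?case using q' x c by (intro exI[of _ Q]) (auto simp: chain_Suc)
qed

lemma chain_shift_down:
  assumes v: "v < m"
  shows "i \<le> M \<Longrightarrow> M + r \<le> N \<Longrightarrow> chain i M r q \<Longrightarrow>
    \<exists>q' x. chain i x r q' \<and> i \<le> x \<and> x \<le> M \<and> cost (Suc v) r q' \<le> cost (Suc v) r q \<and>
      cost v r q' + of_bool (eps v 0 i) \<le> cost (Suc v) r q + of_bool (eps v r x)"
proof (induction r arbitrary: M)
  case 0
  then show ?case by (intro exI[of _ q] exI[of _ i]) auto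
next
  case (Suc r)
  have c: "chain i (q r) r q" "i \<le> q r" "q r \<le> M" using Suc.prems(3) by (auto simp: chain_Suc)
  obtain q' x where q': "chain i x r q'" "i \<le> x" "x \<le> q r" "cost (Suc v) r q' \<le> cost (Suc v) r q"
      "cost v r q' + of_bool (eps v 0 i) \<le> cost (Suc v) r q + of_bool (eps v r x)"
    using Suc.IH[OF c(2) _ c(1)] c Suc.prems(2) by auto
  have gS: "gap (Suc v) r p = gap v r p + of_bool (eps v r p) - of_bool (eps v (Suc r) p)" if "p \<le> M" for p
    using gap_Suc[OF v, of p r] that Suc.prems(2) by simp
  have g0: "0 \<le> gap (Suc v) r (q r)" using gap_nonneg[of "Suc v" "q r" r] v c(3) Suc.prems(2) by simp
  show ?case
  proof (cases "eps v r x \<and> \<not> eps v r (q r)")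
    case True
    \<comment> \<open>The telescoping sum would lose a unit between \<open>x\<close> and
      \<open>q r\<close>. The point \<open>p\<close> avoids this: \<open>gap v r p\<close> and
      \<open>gap (Suc v) r p\<close> are both zero, and \<open>eps v (Suc r) p\<close> supplies the
      unit.\<close>
    then obtain p where p: "x \<le> p" "p < q r" "eps v r p" "\<not> eps v r (Suc p)"
      using discrete_drop[of x "q r" "\<lambda>p. \<not> eps v r p"] q'(3) by blast
    note rise = eps_rise[OF v _ p(3,4)]
    have "gap v r p = 0" "eps v (Suc r) p" using rise p(2) c(3) Suc.prems(2) by auto
    moreover obtain Q where Q: "Q r = p" "chain i x r Q" "\<And>w. cost w r Q = cost w r q'"
      using q'(1) by (metis chain_upd cost_upd fun_upd_same)
    moreover have "chain i p r Q" using chain_mono[OF Q(2) p(1)] .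
    ultimately show ?thesis using q' p c g0 gS[of p] True
      by (intro exI[of _ Q] exI[of _ p]) (auto simp: chain_Suc)
  next
    case False
    moreover obtain Q where Q: "Q r = q r" "chain i x r Q" "\<And>w. cost w r Q = cost w r q'"
      using q'(1) by (metis chain_upd cost_upd fun_upd_same)
    moreover have "chain i (q r) r Q" using chain_mono[OF Q(2) q'(3)] .
    ultimately show ?thesis using q' c gS[of "q r"]
      by (intro exI[of _ Q] exI[of _ "q r"]) (cases "eps v r x"; auto simp: chain_Suc)
  qed
qed

definition window :: "nat \<Rightarrow> nat \<Rightarrow> nat \<Rightarrow> nat" where
  "window i = inclen (\<lambda>v r. r + i \<le> N \<and> J v r)"

lemma window_beyond: "N < r + i \<Longrightarrow> window i v r = 0"
proof -
  have "\<forall>r. N < r + i \<longrightarrow> window i v r = 0"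
    by (induction v) (force simp: window_def inclen.simps(2))+
  then show "N < r + i \<Longrightarrow> window i v r = 0" by blast
qed

lemma window_Suc:
  "r + i \<le> N \<Longrightarrow> window i (Suc v) r = (if J v r then Suc (window i v r) else max (window i v r) (window i (Suc v) (Suc r)))"
  unfolding window_def
  using inclen_mem[of "\<lambda>v r. r + i \<le> N \<and> J v r" v r] inclen_not_mem[of "\<lambda>v r. r + i \<le> N \<and> J v r" v r] by simp

text \<open>The bound \<open>N - r\<close> is chosen so that its \<open>eps\<close> refers to array
  row \<open>N\<close>, the top row, where it equals \<open>J v r\<close>. Thus window, cost and
  \<open>E\<close> change consistently with the new label.\<close>

lemma chain_below_window_step:
  assumes v: "v < m" and IH: "\<exists>q. chain i (N - r) r q \<and> int (window i v r) + cost v r q \<le> E v 0 i" and ri: "r + i \<le> N"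
  shows "\<exists>q. chain i (N - r) r q \<and> int (window i v r + (if J v r then 1 else 0)) + cost (Suc v) r q \<le> E (Suc v) 0 i"
proof -
  obtain q where q: "chain i (N - r) r q" "int (window i v r) + cost v r q \<le> E v 0 i" using IH by blast
  have iN: "i \<le> N - r" "N - r + r \<le> N" using ri by linarith+
  obtain q' where q': "chain i (N - r) r q'"
      "cost (Suc v) r q' + of_bool (eps v r (N - r)) \<le> cost v r q + of_bool (eps v 0 i)"
    using chain_shift_up[OF v iN q(1)] by blast
  have "eps v r (N - r) = J v r" using top[OF v, of r] ri by (simp add: eps_def)
  then show ?thesis using q' q(2) E_Suc[OF v, of i 0] ri by (intro exI[of _ q']) auto
qed

lemma chain_below_window:
  "v \<le> m \<Longrightarrow> r + i \<le> N \<Longrightarrow> \<exists>q. chain i (N - r) r q \<and> int (window i v r) + cost v r q \<le> E v 0 i"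
proof (induction v arbitrary: r)
  case 0
  have "cost 0 r (\<lambda>_. i) = 0" using 0 by (simp add: cost_def gap_init)
  then show ?case using 0 by (intro exI[of _ "\<lambda>_. i"]) (auto simp: chain_def window_def E_init)
next
  case (Suc v)
  then have v: "v < m" by simp
  have step: "\<exists>q. chain i (N - r) r q \<and> int (window i v r + (if J v r then 1 else 0)) + cost (Suc v) r q \<le> E (Suc v) 0 i"
    if "r + i \<le> N" for r
    by (rule chain_below_window_step[OF v _ that]) (use Suc.IH that v in simp)
  show ?case using Suc.prems(2)
  proof (induction "N - (r + i)" arbitrary: r rule: less_induct)
    case less
    show ?case
    proof (cases "window i (Suc v) r = window i v r + (if J v r then 1 else 0)")
      case True
      then show ?thesis using step[OF less.prems] by simp
    next
      case False
      \<comment> \<open>The maximum comes from lower rows, so the chain for \<open>Suc r\<close>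
        serves; dropping its last point does not raise the cost because gaps are
        non-negative.\<close>
      then have w: "window i (Suc v) r = window i (Suc v) (Suc r)" using window_Suc[OF less.prems, of v] by (auto split: if_splits)
      have le: "Suc r + i \<le> N"
      proof (rule ccontr)
        assume "\<not> Suc r + i \<le> N"
        then have "window i (Suc v) (Suc r) = 0" using window_beyond by simp
        then show False using w False window_Suc[OF less.prems, of v] by (auto split: if_splits)
      qed
      then obtain q where q: "chain i (N - Suc r) (Suc r) q" "int (window i (Suc v) (Suc r)) + cost (Suc v) (Suc r) q \<le> E (Suc v) 0 i"
        using less.hyps[of "Suc r"] less.prems by (metis Suc_diff_Suc Suc_le_lessD add_Suc lessI)
      have c: "chain i (q r) r q" "q r \<le> N - Suc r" using q(1) by (auto simp: chain_Suc)
      have "0 \<le> gap (Suc v) r (q r)" using gap_nonneg[of "Suc v" "q r" r] v c(2) le by simp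
      moreover have "chain i (N - r) r q" using chain_mono[OF c(1), of "N - r"] c(2) by simp
      ultimately show ?thesis using q(2) w by (intro exI[of _ q]) auto
    qed
  qed
qed

lemma window_below_chain:
  "v \<le> m \<Longrightarrow> r + i \<le> N \<Longrightarrow> chain i (N - r) r q \<Longrightarrow> E v 0 i \<le> int (window i v r) + cost v r q"
proof (induction v arbitrary: r q)
  case 0
  have "cost 0 r q = 0" unfolding cost_def
  proof (rule sum.neutral, intro ballI)
    fix s assume "s \<in> {..<r}"
    then have "q s + Suc s \<le> N" using 0 by (auto simp: chain_def dest!: spec[of _ s])
    then show "gap 0 s (q s) = 0" by (rule gap_init)
  qed
  then show ?case using 0 by (simp add: E_init)
next
  case (Suc v)
  then have v: "v < m" by simp
  have ES: "E (Suc v) 0 i = E v 0 i + of_bool (eps v 0 i)" using E_Suc[OF v, of i 0] Suc.prems(2) by simp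
  show ?case using Suc.prems(2,3)
  proof (induction "N - (r + i)" arbitrary: r q rule: less_induct)
    case less
    have iN: "i \<le> N - r" "N - r + r \<le> N" using less.prems(1) by linarith+
    obtain q' x where q': "chain i x r q'" "i \<le> x" "x \<le> N - r" "cost (Suc v) r q' \<le> cost (Suc v) r q"
      "cost v r q' + of_bool (eps v 0 i) \<le> cost (Suc v) r q + of_bool (eps v r x)"
      using chain_shift_down[OF v iN less.prems(2)] by blast
    have up: "E v 0 i \<le> int (window i v r) + cost v r q'"
      using Suc.IH[of r q'] v less.prems(1) chain_mono[OF q'(1,3)] by simp
    have J: "eps v r (N - r) = J v r" using top[OF v, of r] less.prems(1) by (simp add: eps_def)
    have wS: "window i v r + (if J v r then 1 else 0) \<le> window i (Suc v) r"
      using window_Suc[OF less.prems(1), of v] by auto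
    show ?case
    proof (cases "eps v r x \<and> \<not> J v r")
      case False
      then show ?thesis using up q'(5) wS ES by (cases "eps v r x") auto
    next
      case True
      \<comment> \<open>\<open>eps v r\<close> is lost between \<open>x\<close> and the top row.
        Appending \<open>p\<close>, a point of zero gap, gives a chain of length
        \<open>Suc r\<close> and reduces the claim to the smaller window.\<close>
      then obtain p where p: "x \<le> p" "p < N - r" "eps v r p" "\<not> eps v r (Suc p)"
        using discrete_drop[of x "N - r" "\<lambda>p. \<not> eps v r p"] q'(3) J by blast
      have pr: "gap v r p = 0" "eps v (Suc r) p" using eps_rise[OF v _ p(3,4)] p(2) by auto
      have "gap (Suc v) r p = 0" using gap_Suc[OF v, of p r] pr p by simp
      moreover have "chain i (N - Suc r) (Suc r) (q'(r := p))"
        using q'(1,2) p chain_mono[OF q'(1), of p] by (auto simp: chain_Suc)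
      ultimately have "E (Suc v) 0 i \<le> int (window i (Suc v) (Suc r)) + cost (Suc v) r q'"
        using less.hyps[of "Suc r" "q'(r := p)"] p q'(2) by simp
      moreover have "window i (Suc v) (Suc r) \<le> window i (Suc v) r"
        unfolding window_def by (rule inclen_antimono) simp
      ultimately show ?thesis using q'(4) by simp
    qed
  qed
qed

end

text \<open>At \<open>v = m\<close> the quantities \<open>E\<close> and \<open>cost\<close> depend
  on the right column only, and an optimal chain of either array is also a chain for the other
  one.\<close>

theorem window_eq:
  assumes "stairs N m L J" "stairs N m L' J'" "\<And>t r. t \<le> N \<Longrightarrow> L t m r = L' t m r" "r + i \<le> N"
  shows "stairs.window N J i m r = stairs.window N J' i m r"
proof -
  interpret S: stairs N m L J by fact
  interpret S': stairs N m L' J' by fact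
  have E: "S.E m s p = S'.E m s p" if "p + s \<le> N" for s p
    using assms(3)[OF that] by (simp add: S.E_def S'.E_def)
  have ch: "S.chain = S'.chain" by (intro ext) (simp add: S.chain_def S'.chain_def)
  have cost: "S.cost m r q = S'.cost m r q" if "S.chain i (N - r) r q" for q
    unfolding S.cost_def S'.cost_def
  proof (rule sum.cong)
    fix s assume "s \<in> {..<r}"
    then have "q s \<le> N - r" "s < r" using that by (auto simp: S.chain_def)
    then show "S.gap m s (q s) = S'.gap m s (q s)" using E[of "q s" s] E[of "q s" "Suc s"] assms(4) by (simp add: S.gap_def S'.gap_def)
  qed simp
  obtain q where q: "S.chain i (N - r) r q" "int (S.window i m r) + S.cost m r q \<le> S.E m 0 i"
    using S.chain_below_window[OF order_refl assms(4)] by blast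
  obtain q' where q': "S'.chain i (N - r) r q'" "int (S'.window i m r) + S'.cost m r q' \<le> S'.E m 0 i"
    using S'.chain_below_window[OF order_refl assms(4)] by blast
  have "S'.E m 0 i \<le> int (S'.window i m r) + S'.cost m r q"
    by (rule S'.window_below_chain[OF order_refl assms(4)]) (use q ch in simp)
  moreover have "S.E m 0 i \<le> int (S.window i m r) + S.cost m r q'"
    by (rule S.window_below_chain[OF order_refl assms(4)]) (use q' ch in simp)
  moreover have "S.E m 0 i = S'.E m 0 i" using E[of i 0] assms(4) by simp
  ultimately show ?thesis using q q' cost ch by force
qed

section \<open>Words on staircases\<close>

lemma finite_inc: "finite {v. subseq v x \<and> sorted_wrt (<) v}"
  by (rule finite_subset[of _ "set (subseqs x)"]) (auto simp: subseqs_powset)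

lemma lis_ge: "subseq s x \<Longrightarrow> sorted_wrt (<) s \<Longrightarrow> length s \<le> lis x"
  unfolding lis_def by (rule Max_ge) (use finite_inc[of x] in auto)

lemma lis_ex: "\<exists>s. subseq s x \<and> sorted_wrt (<) s \<and> length s = lis x"
proof -
  have "lis x \<in> length ` {v. subseq v x \<and> sorted_wrt (<) v}"
    unfolding lis_def by (rule Max_in) (use finite_inc[of x] in \<open>auto intro: exI[of _ "[]"]\<close>)
  then show ?thesis by auto
qed

lemma subseq_rev: "subseq x y \<Longrightarrow> subseq (rev x) (rev y)"
proof (induction rule: list_emb.induct)
  case (list_emb_Cons2 a b x y)
  then show ?case by (auto intro: list_emb_append_mono)
qed (auto intro: subseq_rev_drop_many)

lemma subseq_rev_iff [simp]: "subseq (rev x) (rev y) \<longleftrightarrow> subseq x y"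
  using subseq_rev[of x y] subseq_rev[of "rev x" "rev y"] by auto

lemma subseq_mem: "subseq x y \<Longrightarrow> a \<in> set x \<Longrightarrow> a \<in> set y"
  by (elim list_emb_set) auto

lemma lds_rev: "lds x = lis (rev x)"
proof -
  have "{v. subseq v x \<and> sorted_wrt (>) v} = rev ` {v. subseq v (rev x) \<and> sorted_wrt (<) v}"
  proof (intro set_eqI iffI)
    fix v assume "v \<in> {v. subseq v x \<and> sorted_wrt (>) v}"
    then have "rev v \<in> {v. subseq v (rev x) \<and> sorted_wrt (<) v}" by (simp add: sorted_wrt_rev)
    then show "v \<in> rev ` {v. subseq v (rev x) \<and> sorted_wrt (<) v}" by (metis image_eqI rev_rev_ident)
  next
    fix v assume "v \<in> rev ` {v. subseq v (rev x) \<and> sorted_wrt (<) v}"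
    then obtain s where "v = rev s" "subseq s (rev x)" "sorted_wrt (<) s" by auto
    then show "v \<in> {v. subseq v x \<and> sorted_wrt (>) v}" using subseq_rev[of s "rev x"] by (simp add: sorted_wrt_rev)
  qed
  then show ?thesis by (simp add: lds_def lis_def image_image)
qed

lemma lis_Nil [simp]: "lis [] = 0"
  using lis_ex[of "[]"] by (metis list.size(3) list_emb_Nil2)

lemma lis_pos: "x \<noteq> [] \<Longrightarrow> 0 < lis x"
  using lis_ge[of "[hd x]" x] by (cases x) auto

lemma lis_mono: "subseq x y \<Longrightarrow> lis x \<le> lis y"
  using lis_ex[of x] lis_ge by (metis subseq_order.trans)

definition within :: "nat \<Rightarrow> nat \<Rightarrow> int list \<Rightarrow> int list" where
  "within u v x = filter (\<lambda>a. int u < a \<and> a \<le> int v) x"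

lemma within_snoc: "within u v (x @ [a]) = (if int u < a \<and> a \<le> int v then within u v x @ [a] else within u v x)"
  by (simp add: within_def)

lemma lis_within_mono: "v \<le> w \<Longrightarrow> lis (within u v x) \<le> lis (within u w x)"
proof (rule lis_mono)
  assume "v \<le> w"
  then have "within u v x = filter (\<lambda>a. a \<le> int v) (within u w x)"
    unfolding within_def filter_filter by (intro filter_cong) auto
  then show "subseq (within u v x) (within u w x)" by simp
qed

lemma lis_snoc_upper: "lis (x @ [a]) \<le> max (lis x) (Suc (lis (filter (\<lambda>b. b < a) x)))"
proof -
  obtain s where s: "subseq s (x @ [a])" "sorted_wrt (<) s" "length s = lis (x @ [a])" using lis_ex by blast
  obtain s1 s2 where d: "s = s1 @ s2" "subseq s1 x" "subseq s2 [a]" using s(1) by (auto simp: subseq_append_iff)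
  show ?thesis
  proof (cases "s2 = []")
    case True
    then show ?thesis using d s lis_ge[of s x] by simp
  next
    case False
    then have s2: "s2 = [a]" using d(3) by (cases s2) (auto split: if_splits)
    then have "filter (\<lambda>b. b < a) s1 = s1" "sorted_wrt (<) s1" using s(2) d(1) by (auto simp: sorted_wrt_append filter_id_conv)
    then have "length s1 \<le> lis (filter (\<lambda>b. b < a) x)" using subseq_filter[OF d(2), of "\<lambda>b. b < a"] lis_ge by metis
    then show ?thesis using s(3) d(1) s2 by simp
  qed
qed

lemma lis_snoc_lower: "Suc (lis (filter (\<lambda>b. b < a) x)) \<le> lis (x @ [a])"
proof -
  obtain s where s: "subseq s (filter (\<lambda>b. b < a) x)" "sorted_wrt (<) s" "length s = lis (filter (\<lambda>b. b < a) x)" using lis_ex by blast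
  have "set s \<subseteq> {b. b < a}"
    using subseq_mem[OF s(1)] by auto
  then have "sorted_wrt (<) (s @ [a])" using s(2) by (auto simp: sorted_wrt_append)
  moreover have "subseq (s @ [a]) (x @ [a])" using s(1) by (intro list_emb_append_mono) (auto intro: subseq_order.trans)
  ultimately show ?thesis using lis_ge[of "s @ [a]" "x @ [a]"] s(3) by simp
qed

lemma lis_within_snoc:
  assumes "u < w" "w \<le> v"
  shows "lis (within u v (x @ [int w])) = max (lis (within u v x)) (Suc (lis (within u (w - 1) x)))"
proof -
  have f: "filter (\<lambda>b. b < int w) (within u v x) = within u (w - 1) x"
    unfolding within_def filter_filter using assms by (intro filter_cong) auto
  have e: "within u v (x @ [int w]) = within u v x @ [int w]" using assms by (simp add: within_snoc)
  have "lis (within u v x) \<le> lis (within u v x @ [int w])" by (rule lis_mono) (simp add: subseq_rev_drop_many)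
  then show ?thesis using lis_snoc_upper[of "within u v x" "int w"] lis_snoc_lower[of "int w" "within u v x"] unfolding e f by simp
qed

text \<open>A strictly increasing subsequence uses the value \<open>Suc v\<close> at most once, as
  its last element.\<close>

lemma lis_within_Suc: "lis (within u (Suc v) x) \<le> Suc (lis (within u v x))"
proof -
  obtain s where s: "subseq s (within u (Suc v) x)" "sorted_wrt (<) s" "length s = lis (within u (Suc v) x)" using lis_ex by blast
  have sb: "b \<le> int (Suc v)" if "b \<in> set s" for b using subseq_mem[OF s(1)] that by (auto simp: within_def)
  show ?thesis
  proof (cases s rule: rev_cases)
    case (snoc t b)
    have t: "filter (\<lambda>b. b \<le> int v) t = t"
      using s(2) sb snoc by (force simp: filter_id_conv sorted_wrt_append)
    have "subseq t (within u (Suc v) x)" using s(1) snoc using subseq_order.trans[OF subseq_rev_drop_many[OF subseq_order.order_refl, of t "[b]"]] by blast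
    then have "subseq t (filter (\<lambda>b. b \<le> int v) (within u (Suc v) x))" using subseq_filter[of t _ "\<lambda>b. b \<le> int v"] t by metis
    also have "filter (\<lambda>b. b \<le> int v) (within u (Suc v) x) = within u v x"
      unfolding within_def filter_filter by (intro filter_cong) auto
    finally have "length t \<le> lis (within u v x)" using lis_ge s(2) snoc by (auto simp: sorted_wrt_append)
    then show ?thesis using s(3) snoc by simp
  qed (use s in simp)
qed

text \<open>Position \<open>c\<close> of a word of length \<open>n\<close> corresponds to row \<open>n - 1 - c\<close>, so that prefixes correspond to
  sets of bottom rows.\<close>

lemma inclen_word:
  "inclen (\<lambda>v r. r < length x \<and> x ! (length x - Suc r) = int (Suc (u + v))) v r = lis (within u (u + v) (take (length x - r) x))"
    (is "inclen ?J v r = _")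
proof (induction v arbitrary: r)
  case 0
  have "within u u y = []" for y by (simp add: within_def filter_empty_conv)
  then show ?case by simp
next
  case (Suc v)
  show ?case
  proof (induction "length x - r" arbitrary: r rule: less_induct)
    case less
    let ?l = "\<lambda>v r. lis (within u (u + v) (take (length x - r) x))"
    show ?case
    proof (cases "r < length x")
      case False
      then have "inclen ?J (Suc v) r = inclen ?J v r" using inclen_cases[of ?J v r] by auto
      then show ?thesis using Suc[of r] False by (simp add: within_def)
    next
      case True
      define a where "a = x ! (length x - Suc r)"
      have tk: "take (length x - r) x = take (length x - Suc r) x @ [a]"
        using True take_Suc_conv_app_nth[of "length x - Suc r" x] by (simp add: a_def Suc_diff_Suc)
      have IH: "inclen ?J (Suc v) (Suc r) = ?l (Suc v) (Suc r)" using less[of "Suc r"] True by simp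
      show ?thesis
      proof (cases "a = int (Suc (u + v))")
        case eq: True
        then have "inclen ?J (Suc v) r = Suc (inclen ?J v r)" using True by (intro inclen_mem) (simp add: a_def)
        moreover have "?l v r = ?l v (Suc r)" unfolding tk using eq by (simp add: within_snoc)
        moreover have "?l (Suc v) r = max (?l (Suc v) (Suc r)) (Suc (?l v (Suc r)))"
          unfolding tk eq using lis_within_snoc[of u "Suc (u + v)" "u + Suc v"] by simp
        ultimately show ?thesis using Suc[of r] lis_within_Suc[of u "u + v" "take (length x - Suc r) x"] by simp
      next
        case ne: False
        then have i: "inclen ?J (Suc v) r = max (inclen ?J v r) (inclen ?J (Suc v) (Suc r))" using inclen_not_mem[of ?J v r] by (simp add: a_def)
        have mon: "?l v (Suc r) \<le> ?l (Suc v) (Suc r)" by (rule lis_within_mono) simp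
        show ?thesis
        proof (cases "int u < a \<and> a \<le> int (u + v)")
          case True
          then obtain w where w: "a = int w" "u < w" "w \<le> u + v" using that[of "nat a"] by auto
          have "lis (within u (u + v) (take (length x - Suc r) x)) \<le> lis (within u (u + Suc v) (take (length x - Suc r) x))"
            by (rule lis_within_mono) simp
          moreover have "lis (within u (u + v) (take (length x - r) x)) =
              max (lis (within u (u + v) (take (length x - Suc r) x))) (Suc (lis (within u (w - 1) (take (length x - Suc r) x))))"
            unfolding tk w(1) by (rule lis_within_snoc) (use w in auto)
          moreover have "lis (within u (u + Suc v) (take (length x - r) x)) =
              max (lis (within u (u + Suc v) (take (length x - Suc r) x))) (Suc (lis (within u (w - 1) (take (length x - Suc r) x))))"
            unfolding tk w(1) by (rule lis_within_snoc) (use w in auto)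
          ultimately show ?thesis unfolding i Suc IH by linarith
        next
          case False
          then show ?thesis unfolding i Suc IH tk using mon ne by (auto simp: within_snoc)
        qed
      qed
    qed
  qed
qed

section \<open>Words as chains between consecutive staircases\<close>

definition stair :: "nat \<Rightarrow> (nat \<times> nat) set" where
  "stair k = {(r, c). r + c < k}"

definition diag :: "int list \<Rightarrow> nat \<Rightarrow> (nat \<times> nat) set" where
  "diag x v = {(r, c). Suc (r + c) < length x \<or> Suc (r + c) = length x \<and> x ! c \<le> int v}"

definition letters :: "nat \<Rightarrow> int list \<Rightarrow> bool" where
  "letters m x \<longleftrightarrow> (\<forall>a\<in>set x. 0 < a \<and> a \<le> int m)"

lemma diagram_between: "stair k \<subseteq> D \<Longrightarrow> D \<subseteq> stair (Suc k) \<Longrightarrow> diagram D"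
proof -
  assume a: "stair k \<subseteq> D" "D \<subseteq> stair (Suc k)"
  have "stair (Suc k) \<subseteq> {..k} \<times> {..k}" by (auto simp: stair_def)
  then have "finite D" using a(2) finite_subset[of D "{..k} \<times> {..k}"] by (simp add: subset_trans)
  moreover have "(r, c) \<in> D" if "(Suc r, c) \<in> D \<or> (r, Suc c) \<in> D" for r c
  proof -
    have "(r, c) \<in> stair k" using that a(2) by (auto simp: stair_def)
    then show ?thesis using a(1) by blast
  qed
  ultimately show ?thesis unfolding diagram_def by blast
qed

lemma diagram_stair [simp]: "diagram (stair k)"
  by (rule diagram_between[of "k - 1"]) (auto simp: stair_def)

text \<open>All new boxes lie on the antidiagonal \<open>r + c = k\<close>, where rows and columns
  are automatically distinct.\<close>

lemma strip_between: "stair k \<subseteq> A \<Longrightarrow> A \<subseteq> B \<Longrightarrow> B \<subseteq> stair (Suc k) \<Longrightarrow> strip A B"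
proof -
  assume a: "stair k \<subseteq> A" "A \<subseteq> B" "B \<subseteq> stair (Suc k)"
  then have "diagram A" "diagram B" using diagram_between by blast+
  moreover have "r + c = k" if "(r, c) \<in> B - A" for r c
    using that a by (force simp: stair_def)
  ultimately show ?thesis unfolding strip_def using a(2) by (metis add_left_cancel add_right_cancel)
qed

lemma strip_stair: "strip (stair k) (stair (Suc k))"
  by (rule strip_between) (auto simp: stair_def)

lemma len_stair [simp]: "len (stair k) r = k - r"
proof -
  have "{c. (r, c) \<in> stair k} = {..<k - r}" by (auto simp: stair_def)
  then show ?thesis by (simp add: len_def)
qed

lemma diag_bounds: "length x = Suc k \<Longrightarrow> stair k \<subseteq> diag x v" "length x = Suc k \<Longrightarrow> diag x v \<subseteq> stair (Suc k)"
  by (auto simp: stair_def diag_def)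

lemma strip_diag: "x \<noteq> [] \<Longrightarrow> strip (diag x v) (diag x (Suc v))"
  by (rule strip_between[of "length x - 1"]) (auto simp: stair_def diag_def)

lemma letters_nth: "letters m x \<Longrightarrow> i < length x \<Longrightarrow> 0 < x ! i \<and> x ! i \<le> int m"
  by (simp add: letters_def)

lemma diag_0: "letters m x \<Longrightarrow> length x = Suc k \<Longrightarrow> diag x 0 = stair k"
  using letters_nth[of m x] by (auto simp: stair_def diag_def) (metis le_add2 le_imp_less_Suc not_less of_nat_0)

lemma diag_top: "letters m x \<Longrightarrow> length x = Suc k \<Longrightarrow> diag x m = stair (Suc k)"
proof -
  assume x: "letters m x" "length x = Suc k"
  have "x ! c \<le> int m" if "Suc (r + c) = length x" for r c using letters_nth[OF x(1), of c] that by simp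
  then show ?thesis using x(2) by (auto simp: stair_def diag_def less_Suc_eq)
qed

lemma diag_rev: "diag (rev x) v = conjugate (diag x v)"
proof -
  have "(r, c) \<in> diag (rev x) v \<longleftrightarrow> (c, r) \<in> diag x v" for r c
  proof (cases "Suc (r + c) = length x")
    case True
    then have "rev x ! c = x ! r" by (subst rev_nth) (auto intro: arg_cong[of _ _ "(!) x"])
    then show ?thesis using True by (simp add: diag_def)
  qed (auto simp: diag_def)
  then show ?thesis by auto
qed

lemma step_diag:
  assumes "x \<noteq> []"
  shows "step (\<lambda>v. len (diag x (u + v))) v r \<longleftrightarrow> r < length x \<and> x ! (length x - Suc r) = int (Suc (u + v))"
proof -
  have "step (\<lambda>v. len (diag x (u + v))) v r \<longleftrightarrow> (r, len (diag x (u + v)) r) \<in> diag x (Suc (u + v)) - diag x (u + v)"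
    unfolding step_def using strip_mem[OF strip_diag[OF assms]] by simp
  also have "\<dots> \<longleftrightarrow> (\<exists>c. (r, c) \<in> diag x (Suc (u + v)) - diag x (u + v))"
    using strip_mem[OF strip_diag[OF assms]] by blast
  also have "\<dots> \<longleftrightarrow> r < length x \<and> x ! (length x - Suc r) = int (Suc (u + v))" (is "?L \<longleftrightarrow> ?R")
  proof
    assume ?L
    then obtain c where c: "Suc (r + c) = length x" "x ! c \<le> int (Suc (u + v))" "\<not> x ! c \<le> int (u + v)" by (auto simp: diag_def)
    then have "length x - Suc r = c" by simp
    then show ?R using c by auto
  next
    assume ?R then show ?L by (intro exI[of _ "length x - Suc r"]) (auto simp: diag_def)
  qed
  finally show ?thesis .
qed

lemma inclen_diag: "x \<noteq> [] \<Longrightarrow> inclen (step (\<lambda>v. len (diag x (u + v)))) v 0 = lis (within u (u + v) x)"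
  using inclen_word[of x u v 0] by (subst inclen_cong[OF step_diag]) auto

definition staircase :: "nat \<Rightarrow> int list \<Rightarrow> (nat \<Rightarrow> nat \<Rightarrow> (nat \<times> nat) set) \<Rightarrow> bool" where
  "staircase m x G \<longleftrightarrow> growth (length x - 1) m G \<and> (\<forall>t<length x. G t 0 = stair t) \<and> (\<forall>v\<le>m. G (length x - 1) v = diag x v)"

lemma staircase_exists:
  assumes "letters m x" "x \<noteq> []"
  shows "\<exists>G. staircase m x G"
proof -
  have l: "length x = Suc (length x - 1)" using assms(2) by (cases x) auto
  have "\<exists>G. growth (length x - 1) m G \<and> (\<forall>t\<le>length x - 1. G t 0 = stair t) \<and> (\<forall>v\<le>m. G (length x - 1) v = diag x v)"
    by (rule growth_exists) (use assms strip_stair strip_diag diag_0[OF assms(1) l] in auto)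
  then show ?thesis unfolding staircase_def using l by (metis Suc_leI Suc_le_mono)
qed

lemma staircase_rev: "staircase m x G \<Longrightarrow> staircase m (rev x) (\<lambda>t v. conjugate (G t v))"
proof -
  have "conjugate (stair t) = stair t" for t by (auto simp: stair_def conjugate_def)
  then show "staircase m x G \<Longrightarrow> staircase m (rev x) (\<lambda>t v. conjugate (G t v))"
    by (simp add: staircase_def growth_conjugate diag_rev)
qed

lemma stairs_word:
  assumes G: "staircase m x G" and x: "letters m x" "length x = Suc N"
  shows "stairs N m (\<lambda>t v. len (G t v)) (\<lambda>v r. r < length x \<and> x ! (length x - Suc r) = int (Suc v))"
proof -
  have g: "growth N m G" using G x by (simp add: staircase_def)
  have "slide m (\<lambda>v. len (G (Suc t) v)) (\<lambda>v. len (G t v))" if "t < N" for t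
    using growth_slide[OF g that, of 0 m] by simp
  moreover have "len (G t 0) r = t - r" if "t \<le> N" for t r using that G x by (simp add: staircase_def)
  moreover have "len (G t v) r \<le> len (G t (Suc v)) r \<and> len (G t (Suc v)) r \<le> Suc (len (G t v) r)" if "t \<le> N" "v < m" for t v r
    using strip_len[OF growthD(1)[OF g that]] by auto
  moreover have "step (\<lambda>v. len (G N v)) v r = (r < length x \<and> x ! (length x - Suc r) = int (Suc v))" if "v < m" "r \<le> N" for v r
  proof -
    have "step (\<lambda>v. len (G N v)) v r = step (\<lambda>v. len (diag x v)) v r"
      using that G x by (simp add: staircase_def step_def)
    also have "\<dots> = (r < length x \<and> x ! (length x - Suc r) = int (Suc v))"
      using step_diag[of x 0 v r] x(2) unfolding add_0 by (cases x) simp_all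
    finally show ?thesis .
  qed
  ultimately show ?thesis unfolding stairs_def by blast
qed

lemma within_all: "letters m x \<Longrightarrow> within 0 m x = x"
  by (auto simp: within_def letters_def filter_id_conv)

text \<open>Row \<open>s\<close> belongs to position \<open>N - s\<close>, so the condition
  \<open>s + i \<le> N\<close> discards the first \<open>i\<close> letters and rows from
  \<open>r\<close> on keep a prefix of length \<open>Suc N - r\<close>: windows are factors.\<close>

lemma lis_factor:
  assumes "letters m x" "length x = Suc N" "r + i \<le> N" "staircase m x G"
  shows "stairs.window N (\<lambda>v r. r < length x \<and> x ! (length x - Suc r) = int (Suc v)) i m r = lis (drop i (take (Suc N - r) x))"
proof -
  let ?y = "drop i x"
  have "(\<lambda>v r. r + i \<le> N \<and> r < length x \<and> x ! (length x - Suc r) = int (Suc v)) =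
     (\<lambda>v r. r < length ?y \<and> ?y ! (length ?y - Suc r) = int (Suc (0 + v)))"
    using assms(2,3) by (intro ext) (auto simp: Suc_diff_le)
  moreover have "within 0 m (take (length ?y - r) ?y) = take (length ?y - r) ?y"
    by (rule within_all) (use assms(1) in \<open>auto simp: letters_def dest!: in_set_takeD in_set_dropD\<close>)
  moreover have "take (length ?y - r) ?y = drop i (take (Suc N - r) x)"
    using assms(2,3) by (simp add: take_drop diff_commute)
  ultimately show ?thesis
    using inclen_word[of ?y 0 m r] unfolding stairs.window_def[OF stairs_word[OF assms(4,1,2)]] add_0 by metis
qed

lemma lis_factor_eq:
  assumes "letters m x" "letters m y" "length x = Suc N" "length y = Suc N" "staircase m x G" "staircase m y H"
    "\<And>t. t \<le> N \<Longrightarrow> G t m = H t m" "1 \<le> i" "i \<le> j" "j \<le> Suc N"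
  shows "lis (factor i j x) = lis (factor i j y)"
proof -
  have r: "Suc N - j + (i - 1) \<le> N" "Suc N - (Suc N - j) = j" using assms by auto
  have "lis (drop (i - 1) (take j x)) = lis (drop (i - 1) (take j y))"
    using window_eq[OF stairs_word[OF assms(5,1,3)] stairs_word[OF assms(6,2,4)] _ r(1)] assms(7)
      lis_factor[OF assms(1,3) r(1) assms(5)] lis_factor[OF assms(2,4) r(1) assms(6)] r(2) by simp
  then show ?thesis by (simp add: factor_def)
qed

lemma rev_factor:
  assumes "1 \<le> i" "i \<le> j" "j \<le> length x"
  shows "rev (factor i j x) = factor (Suc (length x) - j) (Suc (length x) - i) (rev x)"
proof -
  have "rev (factor i j x) = take (Suc j - i) (drop (length x - j) (rev x))"
    using assms by (simp add: factor_def rev_drop rev_take min_def Suc_diff_le)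
  also have "\<dots> = factor (Suc (length x) - j) (Suc (length x) - i) (rev x)"
    using assms by (simp add: factor_def drop_take Suc_diff_le)
  finally show ?thesis .
qed

text \<open>Decreasing subsequences become increasing ones of the reversed words, whose arrays are
  the transposes and therefore agree on the right column too.\<close>

theorem cid_if_right_column_eq:
  assumes "letters m x" "letters m y" "length x = Suc N" "length y = Suc N" "staircase m x G" "staircase m y H"
    "\<And>t. t \<le> N \<Longrightarrow> G t m = H t m"
  shows "x \<sim>cid y"
  unfolding cid_def
proof (intro conjI allI impI)
  show "length x = length y" using assms by simp
  fix i j assume ij: "1 \<le> i \<and> i \<le> j \<and> j \<le> length x"
  show "lis (factor i j x) = lis (factor i j y)" using lis_factor_eq[OF assms] ij assms(3) by simp
  have l: "letters m (rev x)" "letters m (rev y)" using assms(1,2) by (simp_all add: letters_def)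
  have "lis (factor (Suc (Suc N) - j) (Suc (Suc N) - i) (rev x)) = lis (factor (Suc (Suc N) - j) (Suc (Suc N) - i) (rev y))"
    by (rule lis_factor_eq[OF l _ _ staircase_rev[OF assms(5)] staircase_rev[OF assms(6)]]) (use assms(3,4,7) ij in auto)
  then show "lds (factor i j x) = lds (factor i j y)"
    using rev_factor[of i j x] rev_factor[of i j y] ij assms(3,4) by (simp add: lds_rev)
qed

section \<open>Invariants along a whole array\<close>

lemma inclen_growth:
  assumes "growth a m G" "u + v \<le> m"
  shows "inclen (step (\<lambda>v. len (G a (u + v)))) v 0 = inclen (step (\<lambda>v. len (G 0 (u + v)))) v 0"
proof -
  have "inclen (step (\<lambda>v. len (G t (u + v)))) v 0 = inclen (step (\<lambda>v. len (G 0 (u + v)))) v 0" if "t \<le> a" for t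
    using that
  proof (induction t)
    case (Suc t)
    have "inclen (step (\<lambda>v. len (G t (u + v)))) v 0 = inclen (step (\<lambda>v. len (G (Suc t) (u + v)))) v 0"
      by (rule slide.inclen_slide[OF growth_slide[OF assms(1), of t u v]]) (use Suc.prems assms(2) in auto)
    then show ?case using Suc by simp
  qed simp
  from this[OF order_refl] show ?thesis .
qed

lemma pattern_growth_up:
  assumes "growth a m G" "R + C \<le> Suc m" "\<exists>x. pattern R C (step (\<lambda>v. len (G 0 v))) x" "t \<le> a"
  shows "\<exists>x. pattern R C (step (\<lambda>v. len (G t v))) x"
  using assms(4)
proof (induction t)
  case (Suc t)
  then obtain x where "pattern R C (step (\<lambda>v. len (G t v))) x" by auto
  then show ?case using slide.pattern_unslide[OF growth_slide[OF assms(1), of t 0 m]] assms(2) Suc.prems by simp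
qed (use assms(3) in simp)

lemma pattern_growth_down:
  assumes "growth a m G" "R + C \<le> Suc m" "\<exists>x. pattern R C (step (\<lambda>v. len (G a v))) x" "t \<le> a"
  shows "\<exists>x. pattern R C (step (\<lambda>v. len (G t v))) x"
  using assms(4)
proof (induction t rule: inc_induct)
  case (step t)
  then obtain x where "pattern R C (step (\<lambda>v. len (G (Suc t) v))) x" by auto
  then show ?case using slide.pattern_slide[OF growth_slide[OF assms(1), of t 0 m]] assms(2) step.hyps by simp
qed (use assms(3) in simp)

lemma step_iff_mem: "strip (W v) (W (Suc v)) \<Longrightarrow> step (\<lambda>v. len (W v)) v r \<longleftrightarrow> (\<exists>c. (r, c) \<in> W (Suc v) - W v)"
  using strip_mem[of "W v" "W (Suc v)"] by (auto simp: step_def)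

text \<open>A chain of strips starting at the empty diagram that contains the patterns of all rectangles is the
  chain of staircases: the pattern of shape \<open>R \<times> C\<close> forces the box \<open>(R - 1, C - 1)\<close>.\<close>

lemma stair_if_patterns:
  assumes strips: "\<And>t. t < N \<Longrightarrow> strip (P t) (P (Suc t))" and P0: "P 0 = {}"
    and pat: "\<And>R C. R + C \<le> Suc N \<Longrightarrow> \<exists>x. pattern R C (step (\<lambda>t. len (P t))) x"
  shows "t \<le> N \<Longrightarrow> P t = stair t"
proof (induction t rule: less_induct)
  case (less t)
  show ?case
  proof (cases t)
    case 0 then show ?thesis using P0 by (simp add: stair_def)
  next
    case (Suc s)
    have IH: "P u = stair u" if "u \<le> s" for u using less that Suc by simp
    have st: "strip (P u) (P (Suc u))" if "u \<le> s" for u using strips that less.prems Suc by simp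
    \<comment> \<open>Row \<open>Suc q\<close> of the next diagram is no longer than row
      \<open>q\<close> of the staircase \<open>P u\<close>, and that row is empty for
      \<open>q \<ge> u\<close>.\<close>
    have low: "r \<le> u" if step: "step (\<lambda>t. len (P t)) u r" and u: "u \<le> s" for u r
    proof (rule ccontr)
      assume "\<not> r \<le> u"
      then obtain q where q: "r = Suc q" "u \<le> q" by (cases r) auto
      have "len (P (Suc u)) (Suc q) \<le> len (P u) q" by (rule strip_len(3)[OF st[OF u]])
      then show False using step q IH[OF u] by (simp add: step_def)
    qed
    \<comment> \<open>The last entry of this pattern has label \<open>s\<close>. Strict columns put
      it in row \<open>r\<close> or lower; weakly decreasing rows and \<open>low\<close>, applied to
      label \<open>r\<close>, put it in row \<open>r\<close> or higher.\<close>
    have new: "step (\<lambda>t. len (P t)) s r" if r: "r \<le> s" for r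
    proof -
      obtain x where x: "pattern (Suc r) (Suc (s - r)) (step (\<lambda>t. len (P t))) x"
        using pat[of "Suc r" "Suc (s - r)"] r less.prems Suc by auto
      have ge: "i \<le> x i j" if "i \<le> r" "j \<le> s - r" for i j using that(1)
      proof (induction i)
        case (Suc i)
        then show ?case using patternD(3)[OF x, of i j] that(2) by simp
      qed simp
      have "step (\<lambda>t. len (P t)) r (x r 0)" using patternD(1)[OF x, of r 0] by simp
      then have "x r 0 \<le> r" using low r by blast
      moreover have "x r (s - r) \<le> x r 0" using pattern_row_mono[OF x, of r 0 "s - r"] by simp
      ultimately have "x r (s - r) = r" using ge[of r "s - r"] by simp
      then show ?thesis using patternD(1)[OF x, of r "s - r"] r by simp
    qed
    have s: "strip (P s) (P (Suc s))" using st by simp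
    have "len (P (Suc s)) r = len (stair (Suc s)) r" for r
    proof (cases "r \<le> s")
      case True
      then show ?thesis using new[OF True] strip_len(2)[OF s, of r] IH[of s] by (simp add: step_def)
    next
      case False
      then have "\<not> step (\<lambda>t. len (P t)) s r" using low by blast
      then show ?thesis using False IH[of s] by (simp add: step_def)
    qed
    then show ?thesis using diagram_eqI[OF stripD(2)[OF s] diagram_stair] Suc by simp
  qed
qed

lemma word_of_chain:
  assumes "\<And>v. v < m \<Longrightarrow> strip (W v) (W (Suc v))" "W 0 = stair N" "W m = stair (Suc N)"
  shows "\<exists>x. letters m x \<and> length x = Suc N \<and> (\<forall>v\<le>m. W v = diag x v)"
proof -
  have mono: "W v \<subseteq> W w" if "v \<le> w" "w \<le> m" for v w
    using that
  proof (induction w rule: dec_induct)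
    case (step w)
    then show ?case using stripD(3)[OF assms(1), of w] by auto
  qed simp
  define l where "l c = (LEAST v. (N - c, c) \<in> W v)" for c
  define x where "x = map (\<lambda>c. int (l c)) [0..<Suc N]"
  have len: "length x = Suc N" and nth: "c \<le> N \<Longrightarrow> x ! c = int (l c)" for c by (auto simp: x_def simp del: upt_Suc)
  have top: "(N - c, c) \<in> W m" "(N - c, c) \<notin> W 0" if "c \<le> N" for c using that assms(2,3) by (auto simp: stair_def)
  have lm: "l c \<le> m" and l0: "0 < l c" if "c \<le> N" for c
  proof -
    show "l c \<le> m" unfolding l_def using Least_le[of "\<lambda>v. (N - c, c) \<in> W v" m] top(1)[OF that] by simp
    have "(N - c, c) \<in> W (l c)" unfolding l_def using LeastI[of "\<lambda>v. (N - c, c) \<in> W v" m] top(1)[OF that] by simp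
    then show "0 < l c" using top(2)[OF that] by (cases "l c") auto
  qed
  have iff: "(N - c, c) \<in> W v \<longleftrightarrow> l c \<le> v" if "c \<le> N" "v \<le> m" for c v
  proof
    show "(N - c, c) \<in> W v \<Longrightarrow> l c \<le> v" unfolding l_def by (rule Least_le)
    have "(N - c, c) \<in> W (l c)" unfolding l_def using LeastI[of "\<lambda>v. (N - c, c) \<in> W v" m] top(1)[OF that(1)] by simp
    then show "l c \<le> v \<Longrightarrow> (N - c, c) \<in> W v" using mono that(2) by blast
  qed
  have "W v = diag x v" if "v \<le> m" for v
  proof -
    have b: "stair N \<subseteq> W v" "W v \<subseteq> stair (Suc N)" using mono[of 0 v] mono[of v m] assms(2,3) that by auto
    have "(r, c) \<in> W v \<longleftrightarrow> (r, c) \<in> diag x v" for r c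
    proof (cases "r + c = N")
      case True
      then have "r = N - c" "c \<le> N" by auto
      then show ?thesis using iff[of c v] that nth len True by (simp add: diag_def)
    next
      case False
      then show ?thesis using b len by (auto simp: diag_def stair_def)
    qed
    then show ?thesis by auto
  qed
  moreover have "letters m x"
    unfolding letters_def x_def using lm l0 by (auto simp: less_Suc_eq_le simp del: upt_Suc)
  ultimately show ?thesis using len by blast
qed

text \<open>All tableaux of a given shape are compatible with a given right column.\<close>

theorem staircase_transfer:
  assumes G: "staircase m x G" and x: "letters m x" "length x = Suc N"
    and T: "\<And>v. v < m \<Longrightarrow> strip (T v) (T (Suc v))" "T 0 = {}" "T m = G 0 m"
  shows "\<exists>y H. letters m y \<and> length y = Suc N \<and> staircase m y H \<and> (\<forall>v\<le>m. H 0 v = T v) \<and> (\<forall>t\<le>N. H t m = G t m)"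
proof -
  have g: "growth N m G" "\<And>t. t \<le> N \<Longrightarrow> G t 0 = stair t" "\<And>v. v \<le> m \<Longrightarrow> G N v = diag x v"
    using G x by (auto simp: staircase_def)
  have sG: "strip (G t m) (G (Suc t) m)" if "t < N" for t using growthD(2)[OF g(1) that] by simp
  have "diagram (G 0 m)"
  proof (cases "m = 0")
    case True
    then show ?thesis using g(2)[of 0] by simp
  next
    case False
    then show ?thesis using stripD(2)[OF growthD(1)[OF g(1), of 0 "m - 1"]] by simp
  qed
  then obtain H where H: "growth N m H" "\<And>v. v \<le> m \<Longrightarrow> H 0 v = T v" "\<And>t. t \<le> N \<Longrightarrow> H t m = G t m"
    using growth_exists_rev[of m T N "\<lambda>t. G t m"] T sG by blast
  \<comment> \<open>With the axes exchanged, left and right columns become bottom and top rows.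
    Patterns then travel from the left column of \<open>G\<close> to the common right column and on
    to the left column of \<open>H\<close>.\<close>
  note sw = growth_swap[OF g(1)] growth_swap[OF H(1)]
  have "\<exists>x. pattern R C (step (\<lambda>t. len (H t 0))) x" if RC: "R + C \<le> Suc N" for R C
  proof -
    have "pattern R C (step (\<lambda>t. len (G t 0))) (\<lambda>i j. i)"
      unfolding pattern_def using RC g(2) by (auto simp: step_def)
    then have "\<exists>x. pattern R C (step (\<lambda>t. len (G t m))) x" using pattern_growth_up[OF sw(1) RC, of m] by blast
    then obtain z where z: "pattern R C (step (\<lambda>t. len (G t m))) z" by blast
    have "pattern R C (step (\<lambda>t. len (H t m))) z"
      using z RC H(3) unfolding pattern_def by (auto simp: step_def)
    then show ?thesis using pattern_growth_down[OF sw(2) RC, of 0] by blast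
  qed
  then have H0: "H t 0 = stair t" if "t \<le> N" for t
    using stair_if_patterns[of N "\<lambda>t. H t 0" t] growthD(2)[OF H(1), of _ 0] H(2) T(2) that by blast
  have "H N m = stair (Suc N)" using H(3)[of N] g(3)[of m] diag_top[OF x] by simp
  then obtain y where y: "letters m y" "length y = Suc N" "\<forall>v\<le>m. H N v = diag y v"
    using word_of_chain[of m "H N" N] growthD(1)[OF H(1), of N] H0[of N] by blast
  have "staircase m y H" using H(1) H0 y(2,3) by (simp add: staircase_def less_Suc_eq_le)
  then show ?thesis using y H by blast
qed

section \<open>Prepending a letter\<close>

text \<open>Prepending \<open>a\<close> to a word of length \<open>k\<close> shifts its picture by
  one column and puts \<open>a\<close> at the foot of a new first column, see
  \<open>embed_diag\<close>. A general \<open>D\<close> allows the column to stand before a tableau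
  that has already been slid.\<close>

definition embed :: "nat \<Rightarrow> int \<Rightarrow> nat \<Rightarrow> (nat \<times> nat) set \<Rightarrow> (nat \<times> nat) set" where
  "embed k a v D = {(r, c). c = 0 \<and> (r < k \<or> r = k \<and> a \<le> int v) \<or> (\<exists>d. c = Suc d \<and> (r, d) \<in> D)}"

lemma mem_embed [simp]: "(r, 0) \<in> embed k a v D \<longleftrightarrow> r < k \<or> r = k \<and> a \<le> int v" "(r, Suc c) \<in> embed k a v D \<longleftrightarrow> (r, c) \<in> D"
  by (auto simp: embed_def)

text \<open>The bound on the rows of \<open>B\<close> keeps row \<open>k\<close> free, so the box
  \<open>(k, 0)\<close> cannot share its row with a shifted box.\<close>

lemma strip_embed:
  assumes "strip A B" "v \<le> w" "w \<le> Suc v" "\<And>r c. (r, c) \<in> B \<Longrightarrow> r < k"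
  shows "strip (embed k a v A) (embed k a w B)"
proof -
  note s = stripD[OF assms(1)]
  have fin: "finite (embed k a v D)" if "finite D" for v D
  proof -
    have "embed k a v D \<subseteq> (\<lambda>r. (r, 0)) ` {..k} \<union> (\<lambda>(r, c). (r, Suc c)) ` D" by (force simp: embed_def)
    then show ?thesis using that by (meson finite_UnI finite_atMost finite_imageI finite_subset)
  qed
  have dg: "diagram (embed k a v D)" if D: "diagram D" "\<And>r c. (r, c) \<in> D \<Longrightarrow> r < k" for v D
  proof -
    have "(r, c) \<in> embed k a v D" if "(Suc r, c) \<in> embed k a v D" for r c
      using that diagramD(2)[OF D(1)] by (cases c) auto
    moreover have "(r, c) \<in> embed k a v D" if "(r, Suc c) \<in> embed k a v D" for r c
      using that diagramD(3)[OF D(1)] D(2) by (cases c) auto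
    ultimately show ?thesis using fin[OF diagramD(1)[OF D(1)]] unfolding diagram_def by blast
  qed
  have "embed k a v A \<subseteq> embed k a w B" using s(3) assms(2) by (auto simp: embed_def)
  moreover have "c = d" if "(r, c) \<in> embed k a w B - embed k a v A" "(r, d) \<in> embed k a w B - embed k a v A" for r c d
  proof (cases c; cases d)
    fix c' d' assume "c = Suc c'" "d = Suc d'"
    then show ?thesis using that s(4)[of r c' d'] by simp
  qed (use that assms(4) in auto)
  moreover have "r = q" if "(r, c) \<in> embed k a w B - embed k a v A" "(q, c) \<in> embed k a w B - embed k a v A" for r q c
    using that s(5)[of r "c - 1" q] by (cases c) auto
  ultimately show ?thesis using dg[OF s(1)] dg[OF s(2)] s(3) assms(4) unfolding strip_def by blast
qed

text \<open>The first two diagrams have the same first column, so no box of the first strip is there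
  to trade places with the box of \<open>a\<close> or to act from the left on shifted boxes.\<close>

lemma switch_embed:
  "switch (embed k a v A) (embed k a v B) (embed k a w C) = embed k a w (switch A B C)"
  if "A \<subseteq> B" "v \<le> w"
proof -
  have "(r, c) \<in> switch (embed k a v A) (embed k a v B) (embed k a w C) \<longleftrightarrow> (r, c) \<in> embed k a w (switch A B C)" for r c
  proof (cases c)
    case 0
    then show ?thesis using that(2) by (auto simp: mem_switch)
  next
    case (Suc d)
    have "(\<exists>b. c = Suc b \<and> (r, b) \<in> embed k a v B - embed k a v A) \<longleftrightarrow> (\<exists>b. d = Suc b \<and> (r, b) \<in> B - A)"
      unfolding Suc by (cases d) auto
    then show ?thesis unfolding mem_switch Suc by (simp add: mem_switch)
  qed
  then show ?thesis by auto
qed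

lemma growth_embed:
  assumes "growth a m G" "\<And>t v r c. t \<le> a \<Longrightarrow> v \<le> m \<Longrightarrow> (r, c) \<in> G t v \<Longrightarrow> r < k"
  shows "growth a m (\<lambda>t v. embed k b v (G t v))"
  unfolding growth_def
proof (intro conjI allI impI)
  fix t v assume "t \<le> a" "v < m"
  then show "strip (embed k b v (G t v)) (embed k b (Suc v) (G t (Suc v)))"
    by (intro strip_embed growthD(1)[OF assms(1)]) (use assms(2)[of t "Suc v"] in auto)
next
  fix t v assume "t < a" "v \<le> m"
  then show "strip (embed k b v (G t v)) (embed k b v (G (Suc t) v))"
    by (intro strip_embed growthD(2)[OF assms(1)]) (use assms(2)[of "Suc t" v] in auto)
next
  fix t v assume t: "t < a" "v < m"
  show "embed k b (Suc v) (G t (Suc v)) = switch (embed k b v (G t v)) (embed k b v (G (Suc t) v)) (embed k b (Suc v) (G (Suc t) (Suc v)))"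
    using switch_embed[of "G t v" "G (Suc t) v" v "Suc v" k b "G (Suc t) (Suc v)"] stripD(3)[OF growthD(2)[OF assms(1), of t v]]
      growthD(3)[OF assms(1) t] t by simp
qed

lemma embed_diag: "embed (length x) a v (diag x v) = diag (a # x) v"
proof -
  have "(r, c) \<in> embed (length x) a v (diag x v) \<longleftrightarrow> (r, c) \<in> diag (a # x) v" for r c
    by (cases c) (auto simp: diag_def)
  then show ?thesis by auto
qed

lemma growth_mono:
  assumes "growth a m G" "t \<le> a" "v \<le> m"
  shows "G t v \<subseteq> G a v"
  using assms(2)
proof (induction t rule: inc_induct)
  case (step t)
  then show ?case using stripD(3)[OF growthD(2)[OF assms(1) _ assms(3), of t]] by auto
qed simp

lemma inclen_step_cong:
  assumes "\<And>w. w \<le> v \<Longrightarrow> X w = Y w"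
  shows "inclen (step (\<lambda>v. len (X v))) v r = inclen (step (\<lambda>v. len (Y v))) v r"
  by (rule inclen_cong) (simp add: step_def assms)

definition column :: "nat \<Rightarrow> (nat \<times> nat) set" where
  "column t = {(r, c). c = 0 \<and> r < t}"

text \<open>Second stage of rectifying \<open>a # x\<close>: once \<open>T\<close> is the rectified
  tableau of \<open>x\<close>, only a column of \<open>k = length x\<close> empty boxes remains to
  be slid through.\<close>

definition column_growth :: "nat \<Rightarrow> nat \<Rightarrow> int \<Rightarrow> (nat \<Rightarrow> (nat \<times> nat) set) \<Rightarrow> (nat \<Rightarrow> nat \<Rightarrow> (nat \<times> nat) set) \<Rightarrow> bool" where
  "column_growth k m a T H \<longleftrightarrow> growth k m H \<and> (\<forall>t\<le>k. H t 0 = column t) \<and> (\<forall>v\<le>m. H k v = embed k a v (T v))"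

lemma column_eq: "column t = (\<lambda>r. (r, 0)) ` {..<t}"
  by (auto simp: column_def)

lemma strip_column: "strip (column t) (column (Suc t))"
proof -
  have "diagram (column t)" for t
    unfolding diagram_def by (auto simp: column_eq)
  then show ?thesis by (auto simp: strip_def column_def)
qed

lemma len_column [simp]: "len (column t) r = (if r < t then 1 else 0)"
proof -
  have "{c. (r, c) \<in> column t} = (if r < t then {0} else {})" by (auto simp: column_def)
  then show ?thesis by (simp add: len_def)
qed

lemma embed_0: "0 < a \<Longrightarrow> embed k a 0 {} = column k"
  by (auto simp: embed_def column_def)

lemma staircase_rows:
  assumes "staircase m x G" "t < length x" "v \<le> m"
  shows "G t v \<subseteq> stair (length x)"
proof -
  have l: "length x = Suc (length x - 1)" using assms(2) by simp
  have "G t v \<subseteq> diag x v" using growth_mono[of "length x - 1" m G t v] assms by (simp add: staircase_def)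
  then show ?thesis using diag_bounds(2)[OF l, of v] l by (metis subset_trans)
qed

lemma column_growth_exists:
  assumes G: "staircase m x G" and x: "letters m (a # x)" "x \<noteq> []"
  shows "\<exists>H. column_growth (length x) m a (G 0) H"
proof -
  have l: "0 < length x" using x(2) by simp
  have G0: "G 0 0 = {}" using G l by (simp add: staircase_def stair_def)
  have s: "strip (G 0 v) (G 0 (Suc v))" if "v < m" for v using growthD(1)[of "length x - 1" m G 0 v] G that by (simp add: staircase_def)
  have "strip (embed (length x) a v (G 0 v)) (embed (length x) a (Suc v) (G 0 (Suc v)))" if "v < m" for v
  proof (rule strip_embed[OF s[OF that]])
    show "r < length x" if "(r, c) \<in> G 0 (Suc v)" for r c
      using staircase_rows[OF G l, of "Suc v"] that \<open>v < m\<close> by (auto simp: stair_def)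
  qed auto
  moreover have "column (length x) = embed (length x) a 0 (G 0 0)" using G0 embed_0 x(1) by (simp add: letters_def)
  ultimately show ?thesis
    using growth_exists[of "length x" column m "\<lambda>v. embed (length x) a v (G 0 v)"] strip_column stripD(1)[OF strip_column]
    unfolding column_growth_def by metis
qed

text \<open>Two arrays in succession: \<open>K\<close>, the array of \<open>x\<close> with the new
  column in front, leads from the antidiagonal of \<open>a # x\<close> to the top row of
  \<open>H\<close>, and \<open>H\<close> leads to its bottom row. Their transposes treat the
  reversed word.\<close>

lemma lis_column_growth:
  assumes G: "staircase m x G" and x: "x \<noteq> []" and H: "column_growth (length x) m a (G 0) H" and uv: "u + v \<le> m"
  shows "lis (within u (u + v) (a # x)) = inclen (step (\<lambda>v. len (H 0 (u + v)))) v 0"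
    "lis (within u (u + v) (rev (a # x))) = inclen (step (\<lambda>v. len (conjugate (H 0 (u + v))))) v 0"
proof -
  let ?N = "length x - 1" and ?k = "length x"
  define K where "K t v = embed ?k a v (G t v)" for t v
  have l: "0 < ?k" using x by simp
  have gK: "growth ?N m K"
    unfolding K_def
  proof (rule growth_embed)
    show "growth ?N m G" using G by (simp add: staircase_def)
    show "r < ?k" if "t \<le> ?N" "v \<le> m" "(r, c) \<in> G t v" for t v r c
    proof -
      have "t < length x" using that(1) l by linarith
      then show ?thesis using staircase_rows[OF G, of t v] that by (auto simp: stair_def)
    qed
  qed
  have gH: "growth ?k m H" using H by (simp add: column_growth_def)
  have top: "K ?N v = diag (a # x) v" if "v \<le> m" for v
    using G that embed_diag[of x a v] by (simp add: staircase_def K_def)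
  have mid: "K 0 v = H ?k v" if "v \<le> m" for v using H that by (simp add: column_growth_def K_def)
  have "lis (within u (u + v) (a # x)) = inclen (step (\<lambda>v. len (diag (a # x) (u + v)))) v 0"
    using inclen_diag[of "a # x" u v] by simp
  also have "\<dots> = inclen (step (\<lambda>v. len (K ?N (u + v)))) v 0" by (rule inclen_step_cong) (use top uv in simp)
  also have "\<dots> = inclen (step (\<lambda>v. len (K 0 (u + v)))) v 0" by (rule inclen_growth[OF gK uv])
  also have "\<dots> = inclen (step (\<lambda>v. len (H ?k (u + v)))) v 0" by (rule inclen_step_cong) (use mid uv in simp)
  also have "\<dots> = inclen (step (\<lambda>v. len (H 0 (u + v)))) v 0" by (rule inclen_growth[OF gH uv])
  finally show "lis (within u (u + v) (a # x)) = inclen (step (\<lambda>v. len (H 0 (u + v)))) v 0" .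
  have "lis (within u (u + v) (rev (a # x))) = inclen (step (\<lambda>v. len (conjugate (diag (a # x) (u + v))))) v 0"
    using inclen_diag[of "rev (a # x)" u v] unfolding diag_rev by simp
  also have "\<dots> = inclen (step (\<lambda>v. len (conjugate (K ?N (u + v))))) v 0" by (rule inclen_step_cong) (use top uv in simp)
  also have "\<dots> = inclen (step (\<lambda>v. len (conjugate (K 0 (u + v))))) v 0" by (rule inclen_growth[OF growth_conjugate[OF gK] uv])
  also have "\<dots> = inclen (step (\<lambda>v. len (conjugate (H ?k (u + v))))) v 0" by (rule inclen_step_cong) (use mid uv in simp)
  also have "\<dots> = inclen (step (\<lambda>v. len (conjugate (H 0 (u + v))))) v 0" by (rule inclen_growth[OF growth_conjugate[OF gH] uv])
  finally show "lis (within u (u + v) (rev (a # x))) = inclen (step (\<lambda>v. len (conjugate (H 0 (u + v))))) v 0" .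
qed

section \<open>The right column left behind by a sliding column\<close>

definition vertical :: "nat \<Rightarrow> (nat \<Rightarrow> nat \<Rightarrow> bool) \<Rightarrow> bool" where
  "vertical k J \<longleftrightarrow> (\<forall>s t r q. s < t \<longrightarrow> t < k \<longrightarrow> J s r \<longrightarrow> J t q \<longrightarrow> r < q) \<and> (\<forall>t<k. \<exists>r. J t r)"

lemma inclen_mono_v: "v \<le> w \<Longrightarrow> inclen J v r \<le> inclen J w r"
  by (induction w rule: dec_induct) (use inclen_Suc_ge order_trans in blast)+

lemma inclen_eq_0: "(\<And>s p. s < v \<Longrightarrow> r \<le> p \<Longrightarrow> \<not> J s p) \<Longrightarrow> inclen J v r = 0"
proof (induction v)
  case (Suc v)
  then show ?case using inclen_cases[of J v r] by (metis less_SucI lessI)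
qed simp

text \<open>Expresses the order condition of \<open>vertical\<close> by a chain length, which slides
  preserve.\<close>

lemma inclen_le_1_iff:
  "inclen J v 0 \<le> 1 \<longleftrightarrow> (\<forall>s t r q. s < t \<longrightarrow> t < v \<longrightarrow> J s r \<longrightarrow> J t q \<longrightarrow> r < q)" (is "?L \<longleftrightarrow> ?R")
proof
  assume L: ?L
  show ?R
  proof (intro allI impI, rule ccontr)
    fix s t r q assume a: "s < t" "t < v" "J s r" "J t q" "\<not> r < q"
    have "Suc 0 \<le> inclen J (Suc s) r" using inclen_mem[of J s r] a(3) by simp
    also have "\<dots> \<le> inclen J t r" by (rule inclen_mono_v) (use a in simp)
    also have "\<dots> \<le> inclen J t q" by (rule inclen_antimono) (use a in simp)
    finally have "Suc (Suc 0) \<le> inclen J (Suc t) q" using inclen_mem[of J t q] a(4) by simp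
    also have "\<dots> \<le> inclen J v q" by (rule inclen_mono_v) (use a in simp)
    also have "\<dots> \<le> inclen J v 0" by (rule inclen_antimono) simp
    finally show False using L by simp
  qed
next
  assume R: ?R
  have "inclen J w r \<le> 1" if "w \<le> v" for w r
    using that
  proof (induction w)
    case (Suc w)
    show ?case
    proof (cases "inclen J (Suc w) r = inclen J w r")
      case False
      then obtain q where q: "J w q" "inclen J (Suc w) r = Suc (inclen J w q)" using inclen_cases[of J w r] by metis
      have "inclen J w q = 0" by (rule inclen_eq_0) (use R Suc.prems q(1) in \<open>meson Suc_le_lessD leD\<close>)
      then show ?thesis using q by simp
    qed (use Suc in simp)
  qed simp
  then show ?L by simp
qed

text \<open>The occurrence of label \<open>t\<close> is the chain length 1 on the interval
  consisting of \<open>t\<close>, so \<open>vertical\<close> is a statement about chain lengths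
  alone; these are preserved in the array with exchanged axes.\<close>

lemma vertical_growth:
  assumes "growth k m H" "w \<le> m"
  shows "vertical k (step (\<lambda>t. len (H t w))) \<longleftrightarrow> vertical k (step (\<lambda>t. len (H t 0)))"
proof -
  have g: "growth w k (\<lambda>v t. H t v)"
    using growth_swap[OF assms(1)] assms(2) by (simp add: growth_def)
  have eq: "inclen (step (\<lambda>t. len (H (u + t) w))) v 0 = inclen (step (\<lambda>t. len (H (u + t) 0))) v 0" if "u + v \<le> k" for u v
    using inclen_growth[OF g that] .
  have "(\<exists>r. step (\<lambda>t. len (H t v)) t r) \<longleftrightarrow> inclen (step (\<lambda>s. len (H (t + s) v))) 1 0 = 1" for t v
  proof
    assume "\<exists>r. step (\<lambda>t. len (H t v)) t r"
    then obtain r where "step (\<lambda>s. len (H (t + s) v)) 0 r" by (auto simp: step_def)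
    then have "Suc 0 \<le> inclen (step (\<lambda>s. len (H (t + s) v))) (Suc 0) 0" using inclen_step[of 0 r "step (\<lambda>s. len (H (t + s) v))" 0] by simp
    moreover have "inclen (step (\<lambda>s. len (H (t + s) v))) 1 0 \<le> 1" by (subst inclen_le_1_iff) simp
    ultimately show "inclen (step (\<lambda>s. len (H (t + s) v))) 1 0 = 1" by simp
  next
    assume "inclen (step (\<lambda>s. len (H (t + s) v))) 1 0 = 1"
    then obtain r where "step (\<lambda>s. len (H (t + s) v)) 0 r" using inclen_cases[of "step (\<lambda>s. len (H (t + s) v))" 0 0] by auto
    then show "\<exists>r. step (\<lambda>t. len (H t v)) t r" by (auto simp: step_def)
  qed
  then have "vertical k (step (\<lambda>t. len (H t v))) \<longleftrightarrow>
      inclen (step (\<lambda>t. len (H (0 + t) v))) k 0 \<le> 1 \<and> (\<forall>t<k. inclen (step (\<lambda>s. len (H (t + s) v))) 1 0 = 1)" for v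
    unfolding vertical_def inclen_le_1_iff by simp
  then show ?thesis using eq[of 0 k] eq[of _ 1] by simp
qed

text \<open>Step \<open>t\<close> of the right column fills the row ends from \<open>cut e t\<close>
  up to \<open>cut e (Suc t) - 1\<close>, as far as they are still empty. The jump at
  \<open>t = e\<close> takes in the rows \<open>e\<close> and \<open>Suc e\<close>; if
  \<open>D' \<noteq> D\<close>, row \<open>e\<close> is already filled.\<close>

definition cut :: "nat \<Rightarrow> nat \<Rightarrow> nat" where
  "cut e t = (if t \<le> e then t else Suc t)"

text \<open>The right column of the array that slides a column of \<open>k\<close> boxes through a tableau of shape \<open>D\<close> extended by one
  letter; \<open>D'\<close> is the resulting shape and \<open>(e, f)\<close> is the new box of \<open>D'\<close> or, if \<open>D' = D\<close>, a corner of \<open>D\<close>.\<close>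

definition cut_chain :: "(nat \<times> nat) set \<Rightarrow> (nat \<times> nat) set \<Rightarrow> nat \<Rightarrow> nat \<Rightarrow> (nat \<times> nat) set" where
  "cut_chain D D' e t = D' \<union> {(r, c). r < cut e t \<and> c = len D r}"

text \<open>The row \<open>e\<close> would describe the right column, but transposition exchanges
  the coordinates, so both are kept. The second alternative is an absorption that does not enlarge
  the shape.\<close>

definition corner_key :: "(nat \<times> nat) set \<Rightarrow> (nat \<times> nat) set \<Rightarrow> nat \<Rightarrow> nat \<Rightarrow> bool" where
  "corner_key D D' e f \<longleftrightarrow> D' = insert (e, f) D \<and> (e, f) \<notin> D \<or>
     D' = D \<and> (e, f) \<in> D \<and> (Suc e, f) \<notin> D \<and> (e, Suc f) \<notin> D"

lemma corner_key_conj: "corner_key D D' e f \<Longrightarrow> corner_key (conjugate D) (conjugate D') f e"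
proof -
  have "conjugate (insert (e, f) D) = insert (f, e) (conjugate D)" by (auto simp: conjugate_def)
  then show "corner_key D D' e f \<Longrightarrow> corner_key (conjugate D) (conjugate D') f e" by (auto simp: corner_key_def)
qed

lemma growth_right_len:
  assumes "growth k m H" "s \<le> t" "t \<le> k" "\<And>u. s \<le> u \<Longrightarrow> u < t \<Longrightarrow> \<not> step (\<lambda>t. len (H t m)) u r"
  shows "len (H t m) r = len (H s m) r"
  using assms(2,3,4)
proof (induction t rule: dec_induct)
  case (step n)
  have "\<not> step (\<lambda>t. len (H t m)) n r" using step.prems(2)[of n] step.hyps by simp
  then show ?case using step strip_len(1)[OF growthD(2)[OF assms(1), of n m], of r] by (auto simp: step_def)
qed simp

lemma strict_bounds:
  fixes \<rho> :: "nat \<Rightarrow> nat"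
  assumes "\<And>t. t < k \<Longrightarrow> \<rho> t < \<rho> (Suc t)"
  shows "s \<le> t \<Longrightarrow> t \<le> k \<Longrightarrow> \<rho> s + (t - s) \<le> \<rho> t"
proof (induction t rule: dec_induct)
  case (step t)
  then show ?case using assms[of t] by (simp add: Suc_diff_le)
qed simp

text \<open>Because \<open>vertical\<close> survives, the \<open>k\<close> labels occupy disjoint
  nonempty blocks among the rows 0 to \<open>k\<close>, one below the other. One row is left over:
  it either has no label and its box belongs to \<open>D'\<close>, or it is the second row of a
  block and \<open>D' = D\<close>.\<close>

lemma column_growth_right:
  assumes H: "column_growth k m a T H" and a: "a \<le> int m" and rows: "\<And>r c. (r, c) \<in> T m \<Longrightarrow> r < k" and D: "diagram (T m)"
  shows "\<exists>e f. e \<le> k \<and> corner_key (T m) (H 0 m) e f \<and> (\<forall>t\<le>k. H t m = cut_chain (T m) (H 0 m) e t)"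
proof -
  define J where "J = step (\<lambda>t. len (H t m))"
  define l where "l = len (T m)"
  define l' where "l' = len (H 0 m)"
  have g: "growth k m H" and H0: "\<And>t. t \<le> k \<Longrightarrow> H t 0 = column t" and Hk: "H k m = embed k a m (T m)"
    using H by (auto simp: column_growth_def)
  have st: "strip (H t m) (H (Suc t) m)" if "t < k" for t using growthD(2)[OF g that] by simp
  have mem: "(r, c) \<in> T m \<longleftrightarrow> c < l r" for r c unfolding l_def by (rule mem_iff_len[OF D])
  have lk: "l r = 0" if "k \<le> r" for r using mem[of r 0] rows[of r 0] that by force
  have "step (\<lambda>t. len (H t 0)) t r \<longleftrightarrow> r = t" if "t < k" for t r using that H0 by (auto simp: step_def)
  then have "vertical k (step (\<lambda>t. len (H t 0)))" unfolding vertical_def by auto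
  then have V: "vertical k J" unfolding J_def using vertical_growth[OF g order_refl] by blast
  then have ord: "\<And>s t r q. s < t \<Longrightarrow> t < k \<Longrightarrow> J s r \<Longrightarrow> J t q \<Longrightarrow> r < q" and ne: "\<And>t. t < k \<Longrightarrow> \<exists>r. J t r"
    unfolding vertical_def by blast+
  have dk: "diagram (H k m)"
  proof (cases k)
    case 0
    then have "m = 0 \<Longrightarrow> H k m = column 0" using H0 by simp
    then show ?thesis using growthD(1)[OF g, of k "m - 1"] stripD(1)[OF strip_column] stripD(2) by (cases m) auto
  next
    case (Suc j)
    then show ?thesis using stripD(2)[OF st[of j]] by simp
  qed
  have lenk: "len (H k m) r = (if r \<le> k then Suc (l r) else 0)" for r
  proof -
    have "(r, c) \<in> H k m \<longleftrightarrow> c < (if r \<le> k then Suc (l r) else 0)" for c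
      unfolding Hk by (cases c) (use a lk mem in auto)
    then show ?thesis by (simp add: len_def)
  qed
  \<comment> \<open>The first row of label \<open>t\<close>; the default \<open>Suc k\<close> makes
    \<open>\<rho>\<close> strictly increasing up to index \<open>k\<close>.\<close>
  define \<rho> where "\<rho> t = (if t < k then LEAST r. J t r else Suc k)" for t
  have J\<rho>: "J t (\<rho> t)" if "t < k" for t using LeastI_ex[OF ne[OF that]] that by (simp add: \<rho>_def)
  have Jk: "r \<le> k" if "J t r" "t < k" for t r
  proof (rule ccontr)
    assume "\<not> r \<le> k"
    have sub: "H (Suc t) m \<subseteq> H k m" using growth_mono[OF g, of "Suc t" m] that by simp
    have "(r, len (H t m) r) \<in> H (Suc t) m - H t m" using strip_mem[OF st[OF that(2)]] that(1) by (simp add: J_def step_def)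
    then have "(r, len (H t m) r) \<in> H k m" using sub by blast
    then show False using mem_iff_len[OF dk] lenk[of r] \<open>\<not> r \<le> k\<close> by simp
  qed
  have up: "r < \<rho> t" if "J s r" "s < t" "t \<le> k" for s t r
    using that ord[OF that(2) _ that(1) J\<rho>] Jk[OF that(1)] by (cases "t = k") (auto simp: \<rho>_def)
  have down: "\<rho> t \<le> r" if "J s r" "t \<le> s" "s < k" for s t r
  proof (cases "s = t")
    case True
    then show ?thesis using that by (auto simp: \<rho>_def intro: Least_le)
  next
    case False
    then show ?thesis using ord[OF _ that(3) J\<rho> that(1), of t] that by simp
  qed
  have inc: "\<rho> t < \<rho> (Suc t)" if "t < k" for t using up[OF J\<rho>[OF that]] that by simp
  note sb = strict_bounds[of k \<rho>, OF inc]
  have \<rho>k: "\<rho> k = Suc k" by (simp add: \<rho>_def)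
  have \<rho>lo: "t \<le> \<rho> t" and \<rho>hi: "\<rho> t \<le> Suc t" if "t \<le> k" for t
    using sb[of 0 t] sb[of t k] that \<rho>k by auto
  \<comment> \<open>In \<open>k\<close> strict steps \<open>\<rho>\<close> reaches
    \<open>Suc k\<close>, so it exceeds its argument by one exactly from \<open>s\<close> on. Row
    \<open>s\<close> is the row left over.\<close>
  define s where "s = (LEAST t. \<rho> t = Suc t)"
  have s: "\<rho> s = Suc s" "s \<le> k" unfolding s_def using LeastI[of "\<lambda>t. \<rho> t = Suc t" k] Least_le[of "\<lambda>t. \<rho> t = Suc t" k] \<rho>k by auto
  have \<rho>1: "\<rho> t = t" if "t < s" for t
  proof -
    have "\<rho> t \<noteq> Suc t" using not_less_Least that unfolding s_def by blast
    then show ?thesis using \<rho>lo[of t] \<rho>hi[of t] that s(2) by simp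
  qed
  have \<rho>2: "\<rho> t = Suc t" if "s \<le> t" "t \<le> k" for t using sb[of s t] s \<rho>hi[of t] that by simp
  have len_lo: "len (H t m) r = Suc (l r)" if "r < \<rho> t" "t \<le> k" for t r
  proof -
    have "len (H k m) r = len (H t m) r"
      by (rule growth_right_len[OF g that(2) order_refl]) (use down that J_def in \<open>meson leD\<close>)
    then show ?thesis using lenk[of r] that \<rho>hi[of t] by simp
  qed
  have len_hi: "len (H t m) r = l' r" if "\<rho> t \<le> r" "t \<le> k" for t r
    unfolding l'_def by (rule growth_right_len[OF g le0 that(2)]) (use up that J_def in \<open>meson leD\<close>)
  have same: "l' r = l r" if "J t r" "t < k" for t r
  proof -
    have "len (H t m) r = l' r" using len_hi down[OF that(1) order_refl that(2)] that(2) by simp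
    moreover have "len (H (Suc t) m) r = Suc (l r)" using len_lo up[OF that(1), of "Suc t"] that(2) by simp
    ultimately show ?thesis using that strip_len(2)[OF st[OF that(2)], of r] by (simp add: J_def step_def)
  qed
  have d0: "diagram (H 0 m)"
    using st[of 0] stripD(1) dk by (cases k) auto
  have mem': "(r, c) \<in> H 0 m \<longleftrightarrow> c < l' r" for r c unfolding l'_def by (rule mem_iff_len[OF d0])
  have l'_other: "l' r = l r" if rs: "r \<noteq> s" for r
  proof -
    consider "r < s" | "s < r" "r \<le> k" | "k < r" using rs by linarith
    then show ?thesis
    proof cases
      case 1
      then show ?thesis using same[of r r] J\<rho>[of r] \<rho>1[of r] s(2) by simp
    next
      case 2
      then obtain q where "r = Suc q" by (cases r) auto
      then show ?thesis using same[of q r] J\<rho>[of q] \<rho>2[of q] 2 by simp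
    next
      case 3
      have "(r, 0) \<notin> H k m" using mem_iff_len[OF dk] lenk[of r] 3 by simp
      then have "(r, 0) \<notin> H 0 m" using growth_mono[OF g le0 order_refl] by blast
      then have "l' r = 0" using mem' by simp
      then show ?thesis using 3 lenk[of r] lk[of r] by simp
    qed
  qed
  have memt: "(r, c) \<in> H t m \<longleftrightarrow> c < (if r < \<rho> t then Suc (l r) else l' r)" if "t \<le> k" for t r c
  proof -
    have "diagram (H t m)" using st[of t] st[of "t - 1"] stripD(1,2) that dk by (cases "t = k") auto
    then show ?thesis using mem_iff_len[of "H t m" r c] len_lo[of r t] len_hi[of t r] that by (auto simp: not_less)
  qed
  show ?thesis
  proof (cases "\<exists>t<k. J t s")
    case True
    then obtain t where t: "t < k" "J t s" by blast
    have "t < s" using down[OF t(2) order_refl t(1)] \<rho>2[of t] t(1) by (cases "s \<le> t") auto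
    have "s < \<rho> (Suc t)" using up[OF t(2), of "Suc t"] t(1) by simp
    then have ts: "s = Suc t" using \<rho>1[of "Suc t"] \<open>t < s\<close> by (cases "Suc t < s") auto
    have eq: "l' = l" using l'_other same[OF t(2,1)] by (metis ext)
    then have DD: "H 0 m = T m" using mem mem' by auto
    have Jt: "J t t" using J\<rho>[OF t(1)] \<rho>1[OF \<open>t < s\<close>] by simp
    \<comment> \<open>Rows of equal length would give label \<open>t\<close> two boxes in one
      column. Hence row \<open>t\<close> of \<open>D\<close> ends in a corner.\<close>
    have "l t \<noteq> l (Suc t)"
    proof
      assume e: "l t = l (Suc t)"
      have "(t, l t) \<in> H (Suc t) m - H t m" "(Suc t, l (Suc t)) \<in> H (Suc t) m - H t m"
        using memt[of t] memt[of "Suc t"] \<rho>1[OF \<open>t < s\<close>] s(1) ts t(1) eq by auto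
      then show False using stripD(5)[OF st[OF t(1)], of t "l t" "Suc t"] e by auto
    qed
    then have lt: "l (Suc t) < l t" using len_Suc_le[OF D, of t] by (simp add: l_def)
    have "corner_key (T m) (H 0 m) t (l t - 1)"
      unfolding corner_key_def using DD mem lt by auto
    moreover have "H u m = cut_chain (T m) (H 0 m) t u" if "u \<le> k" for u
    proof -
      have "cut t u = \<rho> u" using \<rho>1[of u] \<rho>2[of u] ts that by (auto simp: cut_def)
      then show ?thesis using memt[OF that] eq mem' by (auto simp: cut_chain_def l_def[symmetric] split: if_splits)
    qed
    ultimately show ?thesis using less_imp_le[OF t(1)] by blast
  next
    case False
    have "len (H k m) s = l' s"
      unfolding l'_def by (rule growth_right_len[OF g le0 order_refl]) (use False J_def in auto)
    then have l's: "l' s = Suc (l s)" using lenk[of s] s(2) by simp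
    have DD: "H 0 m = insert (s, l s) (T m)"
    proof -
      have "(r, c) \<in> H 0 m \<longleftrightarrow> (r, c) \<in> insert (s, l s) (T m)" for r c
        using l's l'_other[of r] mem mem' by (cases "r = s") auto
      then show ?thesis by auto
    qed
    have "corner_key (T m) (H 0 m) s (l s)" unfolding corner_key_def using DD mem by auto
    moreover have "H u m = cut_chain (T m) (H 0 m) s u" if "u \<le> k" for u
    proof -
      have c: "r < cut s u \<longleftrightarrow> r < \<rho> u" if "r \<noteq> s" for r using \<rho>1[of u] \<rho>2[of u] \<open>u \<le> k\<close> that by (cases "u < s"; cases "u = s") (auto simp: cut_def)
      have "(r, c) \<in> H u m \<longleftrightarrow> (r, c) \<in> cut_chain (T m) (H 0 m) s u" for r c
      proof (cases "r = s")
        case True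
        then show ?thesis using memt[OF that, of r c] l's mem' by (auto simp: cut_chain_def l_def[symmetric])
      next
        case ne: False
        then show ?thesis using memt[OF that, of r c] c[OF ne] l'_other[OF ne] mem' by (auto simp: cut_chain_def l_def[symmetric])
      qed
      then show ?thesis by auto
    qed
    ultimately show ?thesis using s(2) by blast
  qed
qed

lemma corner_key_len:
  assumes "corner_key D D' e f" "diagram D" "diagram D'" "D' \<noteq> D"
  shows "f = len D e"
proof -
  have i: "D' = insert (e, f) D" "(e, f) \<notin> D" using assms by (auto simp: corner_key_def)
  then have "len D e \<le> f" using mem_iff_len[OF assms(2)] by auto
  moreover have "\<not> len D e < f"
  proof
    assume l: "len D e < f"
    then have "(e, len D e) \<in> D'" using diagram_row[OF assms(3), of e f "len D e"] i by simp
    then show False using i(1) l mem_iff_len[OF assms(2), of e "len D e"] by auto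
  qed
  ultimately show ?thesis by simp
qed

lemma corner_key_len_less:
  assumes "corner_key D D e f" "diagram D"
  shows "len D (Suc e) \<le> f" "len D e = Suc f"
proof -
  have "(e, f) \<in> D" "(Suc e, f) \<notin> D" "(e, Suc f) \<notin> D" using assms by (auto simp: corner_key_def)
  then show "len D (Suc e) \<le> f" "len D e = Suc f" using mem_iff_len[OF assms(2)] by (auto simp: not_less)
qed

lemma len_eq_0_if: "diagram D \<Longrightarrow> (\<And>c. (r, c) \<notin> D) \<Longrightarrow> len D r = 0"
  by (simp add: len_def)

text \<open>Converse to \<open>column_growth_right\<close>: each admissible box
  \<open>(e, f)\<close> gives a legitimate right column, from which an array can be built.\<close>

lemma cut_chain_props:
  assumes key: "corner_key D D' e f" and d: "diagram D" "diagram D'" and rows: "\<And>r c. (r, c) \<in> D \<Longrightarrow> r < k" and e: "e \<le> k"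
  shows "cut_chain D D' e 0 = D'"
    "\<And>a m. a \<le> int m \<Longrightarrow> cut_chain D D' e k = embed k a m D"
    "\<And>t. t < k \<Longrightarrow> strip (cut_chain D D' e t) (cut_chain D D' e (Suc t))"
    "vertical k (step (\<lambda>t. len (cut_chain D D' e t)))"
proof -
  have mem: "(r, c) \<in> D \<longleftrightarrow> c < len D r" for r c by (rule mem_iff_len[OF d(1)])
  have sub: "D \<subseteq> D'" using key by (auto simp: corner_key_def)
  have lk: "len D r = 0" if "k \<le> r" for r using rows[of r] that by (intro len_eq_0_if d(1)) force
  have new: "(r, len D r) \<in> D' \<longleftrightarrow> D' \<noteq> D \<and> r = e" for r
  proof (cases "D' = D")
    case True then show ?thesis using mem by simp
  next
    case False
    then have "D' = insert (e, len D e) D" using key corner_key_len[OF key d] by (auto simp: corner_key_def)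
    then show ?thesis using mem False by auto
  qed
  have D': "D' \<subseteq> insert (e, len D e) D"
    using key corner_key_len[OF key d] by (cases "D' = D") (auto simp: corner_key_def)
  show "cut_chain D D' e 0 = D'" by (auto simp: cut_chain_def cut_def)
  show "cut_chain D D' e k = embed k a m D" if "a \<le> int m" for a m
  proof -
    \<comment> \<open>For \<open>e = k\<close> the cut stops short of row \<open>k\<close>, whose
      box must then be the one gained by \<open>D'\<close>.\<close>
    have "D' \<noteq> D" if "e = k"
    proof
      assume "D' = D"
      then have "(e, f) \<in> D" using key by (auto simp: corner_key_def)
      then show False using rows \<open>e = k\<close> by blast
    qed
    then have "r < cut e k \<or> (r, len D r) \<in> D' \<longleftrightarrow> r \<le> k" for r using new[of r] e by (auto simp: cut_def)
    moreover have "(r, c) \<in> cut_chain D D' e k \<longleftrightarrow> c < len D r \<or> c = len D r \<and> (r < cut e k \<or> (r, len D r) \<in> D')" for r c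
      using D' sub mem new[of r] by (auto simp: cut_chain_def)
    ultimately have 1: "(r, c) \<in> cut_chain D D' e k \<longleftrightarrow> c < len D r \<or> c = len D r \<and> r \<le> k" for r c by simp
    have "(r, c) \<in> cut_chain D D' e k \<longleftrightarrow> (r, c) \<in> embed k a m D" for r c
    proof (cases "k \<le> r")
      case True
      then show ?thesis unfolding 1 using that lk[OF True] mem by (cases c) (auto simp: order_le_less)
    next
      case False
      then show ?thesis unfolding 1 using mem by (cases c) auto
    qed
    then show ?thesis by auto
  qed
  have dg: "diagram (cut_chain D D' e t)" for t
    unfolding diagram_def
  proof (intro conjI allI impI)
    have "cut_chain D D' e t \<subseteq> D' \<union> (\<lambda>r. (r, len D r)) ` {..<cut e t}" by (auto simp: cut_chain_def)
    then show "finite (cut_chain D D' e t)" using diagramD(1)[OF d(2)] by (meson finite_UnI finite_imageI finite_lessThan finite_subset)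
  next
    fix r c assume "(Suc r, c) \<in> cut_chain D D' e t"
    then show "(r, c) \<in> cut_chain D D' e t"
      using diagramD(2)[OF d(2), of r c] len_Suc_le[OF d(1), of r] mem[of r c] sub by (auto simp: cut_chain_def order_le_less)
  next
    fix r c assume "(r, Suc c) \<in> cut_chain D D' e t"
    then show "(r, c) \<in> cut_chain D D' e t"
      using diagramD(3)[OF d(2), of r c] mem[of r c] sub by (auto simp: cut_chain_def)
  qed
  have diff: "(r, c) \<in> cut_chain D D' e (Suc t) - cut_chain D D' e t \<longleftrightarrow>
      c = len D r \<and> cut e t \<le> r \<and> r < cut e (Suc t) \<and> \<not> (D' \<noteq> D \<and> r = e)" for t r c
    using new[of r] by (auto simp: cut_chain_def)
  show st: "strip (cut_chain D D' e t) (cut_chain D D' e (Suc t))" for t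
    unfolding strip_def
  proof (intro conjI allI impI)
    show "cut_chain D D' e t \<subseteq> cut_chain D D' e (Suc t)" by (auto simp: cut_chain_def cut_def split: if_splits)
  next
    fix r c c' assume "(r, c) \<in> cut_chain D D' e (Suc t) - cut_chain D D' e t" "(r, c') \<in> cut_chain D D' e (Suc t) - cut_chain D D' e t"
    then show "c = c'" unfolding diff by simp
  next
    fix r q c assume a: "(r, c) \<in> cut_chain D D' e (Suc t) - cut_chain D D' e t" "(q, c) \<in> cut_chain D D' e (Suc t) - cut_chain D D' e t"
    show "r = q"
    proof (cases "D' = D")
      case True
      then have "len D (Suc e) < len D e" using corner_key_len_less[of D e f] key d(1) by simp
      moreover have rq: "r = q \<or> r = e \<and> q = Suc e \<or> r = Suc e \<and> q = e"
      proof -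
        have "cut e (Suc t) = Suc (cut e t) \<or> cut e t = e \<and> cut e (Suc t) = Suc (Suc e)" by (auto simp: cut_def)
        then show ?thesis using a unfolding diff by linarith
      qed
      moreover have "len D r = len D q" using a unfolding diff by simp
      ultimately show ?thesis by auto
    next
      case False
      then show ?thesis using a unfolding diff by (auto simp: cut_def le_Suc_eq less_Suc_eq split: if_splits)
    qed
  qed (use dg in auto)
  have step: "step (\<lambda>t. len (cut_chain D D' e t)) t r \<longleftrightarrow> cut e t \<le> r \<and> r < cut e (Suc t) \<and> \<not> (D' \<noteq> D \<and> r = e)" for t r
    using step_iff_mem[of "cut_chain D D' e" t r] st diff by blast
  show "vertical k (step (\<lambda>t. len (cut_chain D D' e t)))"
    unfolding vertical_def step
  proof (intro conjI allI impI)
    fix s t r q assume "s < t" "cut e s \<le> r \<and> r < cut e (Suc s) \<and> \<not> (D' \<noteq> D \<and> r = e)" "cut e t \<le> q \<and> q < cut e (Suc t) \<and> \<not> (D' \<noteq> D \<and> q = e)"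
    moreover have "cut e (Suc s) \<le> cut e t" using \<open>s < t\<close> by (auto simp: cut_def)
    ultimately show "r < q" by linarith
  next
    fix t
    show "\<exists>r\<ge>cut e t. r < cut e (Suc t) \<and> \<not> (D' \<noteq> D \<and> r = e)"
      \<comment> \<open>At \<open>t = e\<close> row \<open>e\<close> may be filled already, whereas
        row \<open>Suc e\<close> is certainly new.\<close>
      by (rule exI[of _ "if t < e then t else Suc t"]) (auto simp: cut_def)
  qed
qed

lemma vertical_cong:
  assumes "\<And>t r. t < k \<Longrightarrow> J t r = K t r" "vertical k K"
  shows "vertical k J"
  unfolding vertical_def
proof (intro conjI allI impI)
  fix s t r q assume "s < t" "t < k" "J s r" "J t q"
  then have "K s r" "K t q" using assms(1)[of s r] assms(1)[of t q] by simp_all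
  then show "r < q" using \<open>s < t\<close> \<open>t < k\<close> assms(2) unfolding vertical_def by blast
next
  fix t assume "t < k"
  then show "\<exists>r. J t r" using assms unfolding vertical_def by blast
qed

text \<open>Labels \<open>u < s\<close> already occupy row \<open>u\<close>, which forces label
  \<open>s\<close> into row \<open>s\<close> or lower; the strip condition forbids anything below
  row \<open>s\<close>.\<close>

lemma column_if_vertical:
  assumes strips: "\<And>t. t < k \<Longrightarrow> strip (P t) (P (Suc t))" and P0: "P 0 = {}" and V: "vertical k (step (\<lambda>t. len (P t)))"
  shows "t \<le> k \<Longrightarrow> P t = column t"
proof (induction t rule: less_induct)
  case (less t)
  show ?case
  proof (cases t)
    case 0 then show ?thesis using P0 by (simp add: column_def)
  next
    case (Suc s)
    have IH: "P u = column u" if "u \<le> s" for u using less that Suc by simp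
    have sk: "s < k" using less.prems Suc by simp
    note st = strips[OF sk]
    have ord: "\<And>u r q. u < s \<Longrightarrow> step (\<lambda>t. len (P t)) u r \<Longrightarrow> step (\<lambda>t. len (P t)) s q \<Longrightarrow> r < q"
      and ne: "\<exists>r. step (\<lambda>t. len (P t)) s r" using V sk unfolding vertical_def by blast+
    have old: "step (\<lambda>t. len (P t)) u u" if "u < s" for u using IH[of u] IH[of "Suc u"] that by (simp add: step_def)
    have "r = s" if "step (\<lambda>t. len (P t)) s r" for r
    proof -
      have "s \<le> r"
      proof (rule ccontr)
        assume "\<not> s \<le> r"
        then show False using ord[OF _ old that, of r] by simp
      qed
      moreover have "\<not> s < r"
      proof
        assume "s < r"
        then obtain q where q: "r = Suc q" "s \<le> q" by (cases r) auto
        then have "len (P (Suc s)) r \<le> len (P s) q" using strip_len(3)[OF st] by simp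
        then show False using that q IH[of s] by (simp add: step_def)
      qed
      ultimately show ?thesis by simp
    qed
    then have J: "step (\<lambda>t. len (P t)) s r \<longleftrightarrow> r = s" for r using ne by auto
    have "len (P (Suc s)) r = len (column (Suc s)) r" for r
      using J[of r] strip_len(1,2)[OF st, of r] IH[of s] by (auto simp: step_def)
    then show ?thesis using diagram_eqI[OF stripD(2)[OF st] stripD(1)[OF strip_column]] Suc by simp
  qed
qed

text \<open>Recovers the letter as the time at which the box \<open>(k, 0)\<close> enters. In the
  last hypothesis \<open>int m\<close> stands for any letter up to \<open>m\<close>, since
  \<open>embed\<close> sees the letter only through its comparison with
  \<open>int v\<close>.\<close>

lemma embed_of_chain:
  assumes W: "\<And>v. v < m \<Longrightarrow> strip (W v) (W (Suc v))" and W0: "W 0 = column k" and Wm: "W m = embed k (int m) m D"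
  shows "\<exists>a T. 0 < a \<and> a \<le> int m \<and> T 0 = {} \<and> T m = D \<and> (\<forall>v<m. strip (T v) (T (Suc v))) \<and> (\<forall>v\<le>m. W v = embed k a v (T v))"
proof -
  have mono: "W v \<subseteq> W w" if "v \<le> w" "w \<le> m" for v w
    using that
  proof (induction w rule: dec_induct)
    case (step w)
    then show ?case using stripD(3)[OF W, of w] by auto
  qed simp
  define l where "l = (LEAST v. (k, 0) \<in> W v)"
  define T where "T v = {(r, c). (r, Suc c) \<in> W v}" for v
  have km: "(k, 0) \<in> W m" using Wm by simp
  have lW: "(k, 0) \<in> W l" and lm: "l \<le> m" unfolding l_def
    using LeastI[of "\<lambda>v. (k, 0) \<in> W v" m] Least_le[of "\<lambda>v. (k, 0) \<in> W v" m] km by auto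
  have l0: "0 < l" using lW W0 by (cases l) (auto simp: column_def)
  have memT: "(r, c) \<in> T v \<longleftrightarrow> (r, Suc c) \<in> W v" for r c v by (simp add: T_def)
  have "W v = embed k (int l) v (T v)" if v: "v \<le> m" for v
  proof -
    have "(r, c) \<in> W v \<longleftrightarrow> (r, c) \<in> embed k (int l) v (T v)" for r c
    proof (cases c)
      case 0
      consider "r < k" | "r = k" | "k < r" by linarith
      then show ?thesis
      proof cases
        case 1
        then have "(r, 0) \<in> W 0" using W0 by (simp add: column_def)
        then show ?thesis using mono[of 0 v] v 0 1 by auto
      next
        case 2
        have "(k, 0) \<in> W v \<longleftrightarrow> l \<le> v" using Least_le[of "\<lambda>v. (k, 0) \<in> W v" v] mono[of l v] v lW unfolding l_def by blast
        then show ?thesis using 0 2 by simp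
      next
        case 3
        then have "(r, 0) \<notin> W m" using Wm by simp
        then have "(r, 0) \<notin> W v" using mono[OF v order_refl] by blast
        then show ?thesis using 0 3 by simp
      qed
    next
      case (Suc d)
      then show ?thesis using memT by simp
    qed
    then show ?thesis by auto
  qed
  moreover have "strip (T v) (T (Suc v))" if v: "v < m" for v
  proof -
    note s = stripD[OF W[OF v]]
    have dT: "diagram (T w)" if "diagram (W w)" for w
    proof -
      have "T w \<subseteq> (\<lambda>(r, c). (r, c - 1)) ` W w" using memT by force
      then have "finite (T w)" using diagramD(1)[OF that] by (meson finite_imageI finite_subset)
      then show ?thesis using diagramD(2,3)[OF that] memT unfolding diagram_def by blast
    qed
    have sub: "T v \<subseteq> T (Suc v)" using s(3) memT by auto
    have "c = d" if "(r, c) \<in> T (Suc v) - T v" "(r, d) \<in> T (Suc v) - T v" for r c d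
      using s(4)[of r "Suc c" "Suc d"] that memT by auto
    moreover have "r = q" if "(r, c) \<in> T (Suc v) - T v" "(q, c) \<in> T (Suc v) - T v" for r q c
      using s(5)[of r "Suc c" q] that memT by auto
    ultimately show ?thesis using dT[OF s(1)] dT[OF s(2)] sub unfolding strip_def by blast
  qed
  moreover have "T 0 = {}" using W0 by (auto simp: T_def column_def)
  moreover have "T m = D" using Wm by (auto simp: T_def)
  moreover have "0 < int l" "int l \<le> int m" using l0 lm by auto
  ultimately show ?thesis by blast
qed

text \<open>The analogue of \<open>staircase_transfer\<close> for a column: bottom row and corner
  are prescribed, and the letter and the tableau to be slid are read off the top row.\<close>

lemma column_growth_of_right:
  assumes key: "corner_key D D' e f" and d: "diagram D" "diagram D'" and rows: "\<And>r c. (r, c) \<in> D \<Longrightarrow> r < k" and e: "e \<le> k"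
    and U: "\<And>v. v < m \<Longrightarrow> strip (U v) (U (Suc v))" "U 0 = {}" "U m = D'"
  shows "\<exists>a T H. 0 < a \<and> a \<le> int m \<and> T 0 = {} \<and> T m = D \<and> (\<forall>v<m. strip (T v) (T (Suc v))) \<and> column_growth k m a T H \<and>
    (\<forall>v\<le>m. H 0 v = U v) \<and> (\<forall>t\<le>k. H t m = cut_chain D D' e t)"
proof -
  have c: "cut_chain D D' e 0 = D'" "cut_chain D D' e k = embed k (int m) m D"
      "\<And>t. t < k \<Longrightarrow> strip (cut_chain D D' e t) (cut_chain D D' e (Suc t))" "vertical k (step (\<lambda>t. len (cut_chain D D' e t)))"
    using cut_chain_props(1)[OF key d _ e] cut_chain_props(2)[OF key d _ e order_refl] cut_chain_props(3)[OF key d _ e]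
      cut_chain_props(4)[OF key d _ e] rows by blast+
  obtain H where H: "growth k m H" "\<And>v. v \<le> m \<Longrightarrow> H 0 v = U v" "\<And>t. t \<le> k \<Longrightarrow> H t m = cut_chain D D' e t"
    using growth_exists_rev[of m U k "cut_chain D D' e"] U c(1,3) d(2) by auto
  have "vertical k (step (\<lambda>t. len (H t m)))"
    by (rule vertical_cong[OF _ c(4)]) (simp add: step_def H(3))
  then have V: "vertical k (step (\<lambda>t. len (H t 0)))" using vertical_growth[OF H(1) order_refl] by blast
  have H0: "H t 0 = column t" if "t \<le> k" for t
    using column_if_vertical[of k "\<lambda>t. H t 0" t] growthD(2)[OF H(1), of _ 0] H(2)[of 0] U(2) V that by simp
  have "H k m = embed k (int m) m D" using H(3)[of k] c(2) by simp
  then obtain a T where "0 < a" "a \<le> int m" "T 0 = {}" "T m = D" "\<forall>v<m. strip (T v) (T (Suc v))" "\<forall>v\<le>m. H k v = embed k a v (T v)"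
    using embed_of_chain[of m "H k" k D] growthD(1)[OF H(1), of k] H0[of k] by blast
  then show ?thesis using H H0 unfolding column_growth_def by blast
qed

text \<open>If \<open>D' \<noteq> D\<close>, the box is the difference of the shapes. Otherwise
  \<open>e\<close> is betrayed by the step that fills two rows: for \<open>x < y\<close>, the end of
  row \<open>Suc x\<close> is present at time \<open>Suc x\<close> only in the chain of
  \<open>x\<close>.\<close>

lemma cut_chain_inject:
  assumes "corner_key D D' e f" "corner_key D D' e' f'" "diagram D" "diagram D'"
    "\<And>t. t \<le> k \<Longrightarrow> cut_chain D D' e t = cut_chain D D' e' t" "e \<le> k" "e' \<le> k" "\<And>r c. (r, c) \<in> D \<Longrightarrow> r < k"
  shows "e = e' \<and> f = f'"
proof (cases "D' = D")
  case False
  then show ?thesis using assms(1,2) unfolding corner_key_def by auto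
next
  case True
  have ek: "e < k" "e' < k" using assms(1,2,8) True by (auto simp: corner_key_def)
  have no: "\<not> x < y" if "x < k" "y < k" "\<And>t. t \<le> k \<Longrightarrow> cut_chain D D' x t = cut_chain D D' y t" for x y
  proof
    assume xy: "x < y"
    have "(Suc x, len D (Suc x)) \<in> cut_chain D D' x (Suc x)" by (simp add: cut_chain_def cut_def)
    then have "(Suc x, len D (Suc x)) \<in> cut_chain D D' y (Suc x)" using that(3)[of "Suc x"] that(1) by simp
    then show False using xy True mem_iff_len[OF assms(3)] by (simp add: cut_chain_def cut_def)
  qed
  have "e = e'" using no[of e e'] no[of e' e] ek assms(5) by (metis linorder_neqE_nat)
  then show ?thesis using corner_key_len_less(2)[of D e f] corner_key_len_less(2)[of D e f'] assms True by simp
qed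

section \<open>The bijection\<close>

text \<open>Here \<open>z\<close> plays the role of the reversed image. The right column of
  \<open>H'\<close> is built from the transposed corner, not by transposing that of
  \<open>H\<close>; the bottom row of \<open>G'\<close> is not prescribed but comes from the top row
  of \<open>H'\<close>.\<close>

definition partner :: "nat \<Rightarrow> int list \<Rightarrow> int list \<Rightarrow> bool" where
  "partner m w z \<longleftrightarrow> (\<exists>a x b y G H G' H' e f. w = a # x \<and> z = b # y \<and> length y = length x \<and>
     staircase m x G \<and> column_growth (length x) m a (G 0) H \<and> staircase m y G' \<and> column_growth (length x) m b (G' 0) H' \<and>
     (\<forall>v\<le>m. H' 0 v = conjugate (H 0 v)) \<and> (\<forall>t<length x. G' t m = conjugate (G t m)) \<and>
     corner_key (G 0 m) (H 0 m) e f \<and> e \<le> length x \<and> f \<le> length x \<and>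
     (\<forall>t\<le>length x. H t m = cut_chain (G 0 m) (H 0 m) e t) \<and>
     (\<forall>t\<le>length x. H' t m = cut_chain (conjugate (G 0 m)) (conjugate (H 0 m)) f t))"

lemma staircase_G0:
  assumes "staircase m x G" "x \<noteq> []"
  shows "G 0 0 = {}" "v < m \<Longrightarrow> strip (G 0 v) (G 0 (Suc v))" "v \<le> m \<Longrightarrow> diagram (G 0 v)"
    "v \<le> m \<Longrightarrow> G 0 v \<subseteq> stair (length x)"
proof -
  have g: "growth (length x - 1) m G" and l: "0 < length x" using assms by (auto simp: staircase_def)
  show G0: "G 0 0 = {}" using assms by (auto simp: staircase_def stair_def)
  show s: "strip (G 0 v) (G 0 (Suc v))" if "v < m" for v using growthD(1)[OF g le0 that] .
  show "diagram (G 0 v)" if "v \<le> m"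
  proof (cases v)
    case 0
    have "{} = stair 0" by (auto simp: stair_def)
    then show ?thesis using G0 0 diagram_stair[of 0] by simp
  next
    case (Suc u)
    then show ?thesis using stripD(2)[OF s[of u]] that by simp
  qed
  show "G 0 v \<subseteq> stair (length x)" if "v \<le> m" using staircase_rows[OF assms(1) l that] .
qed

lemma column_growth_H0:
  assumes "column_growth k m a T H"
  shows "H 0 0 = {}" "v < m \<Longrightarrow> strip (H 0 v) (H 0 (Suc v))" "v \<le> m \<Longrightarrow> diagram (H 0 v)"
proof -
  have g: "growth k m H" using assms by (simp add: column_growth_def)
  show H0: "H 0 0 = {}" using assms by (auto simp: column_growth_def column_def)
  show s: "strip (H 0 v) (H 0 (Suc v))" if "v < m" for v using growthD(1)[OF g le0 that] .
  show "diagram (H 0 v)" if "v \<le> m"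
  proof (cases v)
    case 0
    have "{} = column 0" by (auto simp: column_def)
    then show ?thesis using H0 0 stripD(1)[OF strip_column[of 0]] by simp
  next
    case (Suc u)
    then show ?thesis using stripD(2)[OF s[of u]] that by simp
  qed
qed

text \<open>The arrays for \<open>z\<close> are built backwards: \<open>H'\<close> from its bottom
  row and right column, which yields \<open>b\<close> and a tableau \<open>T\<close>, then
  \<open>G'\<close> from \<open>T\<close> and the transposed right column of
  \<open>G\<close>.\<close>

lemma partner_exists:
  assumes w: "letters m w" "length w = Suc (Suc N)"
  shows "\<exists>z. letters m z \<and> length z = length w \<and> partner m w z"
proof -
  obtain a x where ax: "w = a # x" "length x = Suc N" using w(2) by (cases w) auto
  then have xne: "x \<noteq> []" and lx: "letters m x" and a: "0 < a" "a \<le> int m" using w(1) by (auto simp: letters_def)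
  obtain G where G: "staircase m x G" using staircase_exists[OF lx xne] by blast
  note G0 = staircase_G0[OF G xne]
  obtain H where H: "column_growth (length x) m a (G 0) H" using column_growth_exists[OF G _ xne, of a] w(1) ax(1) by blast
  note H0 = column_growth_H0[OF H]
  have box: "r + c < Suc N" if "(r, c) \<in> G 0 m" for r c using G0(4)[of m] that ax(2) by (auto simp: stair_def)
  have dG: "diagram (G 0 m)" and dH: "diagram (H 0 m)" using G0(3) H0(3) by auto
  obtain e f where ef: "e \<le> length x" "corner_key (G 0 m) (H 0 m) e f" "\<And>t. t \<le> length x \<Longrightarrow> H t m = cut_chain (G 0 m) (H 0 m) e t"
    using column_growth_right[OF H a(2) _ dG] box ax(2) by (metis add_lessD1)
  have f: "f \<le> length x"
  proof (cases "H 0 m = G 0 m")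
    case True
    then have "(e, f) \<in> G 0 m" using ef(2) by (auto simp: corner_key_def)
    then show ?thesis using box[of e f] ax(2) by simp
  next
    case False
    show ?thesis
    proof (cases f)
      case (Suc d)
      have "f = len (G 0 m) e" by (rule corner_key_len[OF ef(2) dG dH False])
      then have "(e, d) \<in> G 0 m" using mem_iff_len[OF dG] Suc by simp
      then show ?thesis using box[of e d] ax(2) Suc by simp
    qed simp
  qed
  have key': "corner_key (conjugate (G 0 m)) (conjugate (H 0 m)) f e" by (rule corner_key_conj[OF ef(2)])
  have rows': "r < length x" if "(r, c) \<in> conjugate (G 0 m)" for r c using box[of c r] that ax(2) by simp
  have e0: "conjugate {} = {}" by (auto simp: conjugate_def)
  have "\<exists>b T H'. 0 < b \<and> b \<le> int m \<and> T 0 = {} \<and> T m = conjugate (G 0 m) \<and> (\<forall>v<m. strip (T v) (T (Suc v))) \<and>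
      column_growth (length x) m b T H' \<and> (\<forall>v\<le>m. H' 0 v = conjugate (H 0 v)) \<and>
      (\<forall>t\<le>length x. H' t m = cut_chain (conjugate (G 0 m)) (conjugate (H 0 m)) f t)"
  proof (rule column_growth_of_right[OF key' _ _ _ f])
    show "r < length x" if "(r, c) \<in> conjugate (G 0 m)" for r c using rows'[OF that] .
  qed (use dG dH H0 e0 in auto)
  then obtain b T H' where T: "0 < b" "b \<le> int m" "T 0 = {}" "T m = conjugate (G 0 m)" "\<forall>v<m. strip (T v) (T (Suc v))"
      "column_growth (length x) m b T H'" "\<forall>v\<le>m. H' 0 v = conjugate (H 0 v)"
      "\<forall>t\<le>length x. H' t m = cut_chain (conjugate (G 0 m)) (conjugate (H 0 m)) f t"
    by blast
  have "letters m (rev x)" "length (rev x) = Suc N" using lx ax(2) by (auto simp: letters_def)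
  then obtain y G' where y: "letters m y" "length y = Suc N" "staircase m y G'" "\<forall>v\<le>m. G' 0 v = T v"
      "\<forall>t\<le>N. G' t m = conjugate (G t m)"
    using staircase_transfer[OF staircase_rev[OF G], of N T] T(3,4,5) by auto
  have g: "column_growth (length x) m b (G' 0) H'" using T(6) y(4) by (simp add: column_growth_def)
  have c: "\<forall>t<length x. G' t m = conjugate (G t m)" using y(5) ax(2) by simp
  have len: "length y = length x" using ax(2) y(2) by simp
  have "partner m w (b # y)"
    unfolding partner_def
    by (rule exI[of _ a], rule exI[of _ x], rule exI[of _ b], rule exI[of _ y], rule exI[of _ G], rule exI[of _ H],
        rule exI[of _ G'], rule exI[of _ H'], rule exI[of _ e], rule exI[of _ f])
      (intro conjI ax(1) refl len G H y(3) g T(7) c ef(2) ef(1) f T(8) allI impI ef(3))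
  moreover have "letters m (b # y)" using y(1) T(1,2) by (simp add: letters_def)
  ultimately show ?thesis using len ax(1) by auto
qed

lemma embed_inject:
  assumes "\<And>v. v \<le> m \<Longrightarrow> embed k a v (T v) = embed k b v (U v)" "0 < a" "a \<le> int m" "0 < b" "b \<le> int m"
  shows "a = b" "v \<le> m \<Longrightarrow> T v = U v"
proof -
  have iff: "a \<le> int v \<longleftrightarrow> b \<le> int v" if "v \<le> m" for v
  proof -
    have "(k, 0) \<in> embed k a v (T v) \<longleftrightarrow> (k, 0) \<in> embed k b v (U v)" using assms(1)[OF that] by simp
    then show ?thesis by simp
  qed
  show "a = b" using iff[of "nat a"] iff[of "nat b"] assms(2-5) by (simp add: nat_le_iff)
  show "T v = U v" if "v \<le> m"
  proof -
    have "(r, c) \<in> T v \<longleftrightarrow> (r, c) \<in> U v" for r c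
      using assms(1)[OF that] mem_embed(2)[of r c k a v "T v"] mem_embed(2)[of r c k b v "U v"] by simp
    then show ?thesis by auto
  qed
qed

lemma diag_inject:
  assumes "letters m x" "letters m y" "length x = length y" "\<And>v. v \<le> m \<Longrightarrow> diag x v = diag y v"
  shows "x = y"
proof (rule nth_equalityI)
  fix i assume i: "i < length x"
  have iff: "x ! i \<le> int v \<longleftrightarrow> y ! i \<le> int v" if "v \<le> m" for v
  proof -
    obtain d where "length x = Suc (d + i)" using less_imp_Suc_add[OF i] by (auto simp: add.commute)
    moreover have "(d, i) \<in> diag x v \<longleftrightarrow> (d, i) \<in> diag y v" using assms(4)[OF that] by simp
    ultimately show ?thesis using assms(3) by (simp add: diag_def)
  qed
  show "x ! i = y ! i"
    using iff[of "nat (x ! i)"] iff[of "nat (y ! i)"] letters_nth[OF assms(1) i] letters_nth[OF assms(2), of i] i assms(3) by (simp add: nat_le_iff)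
qed (use assms in simp)

lemma conjugate_inject: "conjugate A = conjugate B \<Longrightarrow> A = B"
  by (metis conj_conj)

text \<open>The word \<open>z\<close> determines \<open>G'\<close> and \<open>H'\<close>.
  Transposing back gives the right column of \<open>G\<close> and the bottom row of
  \<open>H\<close>; the recovered corner gives the right column of \<open>H\<close>, and both arrays
  can then be run backwards to \<open>w\<close>.\<close>

lemma partner_inject:
  assumes p: "partner m w z" "partner m w' z" and l: "letters m w" "letters m w'" and len: "length w = Suc (Suc N)"
  shows "w = w'"
proof -
  obtain a x b y G H G' H' e f where 1: "w = a # x" "z = b # y" "length y = length x"
     "staircase m x G" "column_growth (length x) m a (G 0) H" "staircase m y G'" "column_growth (length x) m b (G' 0) H'"
     "\<forall>v\<le>m. H' 0 v = conjugate (H 0 v)" "\<forall>t<length x. G' t m = conjugate (G t m)"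
     "corner_key (G 0 m) (H 0 m) e f" "e \<le> length x" "f \<le> length x"
     "\<forall>t\<le>length x. H t m = cut_chain (G 0 m) (H 0 m) e t"
     "\<forall>t\<le>length x. H' t m = cut_chain (conjugate (G 0 m)) (conjugate (H 0 m)) f t"
    using p(1) unfolding partner_def by blast
  obtain c u d s K L K' L' g h where 2: "w' = c # u" "z = d # s" "length s = length u"
     "staircase m u K" "column_growth (length u) m c (K 0) L" "staircase m s K'" "column_growth (length u) m d (K' 0) L'"
     "\<forall>v\<le>m. L' 0 v = conjugate (L 0 v)" "\<forall>t<length u. K' t m = conjugate (K t m)"
     "corner_key (K 0 m) (L 0 m) g h" "g \<le> length u" "h \<le> length u"
     "\<forall>t\<le>length u. L t m = cut_chain (K 0 m) (L 0 m) g t"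
     "\<forall>t\<le>length u. L' t m = cut_chain (conjugate (K 0 m)) (conjugate (L 0 m)) h t"
    using p(2) unfolding partner_def by blast
  define k where "k = length x"
  have k: "length x = k" "length u = k" "length y = k" "0 < k" using 1(1,2,3) 2(2,3) len by (auto simp: k_def)
  have eq: "d = b" "s = y" using 1(2) 2(2) by auto
  have lx: "letters m x" "letters m u" "0 < a" "a \<le> int m" "0 < c" "c \<le> int m" using l 1(1) 2(1) by (auto simp: letters_def)
  have GK': "G' t v = K' t v" if "t < k" "v \<le> m" for t v
    by (rule growth_unique[of "k - 1" m G' K']) (use 1(6) 2(6) eq k that in \<open>auto simp: staircase_def\<close>)
  have HL': "H' t v = L' t v" if "t \<le> k" "v \<le> m" for t v
    by (rule growth_unique[of k m H' L']) (use 1(7) 2(7) eq k that GK' in \<open>auto simp: column_growth_def\<close>)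
  have GK: "G t m = K t m" if "t < k" for t
    using 1(9) 2(9) GK'[of t m] that k conjugate_inject by simp
  have HL: "H 0 v = L 0 v" if "v \<le> m" for v
    using 1(8) 2(8) HL'[of 0 v] that conjugate_inject by simp
  have ne: "x \<noteq> []" using k by auto
  have dG: "diagram (G 0 m)" using staircase_G0(3)[OF 1(4) ne] by simp
  have dH: "diagram (H 0 m)" using column_growth_H0(3)[OF 1(5)] by simp
  have box: "r < k" if "(c, r) \<in> G 0 m" for r c using staircase_G0(4)[OF 1(4) ne, of m] that k by (auto simp: stair_def)
  have "f = h \<and> e = g"
  proof (rule cut_chain_inject[of "conjugate (G 0 m)" "conjugate (H 0 m)" f e h g k])
    show "corner_key (conjugate (G 0 m)) (conjugate (H 0 m)) f e" by (rule corner_key_conj[OF 1(10)])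
    show "corner_key (conjugate (G 0 m)) (conjugate (H 0 m)) h g"
      using corner_key_conj[OF 2(10)] GK[of 0] HL[of m] k(4) by simp
    show "cut_chain (conjugate (G 0 m)) (conjugate (H 0 m)) f t = cut_chain (conjugate (G 0 m)) (conjugate (H 0 m)) h t" if "t \<le> k" for t
      using 1(14) 2(14) HL'[OF that order_refl] GK[of 0] HL[of m] k that by simp
  qed (use dG dH 1(12) 2(12) k box in auto)
  then have Hm: "H t m = L t m" if "t \<le> k" for t
    using 1(13)[rule_format, of t] 2(13)[rule_format, of t] GK[OF k(4)] HL[OF order_refl] k(1,2) that by metis
  have HLall: "H t v = L t v" if "t \<le> k" "v \<le> m" for t v
    by (rule growth_unique_rev[of k m H L]) (use 1(5) 2(5) k that HL Hm in \<open>auto simp: column_growth_def\<close>)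
  have em: "embed k a v (G 0 v) = embed k c v (K 0 v)" if "v \<le> m" for v
    using 1(5) 2(5) k HLall[OF order_refl that] that by (simp add: column_growth_def)
  have ac: "a = c" and GK0: "\<And>v. v \<le> m \<Longrightarrow> G 0 v = K 0 v"
    using embed_inject[OF em lx(3-6)] by auto
  have GKall: "G t v = K t v" if "t \<le> k - 1" "v \<le> m" for t v
  proof (rule growth_unique_rev[of "k - 1" m G K])
    show "G t m = K t m" if "t \<le> k - 1" for t by (rule GK) (use that k(4) in linarith)
  qed (use 1(4) 2(4) k that GK0 in \<open>auto simp: staircase_def\<close>)
  have "x = u"
    by (rule diag_inject[OF lx(1,2)]) (use 1(4) 2(4) k GKall[of "k - 1"] in \<open>auto simp: staircase_def\<close>)
  then show ?thesis using 1(1) 2(1) ac by simp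
qed

lemma interval_within:
  "\<exists>u v. u + v \<le> m \<and> (\<forall>w. letters m w \<longrightarrow> filter (\<lambda>x. x \<in> {a..b}) w = within u (u + v) w)"
proof -
  \<comment> \<open>Letters lie between 1 and \<open>m\<close>, so the interval is clipped to that
    range; truncated subtraction below turns an empty interval into \<open>v = 0\<close>.\<close>
  define u where "u = min m (nat (a - 1))"
  define v where "v = min m (nat b) - u"
  have "filter (\<lambda>x. x \<in> {a..b}) w = within u (u + v) w" if "letters m w" for w
    unfolding within_def
  proof (rule filter_cong[OF refl])
    fix x assume "x \<in> set w"
    then have "0 < x" "x \<le> int m" using that by (auto simp: letters_def)
    then show "x \<in> {a..b} \<longleftrightarrow> int u < x \<and> x \<le> int (u + v)" unfolding u_def v_def atLeastAtMost_iff by (cases "nat (a - 1) \<le> nat b") (simp_all, linarith+)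
  qed
  moreover have "u + v \<le> m" by (simp add: u_def v_def)
  ultimately show ?thesis by blast
qed

lemma rev_within: "rev (within u v x) = within u v (rev x)"
  by (simp add: within_def rev_filter)

lemma partner_rid:
  assumes p: "partner m w z" and l: "letters m w" "letters m z" and len: "length w = Suc (Suc N)"
  shows "w \<sim>rid rev z"
proof -
  obtain a x b y G H G' H' where 1: "w = a # x" "z = b # y" "length y = length x"
     "staircase m x G" "column_growth (length x) m a (G 0) H" "staircase m y G'" "column_growth (length x) m b (G' 0) H'"
     "\<forall>v\<le>m. H' 0 v = conjugate (H 0 v)"
    using p unfolding partner_def by blast
  have ne: "x \<noteq> []" "y \<noteq> []" using 1(1,3) len by auto
  have lz: "letters m (rev z)" using l(2) by (simp add: letters_def)
  have eq: "lis (within u (u + v) z) = lis (within u (u + v) (rev w)) \<and> lis (within u (u + v) (rev z)) = lis (within u (u + v) w)"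
    if uv: "u + v \<le> m" for u v
  proof -
    have 2: "column_growth (length y) m b (G' 0) H'" using 1(3,7) by simp
    have "inclen (step (\<lambda>v. len (H' 0 (u + v)))) v 0 = inclen (step (\<lambda>v. len (conjugate (H 0 (u + v))))) v 0"
      by (rule inclen_step_cong) (use 1(8) uv in simp)
    moreover have "inclen (step (\<lambda>v. len (conjugate (H' 0 (u + v))))) v 0 = inclen (step (\<lambda>v. len (H 0 (u + v)))) v 0"
      by (rule inclen_step_cong) (use 1(8) uv in simp)
    ultimately show ?thesis
      using lis_column_growth[OF 1(4) ne(1) 1(5) uv] lis_column_growth[OF 1(6) ne(2) 2 uv] 1(1,2) by simp
  qed
  show ?thesis unfolding rid_def
  proof (intro conjI allI)
    show "length w = length (rev z)" using 1 by simp
    fix c d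
    obtain u v where uv: "u + v \<le> m" "\<And>w. letters m w \<Longrightarrow> filter (\<lambda>x. x \<in> {c..d}) w = within u (u + v) w"
      using interval_within[of m c d] by blast
    show "lis (filter (\<lambda>x. x \<in> {c..d}) w) = lis (filter (\<lambda>x. x \<in> {c..d}) (rev z))"
      using eq[OF uv(1)] uv(2)[OF l(1)] uv(2)[OF lz] by simp
    show "lds (filter (\<lambda>x. x \<in> {c..d}) w) = lds (filter (\<lambda>x. x \<in> {c..d}) (rev z))"
      using eq[OF uv(1)] uv(2)[OF l(1)] uv(2)[OF lz] by (simp add: lds_rev rev_within)
  qed
qed

lemma partner_cid:
  assumes p: "partner m w z" and l: "letters m w" "letters m z" and len: "length w = Suc (Suc N)"
  shows "tl w \<sim>cid butlast (rev z)"
proof -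
  obtain a x b y G G' where 1: "w = a # x" "z = b # y" "length y = length x" "staircase m x G" "staircase m y G'"
     "\<forall>t<length x. G' t m = conjugate (G t m)"
    using p unfolding partner_def by blast
  have "x \<sim>cid rev y"
    by (rule cid_if_right_column_eq[of m x "rev y" N G "\<lambda>t v. conjugate (G' t v)"])
      (use 1 len l staircase_rev in \<open>auto simp: letters_def\<close>)
  then show ?thesis using 1(1,2) by simp
qed

text \<open>Intervals with a single element detect which letters occur.\<close>

lemma rid_set_eq:
  fixes w u :: "int list"
  assumes "w \<sim>rid u"
  shows "set w = set u"
proof -
  have iff: "x \<in> set v \<longleftrightarrow> lis (filter (\<lambda>y. y \<in> {x..x}) v) \<noteq> 0" for x :: int and v
  proof -
    have "x \<in> set v \<longleftrightarrow> filter (\<lambda>y. y \<in> {x..x}) v \<noteq> []" by (auto simp: filter_empty_conv)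
    then show ?thesis using lis_pos[of "filter (\<lambda>y. y \<in> {x..x}) v"] by fastforce
  qed
  have "lis (filter (\<lambda>y. y \<in> {x..x}) w) = lis (filter (\<lambda>y. y \<in> {x..x}) u)" for x
    using assms unfolding rid_def by blast
  then have "x \<in> set w \<longleftrightarrow> x \<in> set u" for x by (simp only: iff[of x])
  then show ?thesis by (rule set_eqI)
qed

theorem theorem3p2:
  fixes n :: nat
  assumes "n \<ge> 1"
  shows "\<exists>C :: int list \<Rightarrow> int list. bij_betw C (words n) (words n) \<and>
           (\<forall>w\<in>words n. w \<sim>rid C w \<and> tl w \<sim>cid butlast (C w) \<and> set (C w) = set w)"
proof (cases "n = 1")
  case True
  have "tl w \<sim>cid butlast w" if "w \<in> words n" for w
    using that True by (cases w) (auto simp: words_def cid_def)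
  then show ?thesis by (intro exI[of _ id]) (auto simp: rid_def)
next
  case False
  then obtain N where n: "n = Suc (Suc N)" using assms by (cases n; cases "n - 1") auto
  define bound where "bound w = nat (Max (set w))" for w :: "int list"
  have bound: "letters (bound w) w" if "w \<in> words n" for w
    unfolding letters_def bound_def
  proof
    fix a assume "a \<in> set w"
    then have "a \<le> Max (set w)" "0 < a" using that by (auto simp: words_def)
    then show "0 < a \<and> a \<le> int (nat (Max (set w)))" by linarith
  qed
  define Z where "Z w = (SOME z. letters (bound w) z \<and> length z = length w \<and> partner (bound w) w z)" for w
  have Z: "letters (bound w) (Z w)" "length (Z w) = n" "partner (bound w) w (Z w)" if "w \<in> words n" for w
  proof -
    have len: "length w = n" using that by (simp add: words_def)
    have "\<exists>z. letters (bound w) z \<and> length z = length w \<and> partner (bound w) w z"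
      by (rule partner_exists[OF bound[OF that]]) (use len n in simp)
    then have "letters (bound w) (Z w) \<and> length (Z w) = length w \<and> partner (bound w) w (Z w)"
      unfolding Z_def by (rule someI_ex)
    then show "letters (bound w) (Z w)" "length (Z w) = n" "partner (bound w) w (Z w)" using len by auto
  qed
  define C where "C w = rev (Z w)" for w
  have rid: "w \<sim>rid C w" and cid: "tl w \<sim>cid butlast (C w)" if "w \<in> words n" for w
    unfolding C_def using partner_rid[OF Z(3) bound Z(1)] partner_cid[OF Z(3) bound Z(1)] that n by (auto simp: words_def)
  have set: "set (C w) = set w" if "w \<in> words n" for w using rid_set_eq[OF rid[OF that]] by simp
  have inj: "inj_on C (words n)"
  proof (rule inj_onI)
    fix w w' assume w: "w \<in> words n" "w' \<in> words n" "C w = C w'"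
    \<comment> \<open>The bound depends on the set of letters only, and \<open>C\<close> preserves
      that set, so both words are compared within the same \<open>partner\<close> relation.\<close>
    have b: "bound w = bound w'" using set[OF w(1)] set[OF w(2)] w(3) by (simp add: bound_def)
    have "Z w = Z w'" using w(3) by (simp add: C_def)
    then show "w = w'"
      using partner_inject[of "bound w" w "Z w" w' N] Z(3)[OF w(1)] Z(3)[OF w(2)] bound[OF w(1)] bound[OF w(2)] b w(1) n
      by (simp add: words_def)
  qed
  have into: "C w \<in> words n" if "w \<in> words n" for w
    using set[OF that] Z(2)[OF that] that by (simp add: words_def C_def)
  have "words n \<subseteq> C ` words n"
  proof
    fix u assume u: "u \<in> words n"
    let ?S = "{w \<in> words n. set w = set u}"
    have "finite ?S"
      by (rule finite_subset[OF _ finite_lists_length_eq[of "set u" n]]) (auto simp: words_def)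
    moreover have "C ` ?S \<subseteq> ?S" using into set by auto
    moreover have "inj_on C ?S" using inj by (rule inj_on_subset) auto
    ultimately have "C ` ?S = ?S" by (rule endo_inj_surj)
    then show "u \<in> C ` words n" using u by auto
  qed
  then have "bij_betw C (words n) (words n)" using inj into unfolding bij_betw_def by blast
  then show ?thesis using rid cid set by blast
qed

end
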